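(* Suppose that $F$ has a minimizer $x_*\in\mathbb{R}^d$, that $F$ is $L$-smooth and that $\{f_{i,p}\}$ has $\mathcal{V}$-bounded variance. Consider Reg-S-SNAG-EF with $\sigma=L$, $\eta_t=\eta$, $\lambda_t=\lambda=\frac12\sqrt{\eta/\sigma}$, $\alpha_t=\frac{\lambda\sigma}{2+\lambda\sigma}$, $\beta_t=\frac{\lambda\sigma}{1+\lambda\sigma}$, $\gamma=\Theta(k/d)$ sufficiently small, and with $T=\widetilde\Theta(1/\sqrt{\eta L})$ and $S=\Theta(1+L\Delta/\varepsilon)$ sufficiently large, where $\Delta=F(x_{\mathrm{in}})-F(x_* )$. Then, for every $\varepsilon>0$, with an appropriate choice of $\eta>0$, the total number $ST$ of iterations of Reg-S-SNAG-EF for achieving $\mathbb{E}\|\nabla F(x_{\mathrm{out}})\|^2\le\varepsilon$ is $$\widetilde O\left(\frac{L\Delta}{\varepsilon}+\frac{\mathcal{V}}{P}\frac{L\Delta}{\varepsilon^2}+\left(\frac dk+\frac{d^{3/2}}{k^{3/2}\sqrt P}+\frac{d^{4/3}}{k^{4/3}P^{1/3}}\right)\frac{L\Delta}{\varepsilon}+\frac{d}{kP^{1/4}}\frac{L\mathcal{V}^{1/4}\Delta}{\varepsilon^{5/4}}\right),$$ where $x_{\mathrm{out}}=x_{\hat s}$ and $\hat s$ is drawn uniformly at random from $[S]$.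
   Context: Problem. $d,N,P$ are positive integers, $[m]=\{1,\dots,m\}$, $\|\cdot\|$ is the Euclidean norm, $f_{i,p}:\mathbb{R}^d\to\mathbb{R}$ ($i\in[N]$, $p\in[P]$) are differentiable (not necessarily convex), and $F(x)=\frac1P\sum_{p=1}^P\frac1N\sum_{i=1}^N f_{i,p}(x)$. Assumptions. $F$ is $L$-smooth ($L>0$): $\|\nabla F(x)-\nabla F(y)\|\le L\|x-y\|$ for all $x,y$. $\mathcal{V}$-bounded variance: $\frac1{NP}\sum_{i,p}\|\nabla f_{i,p}(x)-\nabla F(x)\|^2\le\mathcal{V}$ for all $x$. Random compression. For $x\in\mathbb{R}^d$ and an integer $1\le q\le d$, $\mathrm{RandComp}(x,q)$ is the random vector obtained by drawing a subset $J\subset[d]$ uniformly among all subsets with $q$ elements (independently at each call) and setting the $j$-th coordinate to $(d/q)x_j$ if $j\in J$ and to $0$ otherwise. S-SNAG-EF (for a generic objective $G=\frac1{NP}\sum_{i,p}\varphi_{i,p}$). Inputs: $x_{\mathrm{in}}\in\mathbb{R}^d$, step sizes $\eta_t,\lambda_t>0$, $\alpha_t,\beta_t\in[0,1]$, $\gamma>0$, an (even) integer $k$, and $T$. Set $x_0=y_0=z_0=x_{\mathrm{in}}$ and $m_{0,p}=m^{(y)}_{0,p}=m^{(z)}_{0,p}=0$ for $p\in[P]$. For $t=1,\dots,T$: for each $p$ draw $i_{t,p}$ uniformly from $[N]$ (independently over $t,p$), and let $h_{t,p}=\nabla \varphi_{i_{t,p},p}(x_{t-1})$. Put $g^{(y)}_{t,p}=h_{t,p}+\frac{\gamma}{\eta_t}m_{t-1,p}$,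 $g^{(z)}_{t,p}=h_{t,p}+\frac{\gamma}{\lambda_t}\big((1-\beta_t)m^{(z)}_{t-1,p}+\beta_t m_{t-1,p}\big)$, $\bar g^{(y)}_{t,p}=\mathrm{RandComp}(g^{(y)}_{t,p},k/2)$, $\bar g^{(z)}_{t,p}=\mathrm{RandComp}(g^{(z)}_{t,p},k/2)$. Update: $m^{(y)}_{t,p}=m_{t-1,p}-\eta_t(\bar g^{(y)}_{t,p}-h_{t,p})$, $m^{(z)}_{t,p}=(1-\beta_t)m^{(z)}_{t-1,p}+\beta_t m_{t-1,p}-\lambda_t(\bar g^{(z)}_{t,p}-h_{t,p})$, $m_{t,p}=(1-\alpha_t)m^{(y)}_{t,p}+\alpha_t m^{(z)}_{t,p}$; and $y_t=x_{t-1}-\eta_t\frac1P\sum_p\bar g^{(y)}_{t,p}$, $z_t=(1-\beta_t)z_{t-1}+\beta_t x_{t-1}-\lambda_t\frac1P\sum_p\bar g^{(z)}_{t,p}$, $x_t=(1-\alpha_t)y_t+\alpha_t z_t$. The output is $x_T$. Reg-S-SNAG-EF. For $z\in\mathbb{R}^d$ let $Q(z)(x)=\|x-z\|^2$. Set $x_0=x_{\mathrm{in}}$. For $s=1,\dots,S$, let $x_s$ be the output of S-SNAG-EF run for $T$ iterations with initial point $x_{s-1}$ on the regularized objective $F+\sigma Q(x_{s-1})$, i.e. with $\varphi_{i,p}=f_{i,p}+\sigma Q(x_{s-1})$, with parameters $\{\eta_t,\lambda_t,\alpha_t,\beta_t\}$, $\gamma$, $k$ (fresh independent randomness at each stage).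 Conventions. "$\gamma=\Theta(k/d)$ sufficiently small" means $\gamma=c\,k/d$ with $c>0$ a sufficiently small absolute constant. $\Theta$ hides absolute constants; $\widetilde O,\widetilde\Theta$ hide absolute constants and additional logarithmic factors in the problem parameters. "$T=\widetilde\Theta(\cdot)$ and $S=\Theta(\cdot)$ sufficiently large" means that the hidden factors are taken sufficiently large.
   Formalization: The iteration bound is stated with Δ replaced by max(Δ, ε/L): it is the printed bound when ε ≤ LΔ, and uses LΔ/ε = 1 when ε > LΔ, since as printed it tends to 0 (and is 0 for Δ = 0) although ST ≥ 1. *)

theory Defs
  imports "HOL-Probability.Probability"
begin

text \<open>
  The hidden constants must be uniform in the dimension d, so d has to be a bound
  term-level variable. Points of d-dimensional space are therefore sequences in
  \<open>topspace (Euclidean_space d)\<close>, i.e. functions \<open>nat \<Rightarrow> real\<close> vanishing at all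
  indices \<open>\<ge> d\<close>; the coordinates are indexed by \<open>{..<d}\<close>.
\<close>

type_synonym rvec = "nat \<Rightarrow> real"

abbreviation Rsp :: "nat \<Rightarrow> rvec set" where
  "Rsp d \<equiv> topspace (Euclidean_space d)"

definition enorm :: "nat \<Rightarrow> rvec \<Rightarrow> real" where
  "enorm d x = L2_set x {..<d}"

definition edist :: "nat \<Rightarrow> rvec \<Rightarrow> rvec \<Rightarrow> real" where
  "edist d x y = enorm d (\<lambda>j. x j - y j)"

text \<open>Frechet differentiability at x, with the derivative represented by the vector g.\<close>

definition has_gradient :: "nat \<Rightarrow> (rvec \<Rightarrow> real) \<Rightarrow> rvec \<Rightarrow> rvec \<Rightarrow> bool" where
  "has_gradient d f x g \<longleftrightarrow> g \<in> Rsp d \<and>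
     (\<forall>e>0. \<exists>\<delta>>0. \<forall>y\<in>Rsp d. edist d y x < \<delta> \<longrightarrow>
        \<bar>f y - f x - (\<Sum>j<d. g j * (y j - x j))\<bar> \<le> e * edist d y x)"

definition differentiable_on_Rsp :: "nat \<Rightarrow> (rvec \<Rightarrow> real) \<Rightarrow> bool" where
  "differentiable_on_Rsp d f \<longleftrightarrow> (\<forall>x\<in>Rsp d. \<exists>g. has_gradient d f x g)"

definition grad :: "nat \<Rightarrow> (rvec \<Rightarrow> real) \<Rightarrow> rvec \<Rightarrow> rvec" where
  "grad d f x = (THE g. has_gradient d f x g)"

lemma has_gradient_unique:
  assumes x: "x \<in> Rsp d" and g: "has_gradient d f x g" and h: "has_gradient d f x h"
  shows "g = h"
proof
  fix i
  show "g i = h i"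
  proof (cases "i < d")
    case False
    then show ?thesis
      using g h by (auto simp: has_gradient_def topspace_Euclidean_space)
  next
    case True
    show ?thesis
    proof (rule ccontr)
      assume ne: "g i \<noteq> h i"
      define e where "e = \<bar>g i - h i\<bar> / 3"
      have e: "e > 0" using ne by (simp add: e_def)
      obtain d1 where d1: "d1 > 0" and g1: "\<And>y. y \<in> Rsp d \<Longrightarrow> edist d y x < d1 \<Longrightarrow>
          \<bar>f y - f x - (\<Sum>j<d. g j * (y j - x j))\<bar> \<le> e * edist d y x"
        using g e unfolding has_gradient_def by blast
      obtain d2 where d2: "d2 > 0" and h1: "\<And>y. y \<in> Rsp d \<Longrightarrow> edist d y x < d2 \<Longrightarrow>
          \<bar>f y - f x - (\<Sum>j<d. h j * (y j - x j))\<bar> \<le> e * edist d y x"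
        using h e unfolding has_gradient_def by blast
      define t where "t = min d1 d2 / 2"
      have t: "t > 0" "t < d1" "t < d2" using d1 d2 by (auto simp: t_def)
      define y where "y = x(i := x i + t)"
      have y: "y \<in> Rsp d"
        using x True by (auto simp: y_def topspace_Euclidean_space)
      have yx: "y j - x j = (if j = i then t else 0)" for j
        by (simp add: y_def)
      have dist: "edist d y x = t"
        using True t by (simp add: edist_def enorm_def L2_set_def yx if_distrib
            [of "\<lambda>u::real. u ^ 2"] cong: if_cong)
      have sum: "(\<Sum>j<d. u j * (y j - x j)) = u i * t" for u :: rvec
        using True by (simp add: yx if_distrib [of "\<lambda>v. _ * v"] cong: if_cong)
      have "\<bar>f y - f x - g i * t\<bar> \<le> e * t" "\<bar>f y - f x - h i * t\<bar> \<le> e * t"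
        using g1[OF y] h1[OF y] t by (simp_all add: dist sum)
      then have "\<bar>g i * t - h i * t\<bar> \<le> 2 * (e * t)" by linarith
      then have "\<bar>g i - h i\<bar> * t \<le> (2 * e) * t"
        using t by (simp add: abs_mult flip: left_diff_distrib)
      then have "\<bar>g i - h i\<bar> \<le> 2 * e" using t by simp
      then show False using e by (simp add: e_def)
    qed
  qed
qed

lemma grad_eqI: "x \<in> Rsp d \<Longrightarrow> has_gradient d f x g \<Longrightarrow> grad d f x = g"
  unfolding grad_def using has_gradient_unique by blast

definition objective :: "nat \<Rightarrow> nat \<Rightarrow> (nat \<Rightarrow> nat \<Rightarrow> rvec \<Rightarrow> real) \<Rightarrow> rvec \<Rightarrow> real" where
  "objective N P f x = 1 / real P * (\<Sum>p=1..P. 1 / real N * (\<Sum>i=1..N. f i p x))"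

definition smooth :: "nat \<Rightarrow> real \<Rightarrow> (rvec \<Rightarrow> real) \<Rightarrow> bool" where
  "smooth d L F \<longleftrightarrow>
     (\<forall>x\<in>Rsp d. \<forall>y\<in>Rsp d. edist d (grad d F x) (grad d F y) \<le> L * edist d x y)"

definition bounded_variance ::
  "nat \<Rightarrow> nat \<Rightarrow> nat \<Rightarrow> real \<Rightarrow> (nat \<Rightarrow> nat \<Rightarrow> rvec \<Rightarrow> real) \<Rightarrow> bool" where
  "bounded_variance d N P V f \<longleftrightarrow>
     (\<forall>x\<in>Rsp d. 1 / (real N * real P) *
        (\<Sum>i=1..N. \<Sum>p=1..P. (edist d (grad d (f i p) x) (grad d (objective N P f) x))\<^sup>2) \<le> V)"

definition rand_comp :: "nat \<Rightarrow> nat \<Rightarrow> rvec \<Rightarrow> rvec pmf" where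
  "rand_comp d q x =
     map_pmf (\<lambda>J j. if j \<in> J then real d / real q * x j else 0)
       (pmf_of_set {J. J \<subseteq> {..<d} \<and> card J = q})"

text \<open>
  The state after iteration t is \<open>(x\<^sub>t, z\<^sub>t, m\<^sub>t, m\<^sub>t\<^sup>z)\<close>, where the last two components
  map a worker \<open>p \<in> {1..P}\<close> to its error memory; \<open>y\<^sub>t\<close> and \<open>m\<^sub>t\<^sup>y\<close> are not read by later
  iterations. All draws of one iteration are independent over the workers (\<open>Pi_pmf\<close>), and the
  two compressions are separate draws; the second argument of \<open>Pi_pmf\<close> is an irrelevant
  default for \<open>p \<notin> {1..P}\<close>.
\<close>

type_synonym snag_state = "rvec \<times> rvec \<times> (nat \<Rightarrow> rvec) \<times> (nat \<Rightarrow> rvec)"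

definition snag_step ::
  "nat \<Rightarrow> nat \<Rightarrow> nat \<Rightarrow> nat \<Rightarrow> real \<Rightarrow> (nat \<Rightarrow> nat \<Rightarrow> rvec \<Rightarrow> real) \<Rightarrow>
   real \<Rightarrow> real \<Rightarrow> real \<Rightarrow> real \<Rightarrow> snag_state \<Rightarrow> snag_state pmf" where
  "snag_step d N P k \<gamma> \<phi> \<eta> lam \<alpha> \<beta> = (\<lambda>(x, z, m, mz). do {
     i \<leftarrow> Pi_pmf {1..P} 0 (\<lambda>_. pmf_of_set {1..N});
     let h = (\<lambda>p. grad d (\<phi> (i p) p) x);
     let w = (\<lambda>p j. (1 - \<beta>) * mz p j + \<beta> * m p j);
     let gy = (\<lambda>p j. h p j + \<gamma> / \<eta> * m p j);
     let gz = (\<lambda>p j. h p j + \<gamma> / lam * w p j);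
     cy \<leftarrow> Pi_pmf {1..P} (\<lambda>_. 0) (\<lambda>p. rand_comp d (k div 2) (gy p));
     cz \<leftarrow> Pi_pmf {1..P} (\<lambda>_. 0) (\<lambda>p. rand_comp d (k div 2) (gz p));
     let my' = (\<lambda>p j. m p j - \<eta> * (cy p j - h p j));
     let mz' = (\<lambda>p j. w p j - lam * (cz p j - h p j));
     let m' = (\<lambda>p j. (1 - \<alpha>) * my' p j + \<alpha> * mz' p j);
     let y' = (\<lambda>j. x j - \<eta> * (1 / real P * (\<Sum>p=1..P. cy p j)));
     let z' = (\<lambda>j. (1 - \<beta>) * z j + \<beta> * x j - lam * (1 / real P * (\<Sum>p=1..P. cz p j)));
     let x' = (\<lambda>j. (1 - \<alpha>) * y' j + \<alpha> * z' j);
     return_pmf (x', z', m', mz')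
   })"

primrec snag_run ::
  "nat \<Rightarrow> nat \<Rightarrow> nat \<Rightarrow> nat \<Rightarrow> real \<Rightarrow> (nat \<Rightarrow> nat \<Rightarrow> rvec \<Rightarrow> real) \<Rightarrow>
   (nat \<Rightarrow> real) \<Rightarrow> (nat \<Rightarrow> real) \<Rightarrow> (nat \<Rightarrow> real) \<Rightarrow> (nat \<Rightarrow> real) \<Rightarrow> rvec \<Rightarrow> nat \<Rightarrow>
   snag_state pmf" where
  "snag_run d N P k \<gamma> \<phi> \<eta> lam \<alpha> \<beta> xin 0 = return_pmf (xin, xin, \<lambda>_ _. 0, \<lambda>_ _. 0)"
| "snag_run d N P k \<gamma> \<phi> \<eta> lam \<alpha> \<beta> xin (Suc t) =
     bind_pmf (snag_run d N P k \<gamma> \<phi> \<eta> lam \<alpha> \<beta> xin t)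
       (snag_step d N P k \<gamma> \<phi> (\<eta> (Suc t)) (lam (Suc t)) (\<alpha> (Suc t)) (\<beta> (Suc t)))"

definition s_snag_ef ::
  "nat \<Rightarrow> nat \<Rightarrow> nat \<Rightarrow> nat \<Rightarrow> real \<Rightarrow> (nat \<Rightarrow> nat \<Rightarrow> rvec \<Rightarrow> real) \<Rightarrow>
   (nat \<Rightarrow> real) \<Rightarrow> (nat \<Rightarrow> real) \<Rightarrow> (nat \<Rightarrow> real) \<Rightarrow> (nat \<Rightarrow> real) \<Rightarrow> nat \<Rightarrow> rvec \<Rightarrow> rvec pmf" where
  "s_snag_ef d N P k \<gamma> \<phi> \<eta> lam \<alpha> \<beta> T xin =
     map_pmf fst (snag_run d N P k \<gamma> \<phi> \<eta> lam \<alpha> \<beta> xin T)"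

definition regularized ::
  "nat \<Rightarrow> real \<Rightarrow> (nat \<Rightarrow> nat \<Rightarrow> rvec \<Rightarrow> real) \<Rightarrow> rvec \<Rightarrow> nat \<Rightarrow> nat \<Rightarrow> rvec \<Rightarrow> real" where
  "regularized d \<sigma> f z = (\<lambda>i p x. f i p x + \<sigma> * (edist d x z)\<^sup>2)"

text \<open>Joint law of the list of stage iterates \<open>[x\<^sub>0, \<dots>, x\<^sub>S]\<close>.\<close>

primrec reg_s_snag_ef ::
  "nat \<Rightarrow> nat \<Rightarrow> nat \<Rightarrow> nat \<Rightarrow> real \<Rightarrow> real \<Rightarrow> (nat \<Rightarrow> nat \<Rightarrow> rvec \<Rightarrow> real) \<Rightarrow>
   (nat \<Rightarrow> real) \<Rightarrow> (nat \<Rightarrow> real) \<Rightarrow> (nat \<Rightarrow> real) \<Rightarrow> (nat \<Rightarrow> real) \<Rightarrow> nat \<Rightarrow> rvec \<Rightarrow> nat \<Rightarrow>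
   rvec list pmf" where
  "reg_s_snag_ef d N P k \<gamma> \<sigma> f \<eta> lam \<alpha> \<beta> T xin 0 = return_pmf [xin]"
| "reg_s_snag_ef d N P k \<gamma> \<sigma> f \<eta> lam \<alpha> \<beta> T xin (Suc s) = do {
     xs \<leftarrow> reg_s_snag_ef d N P k \<gamma> \<sigma> f \<eta> lam \<alpha> \<beta> T xin s;
     x \<leftarrow> s_snag_ef d N P k \<gamma> (regularized d \<sigma> f (last xs)) \<eta> lam \<alpha> \<beta> T (last xs);
     return_pmf (xs @ [x])
   }"

definition reg_output ::
  "nat \<Rightarrow> nat \<Rightarrow> nat \<Rightarrow> nat \<Rightarrow> real \<Rightarrow> real \<Rightarrow> (nat \<Rightarrow> nat \<Rightarrow> rvec \<Rightarrow> real) \<Rightarrow>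
   (nat \<Rightarrow> real) \<Rightarrow> (nat \<Rightarrow> real) \<Rightarrow> (nat \<Rightarrow> real) \<Rightarrow> (nat \<Rightarrow> real) \<Rightarrow> nat \<Rightarrow> nat \<Rightarrow> rvec \<Rightarrow>
   rvec pmf" where
  "reg_output d N P k \<gamma> \<sigma> f \<eta> lam \<alpha> \<beta> T S xin = do {
     xs \<leftarrow> reg_s_snag_ef d N P k \<gamma> \<sigma> f \<eta> lam \<alpha> \<beta> T xin S;
     s \<leftarrow> pmf_of_set {1..S};
     return_pmf (xs ! s)
   }"

text \<open>
  D is the initial gap \<open>\<Delta>\<close>. At least one stage and one iteration are always run, whereas
  this expression tends to 0 with \<open>L * \<Delta> / \<epsilon>\<close>; bounds on the number of iterations valid
  for every \<open>\<epsilon> > 0\<close> therefore use \<open>D = max \<Delta> (\<epsilon> / L)\<close>, which is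
  \<open>\<Delta>\<close> as long as \<open>\<epsilon> \<le> L * \<Delta>\<close>.
\<close>

definition rate :: "real \<Rightarrow> real \<Rightarrow> real \<Rightarrow> real \<Rightarrow> real \<Rightarrow> real \<Rightarrow> real \<Rightarrow> real" where
  "rate d k P L V D \<epsilon> =
     L * D / \<epsilon> + V / P * (L * D / \<epsilon>\<^sup>2)
     + (d / k + d powr (3/2) / (k powr (3/2) * sqrt P)
          + d powr (4/3) / (k powr (4/3) * P powr (1/3))) * (L * D / \<epsilon>)
     + d / (k * P powr (1/4)) * (L * V powr (1/4) * D / \<epsilon> powr (5/4))"

text \<open>
  The logarithmic factor hidden by the soft-O notation is a power of this quantity, which is
  at least 1 and involves only scale-invariant combinations of the problem parameters.
\<close>

definition log_factor :: "real \<Rightarrow> real \<Rightarrow> real \<Rightarrow> real \<Rightarrow> real \<Rightarrow> real \<Rightarrow> real" where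
  "log_factor d P L V D \<epsilon> = ln (exp 1 + d + P + L * D / \<epsilon> + V / \<epsilon>)"

end

theory Submission
  imports Defs
begin

text \<open>
  With \<open>\<sigma> = L\<close> every regularized objective \<open>G\<close> is \<open>L\<close>-strongly convex with \<open>3 L\<close>-Lipschitz gradient.
  Subtracting the averaged error memories from \<open>x\<^sub>t\<close> and \<open>z\<^sub>t\<close> gives virtual iterates that
  perform Nesterov's method exactly, except that the stochastic gradient is taken at \<open>x\<^sub>t\<close>. With
  \<open>\<theta> = lam L\<close>, so \<open>\<eta> = 4 \<theta>\<^sup>2 / L\<close>, the usual potential of that method contracts by \<open>1 - \<theta> / 4\<close> up
  to a noise term and a multiple of the squared averaged memory. The memories themselves contract by
  \<open>1 - \<gamma>\<close> and \<open>1 - \<gamma> / 2\<close> up to gradient terms, which the potential dominates since the condition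
  number is bounded; as \<open>\<theta>\<close> is much smaller than \<open>\<gamma>\<close>, the coupled recursions close.
  A stage hence reduces the gap \<open>G - G\<^sub>m\<^sub>i\<^sub>n\<close> by a factor 10 up to an error of order \<open>\<epsilon> / L\<close>. For the
  inexact proximal point iteration this makes \<open>\<parallel>\<nabla>F(x\<^sub>s)\<parallel>\<^sup>2 + 8 L F(x\<^sub>s)\<close> at most
  \<open>8 L F(x\<^sub>s\<^sub>-\<^sub>1) + \<epsilon> / 2\<close> in expectation, and summing over the stages telescopes.
\<close>

section \<open>Finitely supported random variables and random compression\<close>

text \<open>The virtual iterates follow Nesterov's method because a compressed gradient enters an
  iterate and its averaged memory with the same step size: it cancels in the difference, and only
  the sampled gradient survives. Compression noise is therefore felt only through the point at which
  the gradient is taken. This creates the circularity that shapes the proof: the gradient error is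
  at most \<open>3 * \<sigma>\<close> times the averaged memory, the memories are fed by gradients
  at the true iterates, and these gradients are bounded by potential plus memory. The loop gain is
  small for two reasons. The step \<open>\<eta>\<close> of the memory of \<open>y\<close> is of
  order \<open>\<theta>^2\<close>, whereas \<open>lam\<close> is of order \<open>\<theta>\<close>;
  and the larger memory of \<open>z\<close> reaches \<open>x\<close> only with the weight
  \<open>\<alpha>\<close>, which is at most \<open>\<theta> / 2\<close>. The powers of ten are slack
  for closing the induction and are not tuned. All distributions involved have finite support, so
  expectations are finite sums and integrability is automatic.\<close>

abbreviation (input) expect :: "'a pmf \<Rightarrow> ('a \<Rightarrow> real) \<Rightarrow> real" where
  "expect \<equiv> measure_pmf.expectation"

lemma expect_bind:
  assumes "finite (set_pmf p)" "\<And>x. x \<in> set_pmf p \<Longrightarrow> finite (set_pmf (f x))"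
  shows "expect (bind_pmf p f) h = expect p (\<lambda>x. expect (f x) h)"
  using assms
  by (subst pmf_expectation_bind[of "set_pmf p"], simp, simp, simp,
      subst integral_measure_pmf[of "set_pmf p"]) auto

lemma expect_mono:
  assumes "finite (set_pmf p)" "\<And>x. x \<in> set_pmf p \<Longrightarrow> f x \<le> g x"
  shows "expect p f \<le> expect p g"
  using assms by (intro integral_mono_AE integrable_measure_pmf_finite) (auto simp: AE_measure_pmf_iff)

lemma expect_nonneg: "(\<And>x. 0 \<le> f x) \<Longrightarrow> 0 \<le> expect p f"
  by (rule integral_nonneg_AE) simp

lemma expect_cong:
  assumes "\<And>x. x \<in> set_pmf p \<Longrightarrow> f x = g x"
  shows "expect p f = expect p g"
  using assms by (intro integral_cong_AE) (auto simp: AE_measure_pmf_iff)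

lemma expect_add:
  assumes "finite (set_pmf p)"
  shows "expect p (\<lambda>x. f x + g x) = expect p f + expect p g"
  using assms by (intro Bochner_Integration.integral_add integrable_measure_pmf_finite)

lemma expect_diff:
  assumes "finite (set_pmf p)"
  shows "expect p (\<lambda>x. f x - g x) = expect p f - expect p g"
  using assms by (intro Bochner_Integration.integral_diff integrable_measure_pmf_finite)

lemma expect_sum:
  assumes "finite (set_pmf p)"
  shows "expect p (\<lambda>x. \<Sum>i\<in>I. f i x) = (\<Sum>i\<in>I. expect p (f i))"
  using assms by (intro Bochner_Integration.integral_sum integrable_measure_pmf_finite)

text \<open>Bias-variance decomposition: after centring \<open>X\<close> at its mean the cross term
  has expectation zero. The affine form covers gradient steps and compressed memory updates
  alike.\<close>

lemma expect_square_affine: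
  fixes X :: "'a \<Rightarrow> real"
  assumes "finite (set_pmf p)"
  shows "expect p (\<lambda>y. (a + b * X y)\<^sup>2) =
    (a + b * expect p X)\<^sup>2 + b\<^sup>2 * expect p (\<lambda>y. (X y - expect p X)\<^sup>2)"
proof -
  define m where "m = expect p X"
  have 1: "expect p (\<lambda>y. X y - m) = 0"
    using assms by (simp add: expect_diff m_def)
  have "expect p (\<lambda>y. (a + b * X y)\<^sup>2) =
      expect p (\<lambda>y. (a + b * m)\<^sup>2 + (2 * (a + b * m) * b * (X y - m) + b\<^sup>2 * (X y - m)\<^sup>2))"
    by (intro expect_cong) (simp add: power2_eq_square algebra_simps)
  also have "\<dots> = (a + b * m)\<^sup>2 + b\<^sup>2 * expect p (\<lambda>y. (X y - m)\<^sup>2)"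
    using assms 1 by (simp add: expect_add)
  finally show ?thesis by (simp add: m_def)
qed

text \<open>The mean is the best constant predictor. This later trades a worker's own mean gradient
  for the gradient of the objective, around which the variance assumption is stated.\<close>

lemma expect_square_deviation_le:
  fixes X :: "'a \<Rightarrow> real"
  assumes "finite (set_pmf p)"
  shows "expect p (\<lambda>y. (X y - expect p X)\<^sup>2) \<le> expect p (\<lambda>y. (X y - a)\<^sup>2)"
  using expect_square_affine[OF assms, of "-a" 1 X] by simp

section \<open>Independent draws over the workers\<close>

lemma finite_set_Pi_pmf:
  assumes "finite A" "\<And>p. p \<in> A \<Longrightarrow> finite (set_pmf (Q p))"
  shows "finite (set_pmf (Pi_pmf A dflt Q))"
  using assms by (simp add: set_Pi_pmf finite_PiE_dflt)

lemma expect_Pi_component: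
  assumes "finite A" "x \<in> A"
  shows "expect (Pi_pmf A dflt Q) (\<lambda>f. X (f x)) = expect (Q x) X"
proof -
  have "expect (Pi_pmf A dflt Q) (\<lambda>f. X (f x)) = expect (map_pmf (\<lambda>f. f x) (Pi_pmf A dflt Q)) X"
    by simp
  also have "map_pmf (\<lambda>f. f x) (Pi_pmf A dflt Q) = Q x"
    using assms by (simp add: Pi_pmf_component)
  finally show ?thesis .
qed

text \<open>Independence enters here: cross terms between different workers vanish. The shift
  \<open>a\<close> is generalized because conditioning on the coordinate \<open>x\<close> moves its
  contribution \<open>X x y\<close> into it.\<close>

lemma expect_Pi_square_centered:
  fixes X :: "'a \<Rightarrow> 'b \<Rightarrow> real"
  assumes "finite A" "\<And>p. p \<in> A \<Longrightarrow> finite (set_pmf (Q p))"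
    "\<And>p. p \<in> A \<Longrightarrow> expect (Q p) (X p) = 0"
  shows "expect (Pi_pmf A dflt Q) (\<lambda>f. (a + (\<Sum>p\<in>A. X p (f p)))\<^sup>2) =
    a\<^sup>2 + (\<Sum>p\<in>A. expect (Q p) (\<lambda>y. (X p y)\<^sup>2))"
  using assms
proof (induction A arbitrary: a rule: finite_induct)
  case empty
  then show ?case by simp
next
  case (insert x A)
  have fin: "finite (set_pmf (Pi_pmf A dflt Q))"
    using insert by (intro finite_set_Pi_pmf) auto
  have sum: "(\<Sum>p\<in>A. X p ((f(x := y)) p)) = (\<Sum>p\<in>A. X p (f p))" for f y
    using insert.hyps by (intro sum.cong) auto
  have "expect (Pi_pmf (insert x A) dflt Q) (\<lambda>f. (a + (\<Sum>p\<in>insert x A. X p (f p)))\<^sup>2) =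
      expect (Q x) (\<lambda>y. expect (Pi_pmf A dflt Q) (\<lambda>f. ((a + X x y) + (\<Sum>p\<in>A. X p (f p)))\<^sup>2))"
    using insert fin
    by (subst Pi_pmf_insert', simp, simp, subst expect_bind, simp, simp, subst expect_bind)
      (simp_all add: sum add.assoc fun_upd_same del: fun_upd_apply)
  also have "\<dots> = expect (Q x) (\<lambda>y. (a + 1 * X x y)\<^sup>2 + (\<Sum>p\<in>A. expect (Q p) (\<lambda>y. (X p y)\<^sup>2)))"
    using insert by simp
  also have "\<dots> = a\<^sup>2 + (\<Sum>p\<in>insert x A. expect (Q p) (\<lambda>y. (X p y)\<^sup>2))"
    using insert expect_square_affine[of "Q x" a 1 "X x"] by (simp add: expect_add)
  finally show ?case .
qed

lemma expect_Pi_square: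
  fixes X :: "'a \<Rightarrow> 'b \<Rightarrow> real"
  assumes "finite A" "\<And>p. p \<in> A \<Longrightarrow> finite (set_pmf (Q p))"
    "\<And>p. p \<in> A \<Longrightarrow> expect (Q p) (X p) = \<mu> p"
  shows "expect (Pi_pmf A dflt Q) (\<lambda>f. (a + (\<Sum>p\<in>A. X p (f p)))\<^sup>2) =
    (a + (\<Sum>p\<in>A. \<mu> p))\<^sup>2 + (\<Sum>p\<in>A. expect (Q p) (\<lambda>y. (X p y - \<mu> p)\<^sup>2))"
proof -
  have "expect (Pi_pmf A dflt Q) (\<lambda>f. ((a + (\<Sum>p\<in>A. \<mu> p)) + (\<Sum>p\<in>A. X p (f p) - \<mu> p))\<^sup>2) =
    (a + (\<Sum>p\<in>A. \<mu> p))\<^sup>2 + (\<Sum>p\<in>A. expect (Q p) (\<lambda>y. (X p y - \<mu> p)\<^sup>2))"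
    using assms by (intro expect_Pi_square_centered) (auto simp: expect_diff)
  then show ?thesis by (simp add: sum_subtractf)
qed

lemma expect_Pi_sum:
  assumes "finite A" "\<And>p. p \<in> A \<Longrightarrow> finite (set_pmf (Q p))"
  shows "expect (Pi_pmf A dflt Q) (\<lambda>f. \<Sum>p\<in>A. X p (f p)) = (\<Sum>p\<in>A. expect (Q p) (X p))"
  using assms by (simp add: expect_sum finite_set_Pi_pmf expect_Pi_component)

section \<open>Random coordinate subsets and the compression operator\<close>

lemma card_subsets_containing:
  assumes "j < d" "0 < q"
  shows "card {J. J \<subseteq> {..<d} \<and> card J = q \<and> j \<in> J} = (d - 1) choose (q - 1)"
proof -
  have "bij_betw (insert j) {J. J \<subseteq> {..<d} - {j} \<and> card J = q - 1}
      {J. J \<subseteq> {..<d} \<and> card J = q \<and> j \<in> J}"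
  proof (rule bij_betw_byWitness[where f' = "\<lambda>J. J - {j}"])
    have fin: "finite J" if "J \<subseteq> {..<d}" for J using that finite_subset by blast
    show "insert j ` {J. J \<subseteq> {..<d} - {j} \<and> card J = q - 1} \<subseteq> {J. J \<subseteq> {..<d} \<and> card J = q \<and> j \<in> J}"
    proof (clarsimp, intro conjI)
      fix J assume J: "J \<subseteq> {..<d} - {j}" "card J = q - Suc 0"
      then show "j < d" "J \<subseteq> {..<d}" using assms by auto
      have "finite J" "j \<notin> J" using J fin[of J] by auto
      then show "card (insert j J) = q" using J assms by simp
    qed
    show "(\<lambda>J. J - {j}) ` {J. J \<subseteq> {..<d} \<and> card J = q \<and> j \<in> J} \<subseteq> {J. J \<subseteq> {..<d} - {j} \<and> card J = q - 1}"
      using fin by auto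
  qed auto
  then have "card {J. J \<subseteq> {..<d} \<and> card J = q \<and> j \<in> J} = card {J. J \<subseteq> {..<d} - {j} \<and> card J = q - 1}"
    by (simp add: bij_betw_same_card)
  also have "\<dots> = card ({..<d} - {j}) choose (q - 1)"
    by (intro n_subsets) auto
  finally show ?thesis using assms by simp
qed

context
  fixes d q :: nat
  assumes q: "1 \<le> q" "q \<le> d"
begin

lemma finite_fixed_size_subsets: "finite {J. J \<subseteq> {..<d} \<and> card J = q}"
  by (rule finite_subset[of _ "Pow {..<d}"]) auto

lemma fixed_size_subsets_nonempty: "{J. J \<subseteq> {..<d} \<and> card J = q} \<noteq> {}"
proof -
  have "{..<q} \<in> {J. J \<subseteq> {..<d} \<and> card J = q}" using q by auto
  then show ?thesis by blast
qed

lemma set_rand_comp: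
  "set_pmf (rand_comp d q x) =
    (\<lambda>J j. if j \<in> J then real d / real q * x j else 0) ` {J. J \<subseteq> {..<d} \<and> card J = q}"
  unfolding rand_comp_def using finite_fixed_size_subsets fixed_size_subsets_nonempty by simp

lemma finite_set_rand_comp: "finite (set_pmf (rand_comp d q x))"
  using finite_fixed_size_subsets by (simp add: set_rand_comp)

lemma rand_comp_in_Rsp: "c \<in> set_pmf (rand_comp d q x) \<Longrightarrow> c \<in> Rsp d"
  by (auto simp: set_rand_comp topspace_Euclidean_space)

text \<open>A coordinate has a two-point law, since a random \<open>q\<close>-subset contains
  \<open>j\<close> with probability \<open>q / d\<close>. Such marginals are enough for the whole
  analysis: squared norms are sums over coordinates, so the dependence between coordinates of one
  compression never shows.\<close>

lemma expect_rand_comp_coordinate: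
  assumes j: "j < d"
  shows "expect (rand_comp d q x) (\<lambda>c. u (c j)) =
    real q / real d * u (real d / real q * x j) + (1 - real q / real d) * u 0"
proof -
  define S where "S = {J. J \<subseteq> {..<d} \<and> card J = q}"
  define S1 where "S1 = {J. J \<subseteq> {..<d} \<and> card J = q \<and> j \<in> J}"
  have fin: "finite S" "S \<noteq> {}"
    using finite_fixed_size_subsets fixed_size_subsets_nonempty by (auto simp: S_def)
  have sub: "S1 \<subseteq> S" "finite S1" using fin by (auto simp: S_def S1_def)
  have cS: "card S = d choose q" by (simp add: S_def n_subsets)
  have cS1: "card S1 = (d - 1) choose (q - 1)"
    unfolding S1_def using card_subsets_containing j q by simp
  have "q * (d choose q) = d * ((d - 1) choose (q - 1))"
    using q by (intro times_binomial_minus1_eq) simp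
  then have "real q * real (card S) = real d * real (card S1)"
    unfolding cS cS1 by (metis of_nat_mult)
  moreover have "card S > 0" using fin by (simp add: card_gt_0_iff)
  ultimately have frac: "real (card S1) / real (card S) = real q / real d"
    using q by (simp add: field_simps)
  have "expect (rand_comp d q x) (\<lambda>c. u (c j)) =
      (\<Sum>J\<in>S. u (if j \<in> J then real d / real q * x j else 0)) / card S"
    unfolding rand_comp_def S_def[symmetric] using fin by (simp add: integral_pmf_of_set)
  also have "(\<Sum>J\<in>S. u (if j \<in> J then real d / real q * x j else 0)) =
      (\<Sum>J\<in>S1. u (real d / real q * x j)) + (\<Sum>J\<in>S - S1. u 0)"
    using fin sub by (subst sum.subset_diff[OF sub(1) fin(1)])
      (auto simp: S1_def S_def add.commute intro!: arg_cong2[where f="(+)"] sum.cong)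
  also have "\<dots> = real (card S1) * u (real d / real q * x j) + (real (card S) - real (card S1)) * u 0"
    using fin sub by (simp add: card_Diff_subset of_nat_diff card_mono)
  also have "\<dots> / card S = real q / real d * u (real d / real q * x j) + (1 - real q / real d) * u 0"
    unfolding frac[symmetric] using \<open>card S > 0\<close> by (simp add: field_simps)
  finally show ?thesis .
qed

lemma expect_rand_comp:
  assumes j: "j < d"
  shows "expect (rand_comp d q x) (\<lambda>c. c j) = x j"
  using expect_rand_comp_coordinate[OF j, of x "\<lambda>c. c"] q by simp

lemma expect_rand_comp_deviation:
  assumes j: "j < d"
  shows "expect (rand_comp d q x) (\<lambda>c. (c j - x j)\<^sup>2) = (real d / real q - 1) * (x j)\<^sup>2"
proof -
  have "expect (rand_comp d q x) (\<lambda>c. (c j - x j)\<^sup>2) =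
      real q / real d * (real d / real q * x j - x j)\<^sup>2 + (1 - real q / real d) * (x j)\<^sup>2"
    using expect_rand_comp_coordinate[OF j, of x "\<lambda>c. (c - x j)\<^sup>2"] by simp
  also have "\<dots> = (real d / real q - 1) * (x j)\<^sup>2"
    using q by (simp add: field_simps power2_eq_square)
  finally show ?thesis .
qed

end

section \<open>Gradients and quadratic growth\<close>

definition ip :: "nat \<Rightarrow> rvec \<Rightarrow> rvec \<Rightarrow> real" where
  "ip d x y = (\<Sum>j<d. x j * y j)"

definition nsq :: "nat \<Rightarrow> rvec \<Rightarrow> real" where
  "nsq d x = (\<Sum>j<d. (x j)\<^sup>2)"

lemma nsq_nonneg [simp]: "0 \<le> nsq d x"
  by (simp add: nsq_def sum_nonneg)

lemma enorm_square: "(enorm d x)\<^sup>2 = nsq d x"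
  by (simp add: enorm_def L2_set_def nsq_def sum_nonneg)

lemma enorm_nonneg [simp]: "0 \<le> enorm d x"
  by (simp add: enorm_def)

lemma edist_square: "(edist d x y)\<^sup>2 = nsq d (\<lambda>j. x j - y j)"
  by (simp add: edist_def enorm_square)

lemma edist_nonneg [simp]: "0 \<le> edist d x y"
  by (simp add: edist_def)

lemma Rsp_add: "x \<in> Rsp d \<Longrightarrow> y \<in> Rsp d \<Longrightarrow> (\<lambda>j. x j + y j) \<in> Rsp d"
  and Rsp_diff: "x \<in> Rsp d \<Longrightarrow> y \<in> Rsp d \<Longrightarrow> (\<lambda>j. x j - y j) \<in> Rsp d"
  and Rsp_scale: "x \<in> Rsp d \<Longrightarrow> (\<lambda>j. a * x j) \<in> Rsp d"
  and Rsp_sum: "(\<And>i. i \<in> I \<Longrightarrow> u i \<in> Rsp d) \<Longrightarrow> (\<lambda>j. \<Sum>i\<in>I. u i j) \<in> Rsp d"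
  and Rsp_zero: "(\<lambda>j. 0) \<in> Rsp d"
  by (auto simp: topspace_Euclidean_space)

lemmas Rsp_intros = Rsp_add Rsp_diff Rsp_scale Rsp_sum Rsp_zero

lemma ip_le_enorm: "\<bar>ip d x y\<bar> \<le> enorm d x * enorm d y"
proof -
  have "\<bar>ip d x y\<bar> \<le> (\<Sum>j<d. \<bar>x j\<bar> * \<bar>y j\<bar>)"
    unfolding ip_def by (rule order.trans[OF sum_abs]) (simp add: abs_mult)
  also have "\<dots> \<le> enorm d x * enorm d y"
    unfolding enorm_def by (rule L2_set_mult_ineq)
  finally show ?thesis .
qed

lemma enorm_scale: "enorm d (\<lambda>j. a * x j) = \<bar>a\<bar> * enorm d x"
  by (simp add: enorm_def L2_set_def power_mult_distrib real_sqrt_mult flip: sum_distrib_left)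

section \<open>Calculus of gradients on \<open>Rsp d\<close>\<close>

lemma has_gradient_grad:
  "differentiable_on_Rsp d f \<Longrightarrow> x \<in> Rsp d \<Longrightarrow> has_gradient d f x (grad d f x)"
  unfolding differentiable_on_Rsp_def using grad_eqI by metis

lemma grad_in_Rsp: "differentiable_on_Rsp d f \<Longrightarrow> x \<in> Rsp d \<Longrightarrow> grad d f x \<in> Rsp d"
  using has_gradient_grad has_gradient_def by blast

lemma has_gradient_bound:
  assumes "has_gradient d f x g" "e > 0"
  obtains \<delta> where "\<delta> > 0" "\<And>y. y \<in> Rsp d \<Longrightarrow> edist d y x < \<delta> \<Longrightarrow>
     \<bar>f y - f x - ip d g (\<lambda>j. y j - x j)\<bar> \<le> e * edist d y x"
  using assms unfolding has_gradient_def ip_def by blast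

lemma has_gradient_const: "has_gradient d (\<lambda>_. a) x (\<lambda>_. 0)"
  by (auto simp: has_gradient_def Rsp_zero intro!: exI[of _ 1])

lemma has_gradient_add:
  assumes "has_gradient d f x g" "has_gradient d f' x g'"
  shows "has_gradient d (\<lambda>y. f y + f' y) x (\<lambda>j. g j + g' j)"
  unfolding has_gradient_def
proof (intro conjI allI impI)
  show "(\<lambda>j. g j + g' j) \<in> Rsp d"
    using assms by (intro Rsp_add) (auto simp: has_gradient_def)
  fix e :: real assume "e > 0"
  then have e: "e / 2 > 0" by simp
  obtain d1 where d1: "d1 > 0" "\<And>y. y \<in> Rsp d \<Longrightarrow> edist d y x < d1 \<Longrightarrow>
     \<bar>f y - f x - ip d g (\<lambda>j. y j - x j)\<bar> \<le> e / 2 * edist d y x"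
    using has_gradient_bound[OF assms(1) e] by blast
  obtain d2 where d2: "d2 > 0" "\<And>y. y \<in> Rsp d \<Longrightarrow> edist d y x < d2 \<Longrightarrow>
     \<bar>f' y - f' x - ip d g' (\<lambda>j. y j - x j)\<bar> \<le> e / 2 * edist d y x"
    using has_gradient_bound[OF assms(2) e] by blast
  show "\<exists>\<delta>>0. \<forall>y\<in>Rsp d. edist d y x < \<delta> \<longrightarrow>
      \<bar>f y + f' y - (f x + f' x) - (\<Sum>j<d. (g j + g' j) * (y j - x j))\<bar> \<le> e * edist d y x"
  proof (intro exI[of _ "min d1 d2"] conjI ballI impI)
    fix y assume y: "y \<in> Rsp d" "edist d y x < min d1 d2"
    have "(\<Sum>j<d. (g j + g' j) * (y j - x j)) =
        ip d g (\<lambda>j. y j - x j) + ip d g' (\<lambda>j. y j - x j)"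
      by (simp add: ip_def distrib_right sum.distrib)
    moreover have "\<bar>f y - f x - ip d g (\<lambda>j. y j - x j)\<bar> \<le> e / 2 * edist d y x"
      "\<bar>f' y - f' x - ip d g' (\<lambda>j. y j - x j)\<bar> \<le> e / 2 * edist d y x"
      using d1 d2 y by auto
    ultimately show "\<bar>f y + f' y - (f x + f' x) - (\<Sum>j<d. (g j + g' j) * (y j - x j))\<bar> \<le> e * edist d y x"
      by linarith
  qed (use d1 d2 in auto)
qed

lemma has_gradient_cmult:
  assumes "has_gradient d f x g"
  shows "has_gradient d (\<lambda>y. a * f y) x (\<lambda>j. a * g j)"
  unfolding has_gradient_def
proof (intro conjI allI impI)
  show "(\<lambda>j. a * g j) \<in> Rsp d"
    using assms by (intro Rsp_scale) (auto simp: has_gradient_def)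
  fix e :: real assume "e > 0"
  then have e: "e / (\<bar>a\<bar> + 1) > 0" by simp
  obtain d1 where d1: "d1 > 0" "\<And>y. y \<in> Rsp d \<Longrightarrow> edist d y x < d1 \<Longrightarrow>
     \<bar>f y - f x - ip d g (\<lambda>j. y j - x j)\<bar> \<le> e / (\<bar>a\<bar> + 1) * edist d y x"
    using has_gradient_bound[OF assms(1) e] by blast
  show "\<exists>\<delta>>0. \<forall>y\<in>Rsp d. edist d y x < \<delta> \<longrightarrow>
      \<bar>a * f y - a * f x - (\<Sum>j<d. a * g j * (y j - x j))\<bar> \<le> e * edist d y x"
  proof (intro exI[of _ d1] conjI ballI impI)
    fix y assume y: "y \<in> Rsp d" "edist d y x < d1"
    have "a * f y - a * f x - (\<Sum>j<d. a * g j * (y j - x j)) =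
        a * (f y - f x - ip d g (\<lambda>j. y j - x j))"
      by (simp add: ip_def sum_distrib_left algebra_simps)
    then have "\<bar>a * f y - a * f x - (\<Sum>j<d. a * g j * (y j - x j))\<bar> =
        \<bar>a\<bar> * \<bar>f y - f x - ip d g (\<lambda>j. y j - x j)\<bar>"
      by (simp add: abs_mult)
    also have "\<dots> \<le> \<bar>a\<bar> * (e / (\<bar>a\<bar> + 1) * edist d y x)"
      using d1(2)[OF y] by (intro mult_left_mono) auto
    also have "\<dots> = (\<bar>a\<bar> / (\<bar>a\<bar> + 1)) * (e * edist d y x)"
      by simp
    also have "\<dots> \<le> 1 * (e * edist d y x)"
      using \<open>e > 0\<close> by (intro mult_right_mono) (auto simp: field_simps)
    finally show "\<bar>a * f y - a * f x - (\<Sum>j<d. a * g j * (y j - x j))\<bar> \<le> e * edist d y x"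
      by simp
  qed (use d1 in auto)
qed

lemma has_gradient_sum:
  assumes "\<And>i. i \<in> I \<Longrightarrow> has_gradient d (f i) x (g i)"
  shows "has_gradient d (\<lambda>y. \<Sum>i\<in>I. f i y) x (\<lambda>j. \<Sum>i\<in>I. g i j)"
  using assms
  by (induction I rule: infinite_finite_induct) (auto intro: has_gradient_const has_gradient_add)

lemma has_gradient_edist_square:
  assumes "x \<in> Rsp d" "z \<in> Rsp d"
  shows "has_gradient d (\<lambda>y. (edist d y z)\<^sup>2) x (\<lambda>j. 2 * (x j - z j))"
  unfolding has_gradient_def
proof (intro conjI allI impI)
  show "(\<lambda>j. 2 * (x j - z j)) \<in> Rsp d" using assms by (intro Rsp_intros)
  fix e :: real assume e: "e > 0"
  show "\<exists>\<delta>>0. \<forall>y\<in>Rsp d. edist d y x < \<delta> \<longrightarrow>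
      \<bar>(edist d y z)\<^sup>2 - (edist d x z)\<^sup>2 - (\<Sum>j<d. 2 * (x j - z j) * (y j - x j))\<bar> \<le> e * edist d y x"
  proof (intro exI[of _ e] conjI ballI impI)
    fix y assume y: "edist d y x < e"
    have "(edist d y z)\<^sup>2 - (edist d x z)\<^sup>2 - (\<Sum>j<d. 2 * (x j - z j) * (y j - x j)) = (edist d y x)\<^sup>2"
      unfolding edist_square nsq_def sum_subtractf[symmetric]
      by (intro sum.cong) (auto simp: power2_eq_square algebra_simps)
    also have "\<dots> \<le> e * edist d y x"
      unfolding power2_eq_square using y by (intro mult_right_mono) auto
    finally show "\<bar>(edist d y z)\<^sup>2 - (edist d x z)\<^sup>2 - (\<Sum>j<d. 2 * (x j - z j) * (y j - x j))\<bar> \<le> e * edist d y x"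
      using \<open>(edist d y z)\<^sup>2 - _ - _ = _\<close> by simp
  qed (use e in auto)
qed

lemma has_gradient_line:
  assumes "x \<in> Rsp d" "v \<in> Rsp d" "has_gradient d f (\<lambda>j. x j + t * v j) g"
  shows "((\<lambda>s. f (\<lambda>j. x j + s * v j)) has_real_derivative ip d g v) (at t)"
  unfolding DERIV_def LIM_eq
proof (intro allI impI)
  fix e :: real assume e: "0 < e"
  \<comment> \<open>The added 1 keeps the divisor positive when \<open>v\<close> vanishes.\<close>
  define n where "n = enorm d v + 1"
  have n: "n > 0" by (simp add: n_def add_nonneg_pos)
  have e2: "e / (2 * n) > 0" using e n by simp
  define p where "p s = (\<lambda>j. x j + s * v j)" for s
  have pR: "p s \<in> Rsp d" for s unfolding p_def using assms by (intro Rsp_intros)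
  obtain \<delta> where \<delta>: "\<delta> > 0" "\<And>y. y \<in> Rsp d \<Longrightarrow> edist d y (p t) < \<delta> \<Longrightarrow>
     \<bar>f y - f (p t) - ip d g (\<lambda>j. y j - p t j)\<bar> \<le> e / (2 * n) * edist d y (p t)"
    using has_gradient_bound[OF assms(3) e2] unfolding p_def by blast
  have dist: "edist d (p (t + h)) (p t) = \<bar>h\<bar> * enorm d v" for h
  proof -
    have "(\<lambda>j. p (t + h) j - p t j) = (\<lambda>j. h * v j)" by (auto simp: p_def algebra_simps)
    then show ?thesis unfolding edist_def by (simp add: enorm_scale)
  qed
  have dist_le: "edist d (p (t + h)) (p t) \<le> \<bar>h\<bar> * n" for h
    unfolding dist n_def by (intro mult_left_mono) auto
  have ipv: "ip d g (\<lambda>j. p (t + h) j - p t j) = h * ip d g v" for h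
    unfolding ip_def sum_distrib_left by (intro sum.cong) (auto simp: p_def algebra_simps)
  show "\<exists>s>0. \<forall>h. h \<noteq> 0 \<and> norm (h - 0) < s \<longrightarrow>
      norm ((f (\<lambda>j. x j + (t + h) * v j) - f (\<lambda>j. x j + t * v j)) / h - ip d g v) < e"
  proof (intro exI[of _ "\<delta> / n"] conjI allI impI)
    show "0 < \<delta> / n" using \<delta> n by simp
    fix h :: real assume h: "h \<noteq> 0 \<and> norm (h - 0) < \<delta> / n"
    then have "\<bar>h\<bar> * n < \<delta>" using n by (simp add: field_simps)
    then have lt: "edist d (p (t + h)) (p t) < \<delta>" using dist_le[of h] by linarith
    have "\<bar>f (p (t + h)) - f (p t) - h * ip d g v\<bar> \<le> e / (2 * n) * edist d (p (t + h)) (p t)"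
      using \<delta>(2)[OF pR lt] by (simp add: ipv)
    also have "\<dots> \<le> e / (2 * n) * (\<bar>h\<bar> * n)"
      using e2 dist_le by (intro mult_left_mono) auto
    also have "\<dots> = e / 2 * \<bar>h\<bar>" using n by simp
    also have "\<dots> < e * \<bar>h\<bar>" using e h by simp
    finally have "\<bar>f (p (t + h)) - f (p t) - h * ip d g v\<bar> < e * \<bar>h\<bar>" .
    moreover have "(f (p (t + h)) - f (p t)) / h - ip d g v = (f (p (t + h)) - f (p t) - h * ip d g v) / h"
      using h by (simp add: field_simps)
    ultimately show "norm ((f (\<lambda>j. x j + (t + h) * v j) - f (\<lambda>j. x j + t * v j)) / h - ip d g v) < e"
      using h by (simp add: p_def abs_divide pos_divide_less_eq)
  qed
qed

text \<open>The descent lemma in two-sided form. As \<open>F\<close> may be nonconvex, the lower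
  side is what strong convexity of the regularized objectives rests on.\<close>

lemma smooth_quadratic_bound:
  assumes diff: "differentiable_on_Rsp d F" and smooth: "smooth d L F"
    and x: "x \<in> Rsp d" and y: "y \<in> Rsp d"
  shows "\<bar>F y - F x - ip d (grad d F x) (\<lambda>j. y j - x j)\<bar> \<le> L / 2 * nsq d (\<lambda>j. y j - x j)"
proof -
  define v where "v = (\<lambda>j. y j - x j)"
  define p where "p s = (\<lambda>j. x j + s * v j)" for s :: real
  define D where "D = ip d (grad d F x) v"
  have v: "v \<in> Rsp d" unfolding v_def using x y by (intro Rsp_intros)
  have pR: "p s \<in> Rsp d" for s unfolding p_def using x v by (intro Rsp_intros)
  have der: "((\<lambda>s. F (p s)) has_real_derivative ip d (grad d F (p s)) v) (at s)" for s
    unfolding p_def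
    using has_gradient_line[OF x v has_gradient_grad[OF diff pR[unfolded p_def]]] by simp
  have bd: "\<bar>ip d (grad d F (p s)) v - D\<bar> \<le> L * s * nsq d v" if s: "0 \<le> s" for s
  proof -
    have "ip d (grad d F (p s)) v - D = ip d (\<lambda>j. grad d F (p s) j - grad d F x j) v"
      by (simp add: ip_def D_def left_diff_distrib sum_subtractf)
    then have "\<bar>ip d (grad d F (p s)) v - D\<bar> \<le> edist d (grad d F (p s)) (grad d F x) * enorm d v"
      unfolding edist_def using ip_le_enorm by simp
    also have "\<dots> \<le> (L * edist d (p s) x) * enorm d v"
      using smooth pR x unfolding smooth_def by (intro mult_right_mono) auto
    also have "edist d (p s) x = s * enorm d v"
      using s unfolding edist_def p_def by (simp add: enorm_scale)
    finally show ?thesis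
      by (simp add: power2_eq_square mult.assoc flip: enorm_square)
  qed
  \<comment> \<open>Showing that \<open>\<psi>\<close> decreases on the unit interval avoids
    integrating the derivative along the segment; the sign \<open>\<epsilon>\<close> yields both
    sides with one argument.\<close>
  have key: "\<epsilon> * (F (p 1) - F (p 0) - D) - L / 2 * nsq d v \<le> 0" if \<epsilon>: "\<epsilon> = 1 \<or> \<epsilon> = -1" for \<epsilon> :: real
  proof -
    define \<psi> where "\<psi> s = \<epsilon> * (F (p s) - F (p 0) - s * D) - L / 2 * s\<^sup>2 * nsq d v" for s
    have "\<psi> 1 \<le> \<psi> 0"
    proof (rule DERIV_nonpos_imp_nonincreasing[of 0 1 \<psi>])
      fix s :: real assume s: "0 \<le> s" "s \<le> 1"
      have "(\<psi> has_real_derivative \<epsilon> * (ip d (grad d F (p s)) v - D) - L * s * nsq d v) (at s)"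
        unfolding \<psi>_def by (auto intro!: derivative_eq_intros der)
      moreover have "\<epsilon> * (ip d (grad d F (p s)) v - D) - L * s * nsq d v \<le> 0"
        using bd[OF s(1)] \<epsilon> by auto
      ultimately show "\<exists>D. (\<psi> has_real_derivative D) (at s) \<and> D \<le> 0" by blast
    qed simp
    then show ?thesis by (simp add: \<psi>_def)
  qed
  have p: "p 1 = y" "p 0 = x" by (auto simp: p_def v_def)
  have "F y - F x - D \<le> L / 2 * nsq d v" "- (F y - F x - D) \<le> L / 2 * nsq d v"
    using key[of 1] key[of "-1"] by (simp_all add: p)
  then show ?thesis unfolding D_def v_def by linarith
qed

text \<open>The inequalities of a \<open>\<sigma>\<close>-strongly convex function with
  \<open>3 * \<sigma>\<close>-Lipschitz gradient, in the form in which the accelerated method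
  consumes them, so that its analysis never mentions the regularizer.\<close>

locale quadratic_growth =
  fixes d :: nat and G :: "rvec \<Rightarrow> real" and g :: "rvec \<Rightarrow> rvec" and \<sigma> :: real
  assumes sigma_pos: "0 < \<sigma>"
    and grad_Rsp: "x \<in> Rsp d \<Longrightarrow> g x \<in> Rsp d"
    and upper: "x \<in> Rsp d \<Longrightarrow> y \<in> Rsp d \<Longrightarrow>
      G y \<le> G x + ip d (g x) (\<lambda>j. y j - x j) + 3 * \<sigma> / 2 * nsq d (\<lambda>j. y j - x j)"
    and lower: "x \<in> Rsp d \<Longrightarrow> y \<in> Rsp d \<Longrightarrow>
      G x + ip d (g x) (\<lambda>j. y j - x j) + \<sigma> / 2 * nsq d (\<lambda>j. y j - x j) \<le> G y"
    and lipschitz: "x \<in> Rsp d \<Longrightarrow> y \<in> Rsp d \<Longrightarrow>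
      nsq d (\<lambda>j. g x j - g y j) \<le> 9 * \<sigma>\<^sup>2 * nsq d (\<lambda>j. x j - y j)"
begin

text \<open>\<open>lower\<close> and \<open>upper\<close> squeeze \<open>G y\<close> between two
  polynomials in finitely many coordinates of \<open>y\<close> that take the same value at
  \<open>x\<close>. The topology is the product topology on sequences, the one in which compactness
  is available below.\<close>

lemma continuous_on_Rsp: "continuous_on (Rsp d) G"
  unfolding continuous_on_def
proof
  fix x assume x: "x \<in> Rsp d"
  have co: "((\<lambda>y. y j) \<longlongrightarrow> x j) (at x within Rsp d)" for j
    using continuous_on_subset[OF continuous_on_product_coordinates[of j] subset_UNIV] x
    by (auto simp: continuous_on_def)
  have l: "((\<lambda>y. G x + ip d (g x) (\<lambda>j. y j - x j) + a * nsq d (\<lambda>j. y j - x j)) \<longlongrightarrow> G x)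
     (at x within Rsp d)" for a
  proof -
    have "((\<lambda>y. G x + (\<Sum>j<d. g x j * (y j - x j)) + a * (\<Sum>j<d. (y j - x j)\<^sup>2)) \<longlongrightarrow>
       G x + (\<Sum>j<d. g x j * (x j - x j)) + a * (\<Sum>j<d. (x j - x j)\<^sup>2)) (at x within Rsp d)"
      by (intro tendsto_intros co)
    then show ?thesis by (simp add: ip_def nsq_def)
  qed
  show "(G \<longlongrightarrow> G x) (at x within Rsp d)"
    by (rule tendsto_sandwich[OF _ _ l[of "\<sigma> / 2"] l[of "3 * \<sigma> / 2"]])
      (use lower[OF x] upper[OF x] in \<open>simp_all add: eventually_at_filter\<close>)
qed

text \<open>Beyond this radius the quadratic term of \<open>lower\<close> outweighs the linear
  one.\<close>

lemma coercive:
  assumes x: "x \<in> Rsp d" and u: "u \<in> Rsp d" and far: "2 * enorm d (g x) / \<sigma> \<le> edist d u x"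
  shows "G x \<le> G u"
proof -
  have "- ip d (g x) (\<lambda>j. u j - x j) \<le> enorm d (g x) * edist d u x"
    using ip_le_enorm[of d "g x" "\<lambda>j. u j - x j"] by (simp add: edist_def)
  also have "\<dots> \<le> (\<sigma> / 2 * edist d u x) * edist d u x"
    using far sigma_pos by (intro mult_right_mono) (auto simp: field_simps)
  also have "\<dots> = \<sigma> / 2 * nsq d (\<lambda>j. u j - x j)"
    by (simp add: power2_eq_square flip: edist_square)
  finally show ?thesis using lower[OF x u] by linarith
qed

text \<open>A minimizer is given for \<open>F\<close> only; the regularized objective of each stage
  has its own, obtained here by compactness and coercivity.\<close>

lemma minimizer_exists:
  obtains u where "u \<in> Rsp d" "\<And>y. y \<in> Rsp d \<Longrightarrow> G u \<le> G y"
proof -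
  define x where "x = ((\<lambda>_. 0) :: rvec)"
  have x: "x \<in> Rsp d" by (simp add: x_def Rsp_zero)
  define r where "r = 2 * enorm d (g x) / \<sigma>"
  have r: "r \<ge> 0" using sigma_pos by (simp add: r_def)
  \<comment> \<open>Pinning the coordinates from \<open>d\<close> on to 0 puts the box inside
    \<open>Rsp d\<close>, and Tychonoff makes it compact. A point of \<open>Rsp d\<close> outside
    the box has a coordinate larger than \<open>r\<close>, so \<open>coercive\<close> applies to
    it.\<close>
  define B where "B = (\<Pi>\<^sub>E j\<in>UNIV. if j < d then {-r..r} else {0::real})"
  have B: "B \<subseteq> Rsp d"
    by (auto simp: B_def topspace_Euclidean_space PiE_iff split: if_splits dest!: spec)
  have "compactin (product_topology (\<lambda>_. euclidean) UNIV) B"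
    unfolding B_def compactin_PiE by auto
  then have cB: "compact B"
    by (simp add: euclidean_product_topology)
  have xB: "x \<in> B" using r by (simp add: B_def x_def PiE_iff)
  obtain u where u: "u \<in> B" "\<And>y. y \<in> B \<Longrightarrow> G u \<le> G y"
    using continuous_attains_inf[OF cB _ continuous_on_subset[OF continuous_on_Rsp B]] xB by blast
  show ?thesis
  proof
    show "u \<in> Rsp d" using u B by blast
    fix y assume y: "y \<in> Rsp d"
    show "G u \<le> G y"
    proof (cases "y \<in> B")
      case True
      then show ?thesis using u by blast
    next
      case False
      then obtain j where j: "j < d" "\<bar>y j\<bar> > r"
      proof -
        have "y \<in> B" if "\<And>j. j < d \<Longrightarrow> \<bar>y j\<bar> \<le> r"
          using y that unfolding B_def
          by (auto simp: PiE_iff topspace_Euclidean_space abs_le_iff intro: minus_le_iff[THEN iffD1])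
        then show thesis using False that by force
      qed
      have "\<bar>y j\<bar> \<le> edist d y x"
        unfolding edist_def enorm_def x_def using j member_le_L2_set[of "{..<d}" j "\<lambda>j. \<bar>y j\<bar>"]
        by (simp add: L2_set_def)
      then have "G x \<le> G y" using j y x by (intro coercive) (auto simp: r_def)
      then show ?thesis using u(2)[OF xB] by linarith
    qed
  qed
qed

lemma gradient_gap:
  assumes x: "x \<in> Rsp d" and u: "\<And>y. y \<in> Rsp d \<Longrightarrow> G u \<le> G y"
  shows "nsq d (g x) \<le> 6 * \<sigma> * (G x - G u)"
proof -
  \<comment> \<open>The step length \<open>1 / (3 * \<sigma>)\<close> minimizes the upper bound
    along the gradient, and even this point cannot lie below the minimum.\<close>
  define y where "y = (\<lambda>j. x j - 1 / (3 * \<sigma>) * g x j)"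
  have y: "y \<in> Rsp d" unfolding y_def using x grad_Rsp[OF x] by (intro Rsp_intros)
  have yx: "y j - x j = - (1 / (3 * \<sigma>)) * g x j" for j by (simp add: y_def)
  have "ip d (g x) (\<lambda>j. y j - x j) = - (1 / (3 * \<sigma>)) * nsq d (g x)"
    unfolding yx ip_def nsq_def sum_distrib_left by (simp add: power2_eq_square algebra_simps)
  moreover have "nsq d (\<lambda>j. y j - x j) = (1 / (3 * \<sigma>))\<^sup>2 * nsq d (g x)"
    unfolding yx nsq_def sum_distrib_left by (simp add: power_mult_distrib power_divide)
  ultimately have "G u \<le> G x - 1 / (3 * \<sigma>) * nsq d (g x) + 3 * \<sigma> / 2 * ((1 / (3 * \<sigma>))\<^sup>2 * nsq d (g x))"
    using u[OF y] upper[OF x y] by simp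
  also have "\<dots> = G x - nsq d (g x) / (6 * \<sigma>)"
    using sigma_pos by (simp add: field_simps power2_eq_square)
  finally show ?thesis using sigma_pos by (simp add: field_simps)
qed

lemma gradient_minimizer:
  assumes u: "u \<in> Rsp d" "\<And>y. y \<in> Rsp d \<Longrightarrow> G u \<le> G y"
  shows "g u = (\<lambda>_. 0)"
proof
  fix j
  have "nsq d (g u) \<le> 0" using gradient_gap[OF u] by simp
  then have "nsq d (g u) = 0" using nsq_nonneg[of d "g u"] by linarith
  then have "g u j = 0" if "j < d"
    using that by (simp add: nsq_def sum_nonneg_eq_0_iff)
  then show "g u j = 0" using grad_Rsp[OF u(1)] by (cases "j < d") (auto simp: topspace_Euclidean_space)
qed

end

section \<open>The potential of the accelerated method\<close>

lemma square_sum_le: "(a + b)\<^sup>2 \<le> 2 * a\<^sup>2 + 2 * (b::real)\<^sup>2"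
  using zero_le_power2[of "a - b"] by (simp add: power2_eq_square algebra_simps)

text \<open>One coordinate of the \<open>z\<close> update with the minimizer moved to the origin;
  \<open>g\<close> stands for the gradient at the virtual point and \<open>e\<close> for the error
  of the gradient actually used. The products with \<open>g\<close> are kept exactly, because
  \<open>potential_step\<close> removes them by convexity towards two points. The error costs the
  excess \<open>\<theta> / 4\<close> in front of \<open>z^2\<close>.\<close>

lemma extrapolation_coordinate_bound:
  fixes x z g e \<theta> \<sigma> :: real
  assumes \<theta>: "0 < \<theta>" "\<theta> \<le> 1" and \<sigma>: "0 < \<sigma>"
  shows "\<sigma> / 4 * (1 + \<theta>) * ((z + \<theta> * x) / (1 + \<theta>) - \<theta> / \<sigma> * (g + e))\<^sup>2
    \<le> \<sigma> / 4 * (1 + \<theta> / 4) * z\<^sup>2 + (\<sigma> * \<theta> / 4 + \<theta>\<^sup>2 * \<sigma> / 8) * x\<^sup>2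
      - \<theta> / 2 * (z - x) * g - \<theta> / 2 * (1 + \<theta>) * (x * g) + \<theta>\<^sup>2 / \<sigma> * g\<^sup>2
      + (2 * \<theta> / \<sigma> + \<theta>\<^sup>2 / \<sigma>) * e\<^sup>2"
proof -
  define u where "u = z + \<theta> * x"
  \<comment> \<open>Products of parameters become plain variables here, which makes the final
    bookkeeping linear.\<close>
  have combine: "L \<le> k1 + k2 - b1 - b2 + w + k3"
    if "L = a - b - c + v" "a \<le> a'" "- c \<le> c'" "v \<le> v'" "b = b1 + b2" "0 \<le> t" "t \<le> s"
      "c' = p + s + r + t / 2" "v' = w + t" "k1 + k2 + k3 = a' + p + r + 2 * s + t"
    for L a b c v a' c' v' b1 b2 t s p r w k1 k2 k3 :: real
    using that by linarith
  have "\<sigma> / 4 * (1 + \<theta>) * (u / (1 + \<theta>) - \<theta> / \<sigma> * (g + e))\<^sup>2 =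
      \<sigma> / 4 * (u\<^sup>2 / (1 + \<theta>)) - \<theta> / 2 * g * u - \<theta> / 2 * (e * u)
      + \<theta>\<^sup>2 / (4 * \<sigma>) * ((1 + \<theta>) * (g + e)\<^sup>2)"
  proof -
    have "\<sigma> / 4 * (1 + \<theta>) * (v - r)\<^sup>2 = \<sigma> / 4 * ((1 + \<theta>) * v\<^sup>2) - \<sigma> / 2 * ((1 + \<theta>) * v) * r
        + \<sigma> / 4 * (1 + \<theta>) * r\<^sup>2" for v r
      by (simp add: power2_eq_square field_simps)
    moreover have "(1 + \<theta>) * (u / (1 + \<theta>)) = u" using \<theta> by simp
    moreover have "(1 + \<theta>) * (u / (1 + \<theta>))\<^sup>2 = u\<^sup>2 / (1 + \<theta>)"
      using \<theta> by (simp add: power2_eq_square)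
    moreover have "\<sigma> / 2 * u * (\<theta> / \<sigma> * (g + e)) = \<theta> / 2 * g * u + \<theta> / 2 * (e * u)"
      using \<sigma> by (simp add: field_simps)
    moreover have "\<sigma> / 4 * (1 + \<theta>) * (\<theta> / \<sigma> * (g + e))\<^sup>2 = \<theta>\<^sup>2 / (4 * \<sigma>) * ((1 + \<theta>) * (g + e)\<^sup>2)"
      using \<sigma> by (simp add: power_mult_distrib power_divide power2_eq_square)
    ultimately show ?thesis by (simp only:)
  qed
  \<comment> \<open>Convexity of the square for the weights \<open>1 / (1 + \<theta>)\<close> and
    \<open>\<theta> / (1 + \<theta>)\<close>.\<close>
  moreover have "\<sigma> / 4 * (u\<^sup>2 / (1 + \<theta>)) \<le> \<sigma> / 4 * (z\<^sup>2 + \<theta> * x\<^sup>2)"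
  proof -
    have "(z\<^sup>2 + \<theta> * x\<^sup>2) * (1 + \<theta>) - u\<^sup>2 = \<theta> * (z - x)\<^sup>2"
      by (simp add: u_def power2_eq_square algebra_simps)
    then have "u\<^sup>2 \<le> (z\<^sup>2 + \<theta> * x\<^sup>2) * (1 + \<theta>)" using \<theta> by (smt (verit) mult_nonneg_nonneg zero_le_power2)
    then have "u\<^sup>2 / (1 + \<theta>) \<le> z\<^sup>2 + \<theta> * x\<^sup>2" using \<theta> by (simp add: pos_divide_le_eq)
    then show ?thesis using \<sigma> by (intro mult_left_mono) auto
  qed
  \<comment> \<open>Young's inequality, weighted so that the \<open>z^2\<close> part is exactly the
    excess \<open>\<theta> / 4\<close> relative to \<open>\<sigma> / 4\<close>. The
    \<open>x^2\<close> part carries a further factor \<open>\<theta>\<close> and is later paid for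
    by strong convexity.\<close>
  moreover have "- (\<theta> / 2 * (e * u)) \<le> \<theta> / 2 * (\<sigma> / 8 * z\<^sup>2 + 2 / \<sigma> * e\<^sup>2)
      + \<theta> / 2 * (\<theta> * (\<sigma> / 4 * x\<^sup>2 + 1 / \<sigma> * e\<^sup>2))"
  proof -
    have "0 \<le> (\<sigma> / 4 * z + e)\<^sup>2 * (2 / \<sigma>)" using \<sigma> by simp
    also have "\<dots> = \<sigma> / 8 * z\<^sup>2 + 2 / \<sigma> * e\<^sup>2 + e * z"
      using \<sigma> by (simp add: power2_eq_square field_simps)
    finally have 1: "- (e * z) \<le> \<sigma> / 8 * z\<^sup>2 + 2 / \<sigma> * e\<^sup>2" by simp
    have "0 \<le> (\<sigma> / 2 * x + e)\<^sup>2 * (1 / \<sigma>)" using \<sigma> by simp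
    also have "\<dots> = \<sigma> / 4 * x\<^sup>2 + 1 / \<sigma> * e\<^sup>2 + e * x"
      using \<sigma> by (simp add: power2_eq_square field_simps)
    finally have 2: "- (e * x) \<le> \<sigma> / 4 * x\<^sup>2 + 1 / \<sigma> * e\<^sup>2" by simp
    have "- (\<theta> / 2 * (e * u)) = \<theta> / 2 * (- (e * z)) + \<theta> / 2 * (\<theta> * (- (e * x)))"
      by (simp add: u_def algebra_simps)
    also have "\<dots> \<le> \<theta> / 2 * (\<sigma> / 8 * z\<^sup>2 + 2 / \<sigma> * e\<^sup>2) + \<theta> / 2 * (\<theta> * (\<sigma> / 4 * x\<^sup>2 + 1 / \<sigma> * e\<^sup>2))"
      using 1 2 \<theta> by (intro add_mono mult_left_mono) auto
    finally show ?thesis .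
  qed
  moreover have "\<theta>\<^sup>2 / (4 * \<sigma>) * ((1 + \<theta>) * (g + e)\<^sup>2) \<le> \<theta>\<^sup>2 / (4 * \<sigma>) * (2 * (2 * g\<^sup>2 + 2 * e\<^sup>2))"
    using \<theta> \<sigma> square_sum_le[of g e] by (intro mult_left_mono mult_mono) auto
  moreover have "\<theta> / 2 * g * u = \<theta> / 2 * (z - x) * g + \<theta> / 2 * (1 + \<theta>) * (x * g)"
    by (simp add: u_def field_simps)
  moreover have "0 \<le> \<theta>\<^sup>2 / \<sigma> * e\<^sup>2" using \<sigma> by simp
  moreover have "\<theta>\<^sup>2 / \<sigma> * e\<^sup>2 \<le> \<theta> / \<sigma> * e\<^sup>2"
    using \<theta> \<sigma> by (intro mult_right_mono divide_right_mono) (auto simp: power2_eq_square)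
  moreover have "\<theta> / 2 * (\<sigma> / 8 * z\<^sup>2 + 2 / \<sigma> * e\<^sup>2) + \<theta> / 2 * (\<theta> * (\<sigma> / 4 * x\<^sup>2 + 1 / \<sigma> * e\<^sup>2)) =
      \<sigma> / 4 * (\<theta> / 4) * z\<^sup>2 + \<theta> / \<sigma> * e\<^sup>2 + \<theta>\<^sup>2 * \<sigma> / 8 * x\<^sup>2 + (\<theta>\<^sup>2 / \<sigma> * e\<^sup>2) / 2"
    by (simp add: power2_eq_square algebra_simps)
  moreover have "\<theta>\<^sup>2 / (4 * \<sigma>) * (2 * (2 * g\<^sup>2 + 2 * e\<^sup>2)) = \<theta>\<^sup>2 / \<sigma> * g\<^sup>2 + \<theta>\<^sup>2 / \<sigma> * e\<^sup>2"
    by (simp add: algebra_simps)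
  moreover have "\<sigma> / 4 * (1 + \<theta> / 4) * z\<^sup>2 + (\<sigma> * \<theta> / 4 + \<theta>\<^sup>2 * \<sigma> / 8) * x\<^sup>2 + (2 * \<theta> / \<sigma> + \<theta>\<^sup>2 / \<sigma>) * e\<^sup>2
     = \<sigma> / 4 * (z\<^sup>2 + \<theta> * x\<^sup>2) + \<sigma> / 4 * (\<theta> / 4) * z\<^sup>2 + \<theta>\<^sup>2 * \<sigma> / 8 * x\<^sup>2 + 2 * (\<theta> / \<sigma> * e\<^sup>2) + \<theta>\<^sup>2 / \<sigma> * e\<^sup>2"
    by (simp add: algebra_simps)
  ultimately show ?thesis
    unfolding u_def[symmetric] by (rule combine)
qed

text \<open>The \<open>y\<close> update with an inexact gradient. The small step makes the second
  order term harmless, and the surviving decrease \<open>5 / 8 * \<eta>\<close> absorbs the squared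
  gradient that the \<open>z\<close> update produces.\<close>

lemma descent_coordinate_bound:
  fixes g e \<eta> \<sigma> :: real
  assumes \<eta>: "0 < \<eta>" "0 < \<sigma>" "3 * \<sigma> * \<eta> \<le> 1 / 8"
  shows "- \<eta> * (g * (g + e)) + 3 * \<sigma> / 2 * \<eta>\<^sup>2 * (g + e)\<^sup>2 \<le> - (5 / 8 * \<eta>) * g\<^sup>2 + 2 * \<eta> * e\<^sup>2"
proof -
  have "3 * \<sigma> / 2 * \<eta>\<^sup>2 = (3 * \<sigma> * \<eta>) * (\<eta> / 2)" by (simp add: power2_eq_square)
  also have "\<dots> \<le> 1 / 8 * (\<eta> / 2)" using \<eta> by (intro mult_right_mono) auto
  finally have "3 * \<sigma> / 2 * \<eta>\<^sup>2 * (g + e)\<^sup>2 \<le> \<eta> / 16 * (2 * g\<^sup>2 + 2 * e\<^sup>2)"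
    using \<eta> square_sum_le[of g e] by (intro mult_mono) auto
  moreover have "- \<eta> * (g * (g + e)) \<le> \<eta> * (- (3 / 4) * g\<^sup>2 + e\<^sup>2)"
  proof -
    have "0 \<le> \<eta> * (g / 2 + e)\<^sup>2" using \<eta> by simp
    then show ?thesis by (simp add: power2_eq_square algebra_simps)
  qed
  moreover have "0 \<le> \<eta> * e\<^sup>2" using \<eta> by simp
  ultimately show ?thesis by (simp add: algebra_simps)
qed

lemma expect_nsq_affine:
  assumes fin: "finite (set_pmf M)"
    and mean: "\<And>j. j < d \<Longrightarrow> expect M (\<lambda>s. H s j) = h j"
  shows "expect M (\<lambda>s. nsq d (\<lambda>j. a j + b * H s j)) =
    nsq d (\<lambda>j. a j + b * h j) + b\<^sup>2 * expect M (\<lambda>s. nsq d (\<lambda>j. H s j - h j))"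
proof -
  have "expect M (\<lambda>s. (a j + b * H s j)\<^sup>2) = (a j + b * h j)\<^sup>2 + b\<^sup>2 * expect M (\<lambda>s. (H s j - h j)\<^sup>2)"
    if "j < d" for j
    using expect_square_affine[OF fin, of "a j" b "\<lambda>s. H s j"] mean[OF that] by simp
  then show ?thesis
    using fin by (simp add: nsq_def expect_sum sum.distrib sum_distrib_left)
qed

context quadratic_growth
begin

text \<open>
  The iterates \<open>y\<^sub>t\<close> are not part of the state, but \<open>x = (1 - \<alpha>) y + \<alpha> z\<close> with
  \<open>\<alpha> = \<theta> / (2 + \<theta>)\<close> gives \<open>y = x - \<theta> / 2 (z - x)\<close>.
\<close>

definition potential :: "real \<Rightarrow> rvec \<Rightarrow> rvec \<Rightarrow> rvec \<Rightarrow> real" where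
  "potential \<theta> u x z = G (\<lambda>j. x j - \<theta> / 2 * (z j - x j)) - G u
     + (1 + \<theta> / 4) * (\<sigma> / 4) * nsq d (\<lambda>j. z j - u j)"

lemma potential_nonneg:
  assumes "\<And>y. y \<in> Rsp d \<Longrightarrow> G u \<le> G y" "x \<in> Rsp d" "z \<in> Rsp d" "0 \<le> \<theta>"
  shows "0 \<le> potential \<theta> u x z"
proof -
  have "(\<lambda>j. x j - \<theta> / 2 * (z j - x j)) \<in> Rsp d" using assms by (intro Rsp_intros)
  then show ?thesis using assms sigma_pos unfolding potential_def
    by (intro add_nonneg_nonneg mult_nonneg_nonneg) auto
qed

lemma distance_le_gap:
  assumes u: "u \<in> Rsp d" "\<And>y. y \<in> Rsp d \<Longrightarrow> G u \<le> G y" and x: "x \<in> Rsp d"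
  shows "\<sigma> / 2 * nsq d (\<lambda>j. x j - u j) \<le> G x - G u"
  using lower[OF u(1) x] gradient_minimizer[OF u] by (simp add: ip_def)

lemma gap_le_distance:
  assumes u: "u \<in> Rsp d" "\<And>y. y \<in> Rsp d \<Longrightarrow> G u \<le> G y" and x: "x \<in> Rsp d"
  shows "G x - G u \<le> 3 * \<sigma> / 2 * nsq d (\<lambda>j. x j - u j)"
  using upper[OF u(1) x] gradient_minimizer[OF u] by (simp add: ip_def)

text \<open>Three inequalities are added: descent from \<open>X\<close> to \<open>Y'\<close>,
  convexity at \<open>X\<close> towards \<open>Y\<close>, and strong convexity at \<open>X\<close>
  towards \<open>u\<close> with weight \<open>\<theta> / 2 * (1 + \<theta>)\<close>. The inner
  products with \<open>g X\<close> cancel, and \<open>\<eta> = 4 * \<theta>^2 / \<sigma>\<close>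
  turns the squared gradient of the \<open>z\<close> update into \<open>\<eta> / 4\<close>, less
  than the descent returns. Here \<open>xr\<close> is the true iterate, where gradients are sampled,
  and \<open>X\<close> the virtual one.\<close>

lemma potential_step:
  fixes M :: "'s pmf" and H :: "'s \<Rightarrow> rvec"
  assumes u: "u \<in> Rsp d" "\<And>y. y \<in> Rsp d \<Longrightarrow> G u \<le> G y"
    and X: "X \<in> Rsp d" and Z: "Z \<in> Rsp d" and xr: "xr \<in> Rsp d"
    and \<theta>: "0 < \<theta>" "\<theta> \<le> 1 / 10" and \<eta>: "\<eta> = 4 * \<theta>\<^sup>2 / \<sigma>" and lam: "lam = \<theta> / \<sigma>"
    and \<alpha>: "\<alpha> = \<theta> / (2 + \<theta>)" and \<beta>: "\<beta> = \<theta> / (1 + \<theta>)"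
    and fin: "finite (set_pmf M)"
    and HR: "\<And>s. s \<in> set_pmf M \<Longrightarrow> H s \<in> Rsp d"
    and mean: "\<And>j. j < d \<Longrightarrow> expect M (\<lambda>s. H s j) = g xr j"
    and var: "expect M (\<lambda>s. nsq d (\<lambda>j. H s j - g xr j)) \<le> W"
    and Z': "\<And>s. Z' s = (\<lambda>j. (1 - \<beta>) * Z j + \<beta> * X j - lam * H s j)"
    and X': "\<And>s. X' s = (\<lambda>j. (1 - \<alpha>) * (X j - \<eta> * H s j) + \<alpha> * Z' s j)"
  shows "expect M (\<lambda>s. potential \<theta> u (X' s) (Z' s)) \<le>
    (1 - \<theta> / 4) * potential \<theta> u X Z + 36 * \<theta> * \<sigma> * nsq d (\<lambda>j. xr j - X j) + 2 * \<theta>\<^sup>2 / \<sigma> * W"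
proof -
  define Y where "Y = (\<lambda>j. X j - \<theta> / 2 * (Z j - X j))"
  define Y' where "Y' s = (\<lambda>j. X j - \<eta> * H s j)" for s
  define e where "e = (\<lambda>j. g xr j - g X j)"
  define a where "a = (\<lambda>j. X j - u j)"
  define b where "b = (\<lambda>j. Z j - u j)"
  define W' where "W' = expect M (\<lambda>s. nsq d (\<lambda>j. H s j - g xr j))"
  define Q where "Q = expect M (\<lambda>s. nsq d (\<lambda>j. Z' s j - u j))"
  define R where "R = expect M (\<lambda>s. G (Y' s))"
  have \<eta>0: "\<eta> > 0" and \<eta>1: "3 * \<sigma> * \<eta> \<le> 1 / 8"
  proof -
    show "\<eta> > 0" using \<theta> sigma_pos by (simp add: \<eta>)
    have "\<theta>\<^sup>2 \<le> (1 / 10)\<^sup>2" using \<theta> by (intro power_mono) auto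
    then show "3 * \<sigma> * \<eta> \<le> 1 / 8" using sigma_pos by (simp add: \<eta> power2_eq_square)
  qed
  have W0: "0 \<le> W'" unfolding W'_def by (rule expect_nonneg) simp
  have YR: "Y \<in> Rsp d" unfolding Y_def using X Z by (intro Rsp_intros)
  have gXR: "g X \<in> Rsp d" using X grad_Rsp by blast
  have mix: "(\<lambda>j. X' s j - \<theta> / 2 * (Z' s j - X' s j)) = Y' s" for s
  proof -
    have "\<alpha> * (2 + \<theta>) = \<theta>" using \<theta> by (simp add: \<alpha>)
    moreover have "(1 - \<alpha>) * y + \<alpha> * z - \<theta> / 2 * (z - ((1 - \<alpha>) * y + \<alpha> * z)) =
        y + (z - y) * (\<alpha> * (2 + \<theta>) - \<theta>) / 2" for y z
      by (simp add: field_simps)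
    ultimately have "(1 - \<alpha>) * y + \<alpha> * z - \<theta> / 2 * (z - ((1 - \<alpha>) * y + \<alpha> * z)) = y" for y z
      by simp
    then show ?thesis by (simp add: X' Y'_def)
  qed
  have step_R: "R \<le> G X - 5 / 8 * \<eta> * nsq d (g X) + 2 * \<eta> * nsq d e + \<eta> / 16 * W'"
  proof -
    have "R \<le> expect M (\<lambda>s. (G X + ip d (g X) (\<lambda>j. - \<eta> * H s j)) + 3 * \<sigma> / 2 * nsq d (\<lambda>j. 0 + (- \<eta>) * H s j))"
      unfolding R_def
    proof (rule expect_mono[OF fin])
      fix s assume s: "s \<in> set_pmf M"
      have "Y' s \<in> Rsp d" unfolding Y'_def using X HR[OF s] by (intro Rsp_intros)
      from upper[OF X this]
      show "G (Y' s) \<le> (G X + ip d (g X) (\<lambda>j. - \<eta> * H s j)) + 3 * \<sigma> / 2 * nsq d (\<lambda>j. 0 + (- \<eta>) * H s j)"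
        by (simp add: Y'_def)
    qed
    also have "\<dots> = G X + ip d (g X) (\<lambda>j. - \<eta> * g xr j) + 3 * \<sigma> / 2 * (nsq d (\<lambda>j. 0 + (- \<eta>) * g xr j) + \<eta>\<^sup>2 * W')"
    proof -
      have "expect M (\<lambda>s. ip d (g X) (\<lambda>j. - \<eta> * H s j)) = ip d (g X) (\<lambda>j. - \<eta> * g xr j)"
        unfolding ip_def by (simp add: expect_sum[OF fin] mean)
      then show ?thesis
        using expect_nsq_affine[OF fin mean, where a = "\<lambda>_. 0" and b = "- \<eta>"]
        by (simp add: expect_add[OF fin] W'_def)
    qed
    also have "\<dots> = G X + (\<Sum>j<d. - \<eta> * (g X j * (g X j + e j)) + 3 * \<sigma> / 2 * \<eta>\<^sup>2 * (g X j + e j)\<^sup>2)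
        + 3 * \<sigma> / 2 * \<eta>\<^sup>2 * W'"
      by (simp add: ip_def nsq_def e_def sum.distrib sum_distrib_left sum_subtractf sum_negf power_mult_distrib algebra_simps)
    also have "\<dots> \<le> G X + (\<Sum>j<d. - (5 / 8 * \<eta>) * (g X j)\<^sup>2 + 2 * \<eta> * (e j)\<^sup>2) + \<eta> / 16 * W'"
    proof -
      have "3 * \<sigma> / 2 * \<eta>\<^sup>2 = (3 * \<sigma> * \<eta>) * (\<eta> / 2)" by (simp add: power2_eq_square)
      also have "\<dots> \<le> 1 / 8 * (\<eta> / 2)" using \<eta>0 \<eta>1 by (intro mult_right_mono) auto
      finally have "3 * \<sigma> / 2 * \<eta>\<^sup>2 * W' \<le> \<eta> / 16 * W'" using W0 by (intro mult_right_mono) auto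
      moreover have "(\<Sum>j<d. - \<eta> * (g X j * (g X j + e j)) + 3 * \<sigma> / 2 * \<eta>\<^sup>2 * (g X j + e j)\<^sup>2) \<le>
          (\<Sum>j<d. - (5 / 8 * \<eta>) * (g X j)\<^sup>2 + 2 * \<eta> * (e j)\<^sup>2)"
        by (intro sum_mono descent_coordinate_bound \<eta>0 \<eta>1 sigma_pos)
      ultimately show ?thesis by linarith
    qed
    also have "\<dots> = G X - 5 / 8 * \<eta> * nsq d (g X) + 2 * \<eta> * nsq d e + \<eta> / 16 * W'"
      by (simp add: nsq_def sum.distrib sum_distrib_left sum_subtractf)
    finally show ?thesis .
  qed
  have step_Q: "\<sigma> / 4 * (1 + \<theta>) * Q \<le> \<sigma> / 4 * (1 + \<theta> / 4) * nsq d b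
      + (\<sigma> * \<theta> / 4 + \<theta>\<^sup>2 * \<sigma> / 8) * nsq d a + ip d (g X) (\<lambda>j. Y j - X j)
      - \<theta> / 2 * (1 + \<theta>) * ip d (g X) a + \<eta> / 4 * nsq d (g X)
      + (2 * \<theta> / \<sigma> + \<eta> / 4) * nsq d e + \<eta> / 8 * W'"
  proof -
    have w: "(1 - \<beta>) * Z j + \<beta> * X j - u j = (b j + \<theta> * a j) / (1 + \<theta>)" for j
    proof -
      have b1: "\<beta> * (1 + \<theta>) = \<theta>" using \<theta> by (simp add: \<beta>)
      have "((1 - \<beta>) * Z j + \<beta> * X j - u j) * (1 + \<theta>) =
          Z j * (1 + \<theta>) + (\<beta> * (1 + \<theta>)) * (X j - Z j) - u j * (1 + \<theta>)"
        by (simp add: algebra_simps)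
      also have "\<dots> = b j + \<theta> * a j" unfolding b1 a_def b_def by (simp add: algebra_simps)
      finally show ?thesis using \<theta> by (simp add: eq_divide_eq)
    qed
    have "Q = expect M (\<lambda>s. nsq d (\<lambda>j. ((b j + \<theta> * a j) / (1 + \<theta>)) + (- lam) * H s j))"
      unfolding Q_def Z' by (intro expect_cong) (simp add: w[symmetric] algebra_simps)
    also have "\<dots> = nsq d (\<lambda>j. ((b j + \<theta> * a j) / (1 + \<theta>)) + (- lam) * g xr j) + lam\<^sup>2 * W'"
      unfolding W'_def by (subst expect_nsq_affine[OF fin mean]) auto
    also have "nsq d (\<lambda>j. ((b j + \<theta> * a j) / (1 + \<theta>)) + (- lam) * g xr j) =
        (\<Sum>j<d. ((b j + \<theta> * a j) / (1 + \<theta>) - \<theta> / \<sigma> * (g X j + e j))\<^sup>2)"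
      unfolding nsq_def e_def lam by simp
    finally have "\<sigma> / 4 * (1 + \<theta>) * Q =
        (\<Sum>j<d. \<sigma> / 4 * (1 + \<theta>) * ((b j + \<theta> * a j) / (1 + \<theta>) - \<theta> / \<sigma> * (g X j + e j))\<^sup>2)
        + \<sigma> / 4 * (1 + \<theta>) * lam\<^sup>2 * W'"
      by (simp add: distrib_left sum_distrib_left)
    also have "\<dots> \<le> (\<Sum>j<d. \<sigma> / 4 * (1 + \<theta> / 4) * (b j)\<^sup>2 + (\<sigma> * \<theta> / 4 + \<theta>\<^sup>2 * \<sigma> / 8) * (a j)\<^sup>2
      - \<theta> / 2 * (b j - a j) * g X j - \<theta> / 2 * (1 + \<theta>) * (a j * g X j) + \<theta>\<^sup>2 / \<sigma> * (g X j)\<^sup>2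
      + (2 * \<theta> / \<sigma> + \<theta>\<^sup>2 / \<sigma>) * (e j)\<^sup>2) + \<eta> / 8 * W'"
    proof (intro add_mono sum_mono extrapolation_coordinate_bound)
      have "\<sigma> / 4 * (1 + \<theta>) * lam\<^sup>2 = \<theta>\<^sup>2 / (4 * \<sigma>) * (1 + \<theta>)"
        using sigma_pos by (simp add: lam power_divide power2_eq_square)
      also have "\<dots> \<le> \<theta>\<^sup>2 / (4 * \<sigma>) * 2"
        using \<theta> sigma_pos by (intro mult_left_mono) auto
      also have "\<dots> = \<eta> / 8" by (simp add: \<eta>)
      finally show "\<sigma> / 4 * (1 + \<theta>) * lam\<^sup>2 * W' \<le> \<eta> / 8 * W'"
        using W0 by (intro mult_right_mono)
    qed (use \<theta> sigma_pos in auto)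
    also have "(\<Sum>j<d. \<sigma> / 4 * (1 + \<theta> / 4) * (b j)\<^sup>2 + (\<sigma> * \<theta> / 4 + \<theta>\<^sup>2 * \<sigma> / 8) * (a j)\<^sup>2
      - \<theta> / 2 * (b j - a j) * g X j - \<theta> / 2 * (1 + \<theta>) * (a j * g X j) + \<theta>\<^sup>2 / \<sigma> * (g X j)\<^sup>2
      + (2 * \<theta> / \<sigma> + \<theta>\<^sup>2 / \<sigma>) * (e j)\<^sup>2) =
      \<sigma> / 4 * (1 + \<theta> / 4) * nsq d b + (\<sigma> * \<theta> / 4 + \<theta>\<^sup>2 * \<sigma> / 8) * nsq d a
      - (\<Sum>j<d. \<theta> / 2 * (b j - a j) * g X j) - \<theta> / 2 * (1 + \<theta>) * ip d (g X) a
      + \<theta>\<^sup>2 / \<sigma> * nsq d (g X) + (2 * \<theta> / \<sigma> + \<theta>\<^sup>2 / \<sigma>) * nsq d e"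
      unfolding nsq_def ip_def sum_distrib_left sum.distrib sum_subtractf
      by (simp add: mult.commute)
    also have "(\<Sum>j<d. \<theta> / 2 * (b j - a j) * g X j) = - ip d (g X) (\<lambda>j. Y j - X j)"
      unfolding ip_def sum_negf[symmetric] a_def b_def Y_def by (intro sum.cong) auto
    also have "\<theta>\<^sup>2 / \<sigma> = \<eta> / 4" by (simp add: \<eta>)
    finally show ?thesis by simp
  qed
  have low_Y: "G X + ip d (g X) (\<lambda>j. Y j - X j) \<le> G Y"
    using lower[OF X YR] sigma_pos nsq_nonneg[of d "\<lambda>j. Y j - X j"]
    by (smt (verit) mult_nonneg_nonneg divide_nonneg_pos)
  have low_u: "G X - G u + \<sigma> / 2 * nsq d a \<le> ip d (g X) a"
  proof -
    have "ip d (g X) (\<lambda>j. u j - X j) = - ip d (g X) a"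
      unfolding ip_def a_def sum_negf[symmetric] by (intro sum.cong) (auto simp: algebra_simps)
    moreover have "nsq d (\<lambda>j. u j - X j) = nsq d a"
      unfolding nsq_def a_def by (intro sum.cong) (auto simp: power2_commute)
    ultimately show ?thesis using lower[OF X u(1)] by simp
  qed
  have e_le: "nsq d e \<le> 9 * \<sigma>\<^sup>2 * nsq d (\<lambda>j. xr j - X j)"
    unfolding e_def by (rule lipschitz[OF xr X])
  define D where "D = G X - G u"
  have D0: "0 \<le> D" using u X by (simp add: D_def)
  have "\<theta> / 2 * (1 + \<theta>) * (D + \<sigma> / 2 * nsq d a) \<le> \<theta> / 2 * (1 + \<theta>) * ip d (g X) a"
    using low_u \<theta> unfolding D_def by (intro mult_left_mono) auto
  \<comment> \<open>The \<open>nsq d a\<close> part cancels the one in \<open>step_Q\<close>, and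
    \<open>\<theta> / 2 * D\<close> is kept to pay for the extra weight \<open>\<theta> / 2\<close>
    on the new gap.\<close>
  then have s1: "\<theta> / 2 * D + (\<sigma> * \<theta> / 4 + \<theta>\<^sup>2 * \<sigma> / 8) * nsq d a \<le> \<theta> / 2 * (1 + \<theta>) * ip d (g X) a"
  proof -
    have "\<theta> / 2 * (1 + \<theta>) * (D + \<sigma> / 2 * nsq d a) =
       (\<theta> / 2 * D + (\<sigma> * \<theta> / 4 + \<theta>\<^sup>2 * \<sigma> / 8) * nsq d a) + (\<theta>\<^sup>2 / 2 * D + \<theta>\<^sup>2 * \<sigma> / 8 * nsq d a)"
      by (simp add: power2_eq_square field_simps)
    moreover have "0 \<le> \<theta>\<^sup>2 / 2 * D + \<theta>\<^sup>2 * \<sigma> / 8 * nsq d a" using D0 sigma_pos by simp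
    ultimately show ?thesis using \<open>\<theta> / 2 * (1 + \<theta>) * (D + _) \<le> _\<close> by linarith
  qed
  have g0: "0 \<le> \<eta> * nsq d (g X)" "0 \<le> \<eta> * nsq d e" "0 \<le> \<eta> * W'" using \<eta>0 W0 by auto
  have R_D: "R - G u \<le> D + 2 * (\<eta> * nsq d e) + (\<eta> * W') / 16"
    using step_R g0 by (simp add: D_def)
  have "\<theta> / 2 * (R - G u) \<le> \<theta> / 2 * (D + 2 * (\<eta> * nsq d e) + (\<eta> * W') / 16)"
    using R_D \<theta> by (intro mult_left_mono) auto
  also have "\<dots> = \<theta> / 2 * D + \<theta> / 2 * (2 * (\<eta> * nsq d e) + (\<eta> * W') / 16)"
    by (simp add: algebra_simps)
  finally have s2': "\<theta> / 2 * (R - G u) \<le> \<theta> / 2 * D + \<theta> / 2 * (2 * (\<eta> * nsq d e) + (\<eta> * W') / 16)" .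
  moreover have "\<theta> / 2 * (2 * (\<eta> * nsq d e) + (\<eta> * W') / 16) \<le> 1 / 2 * (2 * (\<eta> * nsq d e) + (\<eta> * W') / 16)"
    using \<theta> g0 by (intro mult_right_mono) auto
  moreover have "1 / 2 * (2 * (\<eta> * nsq d e) + (\<eta> * W') / 16) = \<eta> * nsq d e + (\<eta> * W') / 32"
    by (simp add: field_simps)
  ultimately have s2: "\<theta> / 2 * (R - G u) \<le> \<theta> / 2 * D + (\<eta> * nsq d e + (\<eta> * W') / 32)"
    by (metis add_left_mono order_trans)
  have e4: "\<eta> * nsq d e \<le> 2 / 5 * (\<theta> / \<sigma> * nsq d e)"
  proof -
    have "\<eta> \<le> 2 / 5 * (\<theta> / \<sigma>)" using \<theta> sigma_pos
      by (simp add: \<eta> power2_eq_square divide_right_mono field_simps)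
    then have "\<eta> * nsq d e \<le> 2 / 5 * (\<theta> / \<sigma>) * nsq d e" by (intro mult_right_mono) auto
    then show ?thesis by simp
  qed
  have s3: "(1 + \<theta> / 2) * (R - G u) + \<sigma> / 4 * (1 + \<theta>) * Q \<le>
      potential \<theta> u X Z + 4 * (\<theta> / \<sigma> * nsq d e) + \<eta> / 4 * W'"
  proof -
    have combine: "l + q \<le> Pt + 4 * E + k3"
      if "Pt = GY - Gu + B" "l = (R' - Gu) + tR" "C = 2 * E + x / 4" "tD + A \<le> ipa" "tR \<le> tD + (x + w / 32)"
        "R' \<le> GX - k4 + k5 + k6" "q \<le> B + A + i - ipa + k1 + C + k2" "GX + i \<le> GY" "x \<le> 2 / 5 * E"
        "k1 = y / 4" "k2 = w / 8" "k3 = w / 4" "k4 = 5 / 8 * y" "k5 = 2 * x" "k6 = w / 16"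
        "0 \<le> y" "0 \<le> x" "0 \<le> w"
      for l q Pt E GY Gu B R' tR C x tD A ipa w GX k1 k2 k3 k4 k5 k6 i y :: real
      using that by linarith
    show ?thesis
    proof (rule combine[OF _ _ _ s1 s2 step_R step_Q low_Y e4 _ _ _ _ _ _ g0])
      show "potential \<theta> u X Z = G Y - G u + \<sigma> / 4 * (1 + \<theta> / 4) * nsq d b"
        by (simp add: potential_def Y_def b_def)
      show "(1 + \<theta> / 2) * (R - G u) = (R - G u) + \<theta> / 2 * (R - G u)"
        by (simp add: algebra_simps)
      show "(2 * \<theta> / \<sigma> + \<eta> / 4) * nsq d e = 2 * (\<theta> / \<sigma> * nsq d e) + (\<eta> * nsq d e) / 4"
        by (simp add: algebra_simps)
    qed (simp_all add: D_def)
  qed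
  define P' where "P' = expect M (\<lambda>s. potential \<theta> u (X' s) (Z' s))"
  have P': "P' = (R - G u) + (1 + \<theta> / 4) * (\<sigma> / 4) * Q"
    unfolding P'_def potential_def mix R_def Q_def by (simp add: expect_add[OF fin] expect_diff[OF fin])
  have P'0: "0 \<le> P'"
    unfolding P'_def
  proof (rule order.trans[OF _ expect_mono[OF fin, of "\<lambda>_. 0"]])
    fix s assume s: "s \<in> set_pmf M"
    have "Z' s \<in> Rsp d" unfolding Z' using X Z HR[OF s] by (intro Rsp_intros)
    moreover from this have "X' s \<in> Rsp d" unfolding X' using X HR[OF s] by (intro Rsp_intros)
    ultimately show "0 \<le> potential \<theta> u (X' s) (Z' s)"
      using u \<theta> by (intro potential_nonneg) auto
  qed simp
  have Q0: "0 \<le> Q" unfolding Q_def by (rule expect_nonneg) simp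
  \<comment> \<open>The weight \<open>1 + \<theta> / 4\<close> in the potential is made for this
    point: \<open>(1 + \<theta> / 2) * (1 + \<theta> / 4) \<le> 1 + \<theta>\<close>, so the factor
    \<open>1 + \<theta> / 2\<close> remains as contraction after the gradient error has been
    paid.\<close>
  have "(1 + \<theta> / 2) * P' \<le> (1 + \<theta> / 2) * (R - G u) + \<sigma> / 4 * (1 + \<theta>) * Q"
  proof -
    have "\<theta> * \<theta> \<le> 1 * \<theta>" using \<theta> by (intro mult_right_mono) auto
    moreover have "(1 + \<theta> / 2) * (1 + \<theta> / 4) = 1 + 3 / 4 * \<theta> + (\<theta> * \<theta>) / 8"
      by (simp add: field_simps)
    ultimately have "(1 + \<theta> / 2) * (1 + \<theta> / 4) \<le> 1 + \<theta>" using \<theta> by linarith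
    then have "(1 + \<theta> / 2) * (1 + \<theta> / 4) * (\<sigma> / 4 * Q) \<le> (1 + \<theta>) * (\<sigma> / 4 * Q)"
      using Q0 sigma_pos by (intro mult_right_mono) auto
    moreover have "(1 + \<theta> / 2) * P' = (1 + \<theta> / 2) * (R - G u) + (1 + \<theta> / 2) * (1 + \<theta> / 4) * (\<sigma> / 4 * Q)"
      unfolding P' by (simp only: distrib_left[of "1 + \<theta> / 2" "R - G u"] mult.assoc)
    moreover have "(1 + \<theta>) * (\<sigma> / 4 * Q) = \<sigma> / 4 * (1 + \<theta>) * Q" by simp
    ultimately show ?thesis by (simp only: add_left_mono)
  qed
  then have s4: "(1 + \<theta> / 2) * P' \<le> potential \<theta> u X Z + 36 * \<theta> * \<sigma> * nsq d (\<lambda>j. xr j - X j) + 2 * \<theta>\<^sup>2 / \<sigma> * W"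
  proof -
    have "\<theta> / \<sigma> * nsq d e \<le> \<theta> / \<sigma> * (9 * \<sigma>\<^sup>2 * nsq d (\<lambda>j. xr j - X j))"
      using e_le \<theta> sigma_pos by (intro mult_left_mono) auto
    also have "\<dots> = 9 * \<theta> * \<sigma> * nsq d (\<lambda>j. xr j - X j)"
      using sigma_pos by (simp add: power2_eq_square)
    finally have "4 * (\<theta> / \<sigma> * nsq d e) \<le> 36 * \<theta> * \<sigma> * nsq d (\<lambda>j. xr j - X j)" by simp
    moreover have "\<eta> / 4 * W' \<le> 2 * \<theta>\<^sup>2 / \<sigma> * W"
      using var W0 sigma_pos unfolding W'_def[symmetric] \<eta> by (intro mult_mono) (auto simp: field_simps)
    ultimately show ?thesis
      using s3 \<open>(1 + \<theta> / 2) * P' \<le> (1 + \<theta> / 2) * (R - G u) + _\<close> by linarith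
  qed
  define B where "B = 36 * \<theta> * \<sigma> * nsq d (\<lambda>j. xr j - X j) + 2 * \<theta>\<^sup>2 / \<sigma> * W"
  have B0: "0 \<le> B" using \<theta> sigma_pos var W0 unfolding B_def W'_def[symmetric] by simp
  \<comment> \<open>\<open>1 - \<theta> / 4\<close> is at least the inverse of
    \<open>1 + \<theta> / 2\<close>; using it for the division requires \<open>P'\<close> to be
    nonnegative.\<close>
  have "P' \<le> (1 - \<theta> / 4) * ((1 + \<theta> / 2) * P')"
  proof -
    have "\<theta> * \<theta> \<le> 1 * \<theta>" using \<theta> by (intro mult_right_mono) auto
    then have "1 \<le> (1 - \<theta> / 4) * (1 + \<theta> / 2)" using \<theta> by (simp add: algebra_simps)
    then have "1 * P' \<le> (1 - \<theta> / 4) * (1 + \<theta> / 2) * P'" using P'0 by (intro mult_right_mono)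
    then show ?thesis by (simp add: mult.assoc)
  qed
  also have "\<dots> \<le> (1 - \<theta> / 4) * (potential \<theta> u X Z + B)"
    using s4 \<theta> unfolding B_def by (intro mult_left_mono) auto
  also have "\<dots> \<le> (1 - \<theta> / 4) * potential \<theta> u X Z + 1 * B"
    unfolding distrib_left using \<theta> B0 by (intro add_left_mono mult_right_mono) auto
  finally show ?thesis unfolding P'_def B_def by simp
qed

end

section \<open>The error memories\<close>

text \<open>
  The compression noise of the averaged memory is controlled by the squared norms of the memories of
  the individual workers, with a factor \<open>1 / P\<^sup>2\<close>. Adding these norms with exactly this weight
  yields a quantity whose recursion closes and still gains the factor \<open>1 / P\<close>.
\<close>

definition memory_norm :: "nat \<Rightarrow> nat \<Rightarrow> (nat \<Rightarrow> rvec) \<Rightarrow> real" where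
  "memory_norm d P u = nsq d (\<lambda>j. 1 / real P * (\<Sum>p=1..P. u p j))
     + 1 / (real P)\<^sup>2 * (\<Sum>p=1..P. nsq d (u p))"

lemma memory_norm_nonneg [simp]: "0 \<le> memory_norm d P u"
  by (simp add: memory_norm_def sum_nonneg)

lemma nsq_average_le_memory_norm:
  "nsq d (\<lambda>j. 1 / real P * (\<Sum>p=1..P. u p j)) \<le> memory_norm d P u"
  by (simp add: memory_norm_def sum_nonneg)

lemma memory_norm_coordinates:
  "memory_norm d P u =
    (\<Sum>j<d. (1 / real P * (\<Sum>p=1..P. u p j))\<^sup>2 + 1 / (real P)\<^sup>2 * (\<Sum>p=1..P. (u p j)\<^sup>2))"
  unfolding memory_norm_def nsq_def sum.distrib sum_distrib_left
  by (rule arg_cong2[where f = "(+)", OF refl sum.swap])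

lemma nsq_combination_le:
  assumes "\<And>a b :: real. (r * a + s * b)\<^sup>2 \<le> A * a\<^sup>2 + B * b\<^sup>2"
  shows "nsq d (\<lambda>j. r * x j + s * y j) \<le> A * nsq d x + B * nsq d y"
  unfolding nsq_def sum_distrib_left sum.distrib[symmetric] by (intro sum_mono assms)

text \<open>Both parts of \<open>memory_norm\<close> are sums of squares of linear forms in the
  memories, so a scalar inequality in \<open>a\<close> and \<open>b\<close> lifts term by
  term.\<close>

lemma memory_norm_combination_le:
  assumes "\<And>a b :: real. (r * a + s * b)\<^sup>2 \<le> A * a\<^sup>2 + B * b\<^sup>2"
  shows "memory_norm d P (\<lambda>p j. r * u p j + s * v p j) \<le> A * memory_norm d P u + B * memory_norm d P v"
proof -
  have "(\<lambda>j. 1 / real P * (\<Sum>p=1..P. r * u p j + s * v p j)) =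
      (\<lambda>j. r * (1 / real P * (\<Sum>p=1..P. u p j)) + s * (1 / real P * (\<Sum>p=1..P. v p j)))"
    by (intro ext) (simp add: sum.distrib add_divide_distrib flip: sum_distrib_left)
  then have "nsq d (\<lambda>j. 1 / real P * (\<Sum>p=1..P. r * u p j + s * v p j)) \<le>
      A * nsq d (\<lambda>j. 1 / real P * (\<Sum>p=1..P. u p j)) + B * nsq d (\<lambda>j. 1 / real P * (\<Sum>p=1..P. v p j))"
    by (simp only: nsq_combination_le[OF assms])
  moreover have "1 / (real P)\<^sup>2 * (\<Sum>p=1..P. nsq d (\<lambda>j. r * u p j + s * v p j)) \<le>
      1 / (real P)\<^sup>2 * (\<Sum>p=1..P. A * nsq d (u p) + B * nsq d (v p))"
    by (intro mult_left_mono sum_mono nsq_combination_le assms) auto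
  ultimately show ?thesis
    by (simp add: memory_norm_def sum.distrib sum_distrib_left algebra_simps)
qed

lemma convex_square_le:
  fixes a b \<beta> :: real
  assumes "0 \<le> \<beta>" "\<beta> \<le> 1"
  shows "((1 - \<beta>) * a + \<beta> * b)\<^sup>2 \<le> (1 - \<beta>) * a\<^sup>2 + \<beta> * b\<^sup>2"
proof -
  have "(1 - \<beta>) * a\<^sup>2 + \<beta> * b\<^sup>2 - ((1 - \<beta>) * a + \<beta> * b)\<^sup>2 = \<beta> * (1 - \<beta>) * (a - b)\<^sup>2"
    by (simp add: power2_eq_square algebra_simps)
  moreover have "0 \<le> \<beta> * (1 - \<beta>) * (a - b)\<^sup>2" using assms by simp
  ultimately show ?thesis by linarith
qed

text \<open>With \<open>s = \<gamma> / 2\<close> the coefficient of \<open>b^2\<close> is at most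
  \<open>3 * \<alpha>^2 / \<gamma>\<close>. Convexity would give \<open>\<alpha>\<close> instead,
  and the memory of \<open>x\<close> would then be smaller than that of \<open>z\<close> only by the
  factor \<open>\<theta> / \<gamma>\<close> and not by its square. For the merge with weight
  \<open>\<beta>\<close>, convexity is sufficient.\<close>

lemma young_square_le:
  fixes a b \<alpha> s :: real
  assumes "0 < s" "0 \<le> \<alpha>" "\<alpha> \<le> 1"
  shows "((1 - \<alpha>) * a + \<alpha> * b)\<^sup>2 \<le> (1 + s) * a\<^sup>2 + (1 + 1 / s) * \<alpha>\<^sup>2 * b\<^sup>2"
proof -
  have "0 \<le> (s * ((1 - \<alpha>) * a) - \<alpha> * b)\<^sup>2 / s" using assms by simp
  also have "\<dots> = s * ((1 - \<alpha>) * a)\<^sup>2 + 1 / s * (\<alpha> * b)\<^sup>2 - 2 * ((1 - \<alpha>) * a) * (\<alpha> * b)"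
    using assms by (simp add: power2_eq_square field_simps)
  finally have "((1 - \<alpha>) * a + \<alpha> * b)\<^sup>2 \<le> (1 + s) * ((1 - \<alpha>) * a)\<^sup>2 + (1 + 1 / s) * (\<alpha> * b)\<^sup>2"
    by (simp add: power2_sum distrib_right)
  moreover have "(1 - \<alpha>)\<^sup>2 * a\<^sup>2 \<le> 1 * a\<^sup>2"
    using assms by (intro mult_right_mono) (auto simp: power_le_one)
  then have "(1 + s) * ((1 - \<alpha>) * a)\<^sup>2 \<le> (1 + s) * a\<^sup>2"
    using assms by (intro mult_left_mono) (auto simp: power_mult_distrib)
  ultimately show ?thesis by (simp add: power_mult_distrib mult.assoc)
qed

text \<open>Compression is unbiased, so the mean of the new memory is
  \<open>(1 - \<gamma>) * u\<close>: the correction \<open>\<gamma> / s * u\<close> added before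
  compressing is what drains it. The variance is proportional to the square of
  \<open>s * h + \<gamma> * u\<close>; its \<open>u\<close> part is absorbed by the contraction, and
  its \<open>h\<close> part is the source term.\<close>

lemma memory_norm_compress:
  fixes u h :: "nat \<Rightarrow> rvec" and \<gamma> s \<omega> :: real
  assumes q: "1 \<le> q" "q \<le> d" and s: "0 < s" and P: "1 \<le> P"
    and \<omega>: "real d / real q = 2 * \<omega>" and \<gamma>: "0 \<le> \<gamma>" "\<gamma> + 8 * (\<omega> * \<gamma>) \<le> 1"
  shows "expect (Pi_pmf {1..P} dflt (\<lambda>p. rand_comp d q (\<lambda>j. h p j + \<gamma> / s * u p j)))
      (\<lambda>c. memory_norm d P (\<lambda>p j. u p j - s * (c p j - h p j)))
    \<le> (1 - \<gamma>) * memory_norm d P u + 8 * \<omega> * s\<^sup>2 / (real P)\<^sup>2 * (\<Sum>p=1..P. nsq d (h p))"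
proof -
  define g where "g p j = h p j + \<gamma> / s * u p j" for p j
  define M where "M = Pi_pmf {1..P} dflt (\<lambda>p. rand_comp d q (g p))"
  define K where "K = real d / real q - 1"
  have finQ: "finite (set_pmf (rand_comp d q x))" for x by (rule finite_set_rand_comp[OF q])
  have finM: "finite (set_pmf M)" unfolding M_def by (intro finite_set_Pi_pmf finQ) simp
  have \<omega>0: "0 < \<omega>" using \<omega> q by (smt (verit) divide_pos_pos of_nat_0_less_iff less_le_trans zero_less_one)
  have K: "0 \<le> K" "K \<le> 2 * \<omega>" using q unfolding K_def \<omega>[symmetric] by (auto simp: field_simps)
  \<comment> \<open>The scalar \<open>a\<close> lets one computation serve both parts of
    \<open>memory_norm\<close>: \<open>1 / P\<close> for the average and 1 for the single
    workers.\<close>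
  have dev: "expect (rand_comp d q (g p)) (\<lambda>y. (a * (u p j - s * (y j - h p j)))\<^sup>2) =
      (a * ((1 - \<gamma>) * u p j))\<^sup>2 + a\<^sup>2 * s\<^sup>2 * K * (g p j)\<^sup>2"
    and mean: "expect (rand_comp d q (g p)) (\<lambda>y. a * (u p j - s * (y j - h p j))) = a * ((1 - \<gamma>) * u p j)"
    and cvar: "expect (rand_comp d q (g p)) (\<lambda>y. (a * (u p j - s * (y j - h p j)) - a * ((1 - \<gamma>) * u p j))\<^sup>2) =
      a\<^sup>2 * s\<^sup>2 * K * (g p j)\<^sup>2" if j: "j < d" for p j a
  proof -
    have sg: "s * g p j = s * h p j + \<gamma> * u p j" using s by (simp add: g_def distrib_left)
    have eq: "a * (u p j - s * (y j - h p j)) = (a * (u p j + s * h p j)) + (- a * s) * y j" for y :: rvec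
      by (simp add: algebra_simps)
    have c: "(a * (u p j + s * h p j)) + (- a * s) * g p j = a * ((1 - \<gamma>) * u p j)"
    proof -
      have "(a * (u p j + s * h p j)) + (- a * s) * g p j = a * (u p j + s * h p j - s * g p j)"
        by (simp add: algebra_simps)
      then show ?thesis unfolding sg by (simp add: algebra_simps)
    qed
    show 1: "expect (rand_comp d q (g p)) (\<lambda>y. (a * (u p j - s * (y j - h p j)))\<^sup>2) =
      (a * ((1 - \<gamma>) * u p j))\<^sup>2 + a\<^sup>2 * s\<^sup>2 * K * (g p j)\<^sup>2"
      unfolding eq expect_square_affine[OF finQ] expect_rand_comp[OF q j] c
        expect_rand_comp_deviation[OF q j] K_def
      by (simp add: power_mult_distrib)
    show 2: "expect (rand_comp d q (g p)) (\<lambda>y. a * (u p j - s * (y j - h p j))) = a * ((1 - \<gamma>) * u p j)"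
      unfolding eq c[symmetric] by (simp add: expect_diff[OF finQ] expect_rand_comp[OF q j])
    show "expect (rand_comp d q (g p)) (\<lambda>y. (a * (u p j - s * (y j - h p j)) - a * ((1 - \<gamma>) * u p j))\<^sup>2) =
      a\<^sup>2 * s\<^sup>2 * K * (g p j)\<^sup>2"
      using expect_square_affine[OF finQ[of "g p"], where a = 0 and b = 1
          and X = "\<lambda>y. a * (u p j - s * (y j - h p j))"] 1
      unfolding 2 by simp
  qed
  have coord: "expect M (\<lambda>c. (1 / real P * (\<Sum>p=1..P. u p j - s * (c p j - h p j)))\<^sup>2
        + 1 / (real P)\<^sup>2 * (\<Sum>p=1..P. (u p j - s * (c p j - h p j))\<^sup>2))
      \<le> (1 - \<gamma>) * ((1 / real P * (\<Sum>p=1..P. u p j))\<^sup>2 + 1 / (real P)\<^sup>2 * (\<Sum>p=1..P. (u p j)\<^sup>2))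
        + 8 * \<omega> * s\<^sup>2 / (real P)\<^sup>2 * (\<Sum>p=1..P. (h p j)\<^sup>2)" if j: "j < d" for j
  proof -
    define U where "U = (\<Sum>p=1..P. (u p j)\<^sup>2)"
    define Hh where "Hh = (\<Sum>p=1..P. (h p j)\<^sup>2)"
    define gg where "gg = (\<Sum>p=1..P. (g p j)\<^sup>2)"
    define ub where "ub = 1 / real P * (\<Sum>p=1..P. u p j)"
    have U0: "0 \<le> U" "0 \<le> Hh" "0 \<le> gg" by (auto simp: U_def Hh_def gg_def sum_nonneg)
    have 1: "expect M (\<lambda>c. (1 / real P * (\<Sum>p=1..P. u p j - s * (c p j - h p j)))\<^sup>2) =
        ((1 - \<gamma>) * ub)\<^sup>2 + (1 / (real P)\<^sup>2 * s\<^sup>2 * K) * gg"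
    proof -
      have "expect M (\<lambda>c. (0 + (\<Sum>p=1..P. 1 / real P * (u p j - s * (c p j - h p j))))\<^sup>2) =
        (0 + (\<Sum>p=1..P. 1 / real P * ((1 - \<gamma>) * u p j)))\<^sup>2 + (\<Sum>p=1..P. (1 / real P)\<^sup>2 * s\<^sup>2 * K * (g p j)\<^sup>2)"
        unfolding M_def
        by (subst expect_Pi_square[where X = "\<lambda>p y. 1 / real P * (u p j - s * (y j - h p j))"
              and \<mu> = "\<lambda>p. 1 / real P * ((1 - \<gamma>) * u p j)"])
          (simp_all only: mean[OF j] cvar[OF j] finQ finite_atLeastAtMost)
      also have "(\<Sum>p=1..P. 1 / real P * ((1 - \<gamma>) * u p j)) = (1 - \<gamma>) * ub"
        by (simp add: ub_def sum_distrib_left sum_divide_distrib)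
      finally show ?thesis
        by (simp only: gg_def sum_distrib_left[symmetric] add_0_left power_one_over)
    qed
    have 2: "expect M (\<lambda>c. 1 / (real P)\<^sup>2 * (\<Sum>p=1..P. (u p j - s * (c p j - h p j))\<^sup>2)) =
        1 / (real P)\<^sup>2 * ((1 - \<gamma>)\<^sup>2 * U + (s\<^sup>2 * K) * gg)"
    proof -
      have "expect M (\<lambda>c. \<Sum>p=1..P. (u p j - s * (c p j - h p j))\<^sup>2) =
          (\<Sum>p=1..P. expect (rand_comp d q (g p)) (\<lambda>y. (u p j - s * (y j - h p j))\<^sup>2))"
        unfolding M_def by (rule expect_Pi_sum) (auto simp: finQ)
      also have "\<dots> = (1 - \<gamma>)\<^sup>2 * U + (s\<^sup>2 * K) * gg"
        using dev[OF j, of _ 1] by (simp add: U_def gg_def sum.distrib sum_distrib_left power_mult_distrib)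
      finally show ?thesis by (simp add: expect_sum[OF finM])
    qed
    have gg: "K * (s\<^sup>2 * gg) \<le> 4 * \<omega> * (s\<^sup>2 * Hh + \<gamma>\<^sup>2 * U)"
    proof -
      have "s\<^sup>2 * (g p j)\<^sup>2 \<le> 2 * (s\<^sup>2 * (h p j)\<^sup>2) + 2 * (\<gamma>\<^sup>2 * (u p j)\<^sup>2)" for p
      proof -
        have "s * g p j = s * h p j + \<gamma> * u p j" using s by (simp add: g_def distrib_left)
        then have "s\<^sup>2 * (g p j)\<^sup>2 = (s * h p j + \<gamma> * u p j)\<^sup>2" by (metis power_mult_distrib)
        also have "\<dots> \<le> 2 * (s * h p j)\<^sup>2 + 2 * (\<gamma> * u p j)\<^sup>2" by (rule square_sum_le)
        finally show ?thesis by (simp add: power_mult_distrib)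
      qed
      then have "s\<^sup>2 * gg \<le> 2 * (s\<^sup>2 * Hh) + 2 * (\<gamma>\<^sup>2 * U)"
        unfolding gg_def Hh_def U_def sum_distrib_left sum.distrib[symmetric] by (intro sum_mono)
      then have "K * (s\<^sup>2 * gg) \<le> (2 * \<omega>) * (2 * (s\<^sup>2 * Hh) + 2 * (\<gamma>\<^sup>2 * U))"
        using K U0 by (intro mult_mono) auto
      then show ?thesis by (simp add: algebra_simps)
    qed
    \<comment> \<open>Here \<open>\<gamma>\<close> must be a small multiple of \<open>k / d\<close>:
      the noise fed back by the memory is of order \<open>\<omega> * \<gamma>^2\<close> and has to
      stay below the gain \<open>\<gamma>\<close>.\<close>
    have con: "(1 - \<gamma>)\<^sup>2 + 8 * \<omega> * \<gamma>\<^sup>2 \<le> 1 - \<gamma>"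
    proof -
      have "\<gamma> * (\<gamma> + 8 * (\<omega> * \<gamma>)) \<le> \<gamma> * 1" using \<gamma> by (intro mult_left_mono)
      then show ?thesis by (simp add: power2_eq_square algebra_simps)
    qed
    have "8 * \<omega> * \<gamma>\<^sup>2 \<ge> 0" using \<omega>0 by simp
    have "expect M (\<lambda>c. (1 / real P * (\<Sum>p=1..P. u p j - s * (c p j - h p j)))\<^sup>2
        + 1 / (real P)\<^sup>2 * (\<Sum>p=1..P. (u p j - s * (c p j - h p j))\<^sup>2)) =
        (1 - \<gamma>)\<^sup>2 * ub\<^sup>2 + 1 / (real P)\<^sup>2 * ((1 - \<gamma>)\<^sup>2 * U + 2 * (K * (s\<^sup>2 * gg)))"
      unfolding expect_add[OF finM] 1 2 power_mult_distrib[of "1 - \<gamma>"] by (simp add: algebra_simps)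
    also have "\<dots> \<le> (1 - \<gamma>) * ub\<^sup>2 + 1 / (real P)\<^sup>2 * ((1 - \<gamma>) * U + 8 * \<omega> * (s\<^sup>2 * Hh))"
    proof -
      have "(1 - \<gamma>)\<^sup>2 * ub\<^sup>2 \<le> (1 - \<gamma>) * ub\<^sup>2"
        using con \<open>8 * \<omega> * \<gamma>\<^sup>2 \<ge> 0\<close> by (intro mult_right_mono) auto
      moreover have "((1 - \<gamma>)\<^sup>2 + 8 * \<omega> * \<gamma>\<^sup>2) * U \<le> (1 - \<gamma>) * U"
        using con U0 by (intro mult_right_mono)
      then have "(1 - \<gamma>)\<^sup>2 * U + 2 * (K * (s\<^sup>2 * gg)) \<le> (1 - \<gamma>) * U + 8 * \<omega> * (s\<^sup>2 * Hh)"
        using gg by (simp add: algebra_simps)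
      then have "1 / (real P)\<^sup>2 * ((1 - \<gamma>)\<^sup>2 * U + 2 * (K * (s\<^sup>2 * gg))) \<le>
          1 / (real P)\<^sup>2 * ((1 - \<gamma>) * U + 8 * \<omega> * (s\<^sup>2 * Hh))"
        by (intro mult_left_mono) auto
      ultimately show ?thesis by (rule add_mono)
    qed
    also have "\<dots> = (1 - \<gamma>) * (ub\<^sup>2 + 1 / (real P)\<^sup>2 * U) + 8 * \<omega> * s\<^sup>2 / (real P)\<^sup>2 * Hh"
      by (simp add: algebra_simps add_divide_distrib diff_divide_distrib)
    finally show ?thesis unfolding U_def Hh_def ub_def .
  qed
  have "expect M (\<lambda>c. memory_norm d P (\<lambda>p j. u p j - s * (c p j - h p j))) \<le>
     (\<Sum>j<d. (1 - \<gamma>) * ((1 / real P * (\<Sum>p=1..P. u p j))\<^sup>2 + 1 / (real P)\<^sup>2 * (\<Sum>p=1..P. (u p j)\<^sup>2))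
        + 8 * \<omega> * s\<^sup>2 / (real P)\<^sup>2 * (\<Sum>p=1..P. (h p j)\<^sup>2))"
    unfolding memory_norm_coordinates expect_sum[OF finM] by (intro sum_mono coord) auto
  also have "\<dots> = (1 - \<gamma>) * memory_norm d P u + 8 * \<omega> * s\<^sup>2 / (real P)\<^sup>2 * (\<Sum>p=1..P. nsq d (h p))"
  proof -
    have swap: "(\<Sum>p=1..P. nsq d (h p)) = (\<Sum>j<d. \<Sum>p=1..P. (h p j)\<^sup>2)"
      unfolding nsq_def by (rule sum.swap)
    show ?thesis
      unfolding memory_norm_coordinates swap sum.distrib sum_distrib_left[symmetric] ..
  qed
  finally show ?thesis unfolding M_def g_def .
qed

text \<open>
  \<open>A\<close> is the expected potential and \<open>M\<close>, \<open>Z\<close> are the expected memories of \<open>x\<close> and \<open>z\<close>. The three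
  are bounded simultaneously: \<open>M\<close> and \<open>Z\<close> stay below fixed multiples \<open>\<mu>\<close>, \<open>\<zeta>\<close> of \<open>V + \<sigma> a\<close>, where \<open>a\<close>
  is the geometrically decaying bound on \<open>A\<close>. It matters that \<open>\<mu>\<close> is smaller than \<open>\<zeta>\<close> by
  \<open>(\<theta> / \<gamma>)\<^sup>2\<close>; this produces the exponent \<open>1/4\<close> in the last term of the rate.
\<close>

lemma coupled_recursion_bound:
  fixes A M Z :: "nat \<Rightarrow> real" and \<sigma> \<gamma> \<omega> \<theta> P V \<epsilon> \<alpha> \<beta> A0 \<mu> E0 :: real
  assumes \<sigma>: "0 < \<sigma>" and \<gamma>: "0 < \<gamma>" "\<gamma> \<le> 1 / 5" and \<omega>: "0 < \<omega>" "\<omega> * \<gamma> \<le> 1 / 10"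
    and \<theta>: "0 < \<theta>" "\<theta> \<le> \<gamma> / 10 ^ 5" and P: "1 \<le> P" and V: "0 \<le> V"
    and \<alpha>: "0 \<le> \<alpha>" "\<alpha> \<le> \<theta> / 2" and \<beta>: "0 \<le> \<beta>" "\<beta> \<le> \<theta>"
    and noise1: "\<theta> * V / P \<le> \<epsilon> / 10 ^ 5" and noise2: "(\<theta> / \<gamma>) ^ 4 * V / P \<le> \<epsilon> / 10 ^ 20"
    and nonneg: "\<And>t. 0 \<le> A t" "\<And>t. 0 \<le> M t" "\<And>t. 0 \<le> Z t"
    and init: "A 0 \<le> A0" "M 0 = 0" "Z 0 = 0"
    and recA: "\<And>t. A (Suc t) \<le> (1 - \<theta> / 4) * A t + 36 * \<theta> * \<sigma> * M t + 2 * \<theta>\<^sup>2 / \<sigma> * (V / P)"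
    and recZ: "\<And>t. Z (Suc t) \<le> (1 - \<gamma>) * (Z t + \<beta> * M t)
      + 8 * (\<omega> * \<theta>\<^sup>2 / (\<sigma>\<^sup>2 * P)) * (2 * V + 144 * \<sigma> * A t + 36 * \<sigma>\<^sup>2 * M t)"
    and recM: "\<And>t. M (Suc t) \<le> (1 - \<gamma> / 2) * M t
      + 192 * \<theta>\<^sup>2 * (\<omega> * \<theta>\<^sup>2 / (\<sigma>\<^sup>2 * P)) * (2 * V + 144 * \<sigma> * A t + 36 * \<sigma>\<^sup>2 * M t)
      + 3 * \<alpha>\<^sup>2 / \<gamma> * Z (Suc t)"
  shows "12 * A T + 3 * \<sigma> * M T \<le> 13 * ((1 - \<theta> / 16) ^ T * A0) + 3 * \<epsilon> / (1000 * \<sigma>)"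
proof -
  define q where "q = \<omega> * \<theta>\<^sup>2 / (\<sigma>\<^sup>2 * P)"
  \<comment> \<open>\<open>\<zeta>\<close> balances inflow and contraction of \<open>Z\<close>: the
    source \<open>8 * q * (180 * v t)\<close> equals \<open>\<gamma> / 4 * \<zeta> * v t\<close>.
    The factor \<open>40\<close> in \<open>\<mu>\<close> makes the inflow from \<open>Z\<close>
    small against \<open>\<gamma> * \<mu>\<close>, and \<open>E0\<close> is the level at which
    sampling noise costs at most \<open>\<theta> / 10 * E0\<close> per step.\<close>
  define \<zeta> where "\<zeta> = 5760 * q / \<gamma>"
  define \<mu> where "\<mu> = 40 * (\<theta> / \<gamma>)\<^sup>2 * \<zeta>"
  define E0 where "E0 = 2 * \<epsilon> / (10 ^ 4 * \<sigma>)"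
  define a where "a t = (1 - \<theta> / 16) ^ t * A0 + E0" for t
  define v where "v t = V + \<sigma> * a t" for t
  define \<kappa> where "\<kappa> = \<theta> / \<gamma>"
  have \<kappa>: "0 < \<kappa>" "\<kappa> \<le> 1 / 10 ^ 5" using \<theta> \<gamma> by (auto simp: \<kappa>_def field_simps)
  have \<theta>1: "\<theta> \<le> 1 / 10 ^ 5" using \<theta> \<gamma> by simp
  have q0: "0 < q" using \<omega> \<theta> \<sigma> P by (simp add: q_def)
  have \<zeta>0: "0 < \<zeta>" using q0 \<gamma> by (simp add: \<zeta>_def)
  have \<mu>0: "0 < \<mu>" using \<zeta>0 \<theta> \<gamma> by (simp add: \<mu>_def)
  have A0: "0 \<le> A0" using init nonneg[of 0] by linarith
  have \<epsilon>0: "0 \<le> \<epsilon>"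
  proof -
    have "0 \<le> \<theta> * V / P" using \<theta> V P by simp
    then have "0 \<le> \<epsilon> / 10 ^ 5" using noise1 by (rule order_trans)
    then show ?thesis by simp
  qed
  have E0: "0 \<le> E0" using \<epsilon>0 \<sigma> by (simp add: E0_def)
  have aE: "E0 \<le> a t" "0 \<le> a t" for t using A0 E0 \<theta>1 \<theta> by (simp_all add: a_def)
  have v0: "0 \<le> v t" for t using V \<sigma> aE by (simp add: v_def)
  \<comment> \<open>Source of the fourth power in \<open>noise2\<close>: one
    \<open>\<kappa>^2\<close> comes from \<open>q / \<gamma>\<close>, up to the bounded factor
    \<open>\<omega> * \<gamma>\<close>, and the other is the ratio of \<open>\<mu>\<close> to
    \<open>\<zeta>\<close>.\<close>
  have \<mu>_small: "\<sigma>\<^sup>2 * \<mu> = 230400 * (\<omega> * \<gamma>) * (\<kappa> ^ 4 / P)"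
    using \<sigma> \<gamma> P unfolding \<mu>_def \<zeta>_def q_def \<kappa>_def by (simp add: field_simps power_numeral_reduce)
  have \<mu>_le: "\<sigma>\<^sup>2 * \<mu> \<le> 23040 * (\<kappa> ^ 4 / P)"
  proof -
    have "(230400 * (\<omega> * \<gamma>)) * (\<kappa> ^ 4 / P) \<le> 23040 * (\<kappa> ^ 4 / P)"
    proof (rule mult_right_mono)
      show "230400 * (\<omega> * \<gamma>) \<le> 23040" using \<omega> by linarith
    qed (use \<kappa> P in auto)
    then show ?thesis unfolding \<mu>_small .
  qed
  have \<mu>_tiny: "\<sigma>\<^sup>2 * \<mu> \<le> 1 / 600"
  proof -
    have "\<kappa> ^ 4 \<le> (1 / 10 ^ 5) ^ 4" using \<kappa> by (intro power_mono) auto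
    then have "\<kappa> ^ 4 / P \<le> (1 / 10 ^ 5) ^ 4 / 1" using P by (intro frac_le) auto
    then have "23040 * (\<kappa> ^ 4 / P) \<le> 23040 * ((1 / 10 ^ 5) ^ 4 / 1)" by (intro mult_left_mono) auto
    also have "\<dots> \<le> 1 / 600" by (simp add: power_divide)
    finally show ?thesis using \<mu>_le by linarith
  qed
  have \<mu>V: "\<sigma> * \<mu> * V \<le> \<epsilon> / \<sigma> / 10 ^ 10"
  proof -
    have "\<sigma>\<^sup>2 * \<mu> * V \<le> 23040 * (\<kappa> ^ 4 / P) * V" using \<mu>_le V by (intro mult_right_mono)
    also have "\<dots> = 23040 * ((\<theta> / \<gamma>) ^ 4 * V / P)" by (simp add: \<kappa>_def)
    also have "\<dots> \<le> 23040 * (\<epsilon> / 10 ^ 20)" using noise2 by simp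
    also have "\<dots> \<le> \<epsilon> / 10 ^ 10" using \<epsilon>0 by simp
    finally have "\<sigma> * (\<sigma> * \<mu> * V) \<le> \<epsilon> / 10 ^ 10" by (simp add: power2_eq_square)
    then show ?thesis using \<sigma> by (simp add: field_simps)
  qed
  have \<theta>V: "\<theta> / \<sigma> * (V / P) \<le> \<epsilon> / \<sigma> / 10 ^ 5"
    using noise1 \<sigma> by (simp add: field_simps)
  have step_a: "a (Suc t) = (1 - \<theta> / 16) * a t + \<theta> / 16 * E0" for t
    by (simp add: a_def algebra_simps)
  \<comment> \<open>\<open>a\<close>, and hence \<open>v\<close>, loses at most the fraction
    \<open>\<theta> / 16\<close> per step, much less than the memories do; this is why bounds by
    multiples of \<open>v\<close> propagate.\<close>
  have a_le: "(1 - \<theta> / 16) * a t \<le> a (Suc t)" for t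
    using step_a \<theta> E0 by simp
  have v_le: "(1 - \<theta> / 16) * v t \<le> v (Suc t)" for t
  proof -
    have "(1 - \<theta> / 16) * V \<le> 1 * V" using \<theta> V by (intro mult_right_mono) auto
    moreover have "\<sigma> * ((1 - \<theta> / 16) * a t) \<le> \<sigma> * a (Suc t)" using a_le \<sigma> by (intro mult_left_mono) auto
    moreover have "(1 - \<theta> / 16) * v t = (1 - \<theta> / 16) * V + \<sigma> * ((1 - \<theta> / 16) * a t)"
      by (simp add: v_def algebra_simps)
    ultimately show ?thesis by (simp add: v_def add_mono)
  qed
  have \<theta>\<mu>: "\<theta> * \<mu> \<le> \<gamma> / 4 * \<zeta>"
  proof -
    have "\<theta> * (40 * \<kappa>\<^sup>2) \<le> \<gamma> / 10 ^ 5 * (40 * 1\<^sup>2)"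
      using \<theta> \<kappa> \<gamma> by (intro mult_mono power_mono) auto
    also have "\<dots> \<le> \<gamma> / 4" using \<gamma> by simp
    finally have "\<theta> * (40 * \<kappa>\<^sup>2) * \<zeta> \<le> \<gamma> / 4 * \<zeta>" using \<zeta>0 by (intro mult_right_mono) auto
    then show ?thesis by (simp add: \<mu>_def \<kappa>_def)
  qed
  have q\<zeta>: "1440 * q = \<gamma> / 4 * \<zeta>" using \<gamma> by (simp add: \<zeta>_def)
  have \<theta>\<zeta>: "\<theta>\<^sup>2 * \<zeta> = \<gamma>\<^sup>2 * \<mu> / 40" using \<gamma> by (simp add: \<mu>_def power_divide)
  have main: "A t \<le> a t \<and> M t \<le> \<mu> * v t \<and> Z t \<le> \<zeta> * v t" for t
  proof (induction t)
    case 0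
    have "A0 \<le> a 0" using E0 by (simp add: a_def)
    then show ?case using init \<mu>0 \<zeta>0 v0[of 0] by auto
  next
    case (Suc t)
    define HH where "HH = 2 * V + 144 * \<sigma> * A t + 36 * \<sigma>\<^sup>2 * M t"
    have HH0: "0 \<le> HH" using V \<sigma> nonneg by (simp add: HH_def)
    have HH: "HH \<le> 180 * v t"
    proof -
      have "\<sigma> * A t \<le> \<sigma> * a t" using Suc \<sigma> by (intro mult_left_mono) auto
      moreover have "\<sigma>\<^sup>2 * M t \<le> \<sigma>\<^sup>2 * (\<mu> * v t)" using Suc by (intro mult_left_mono) auto
      moreover have "\<sigma>\<^sup>2 * (\<mu> * v t) \<le> 1 * v t"
        unfolding mult.assoc[symmetric] using \<mu>_tiny v0 by (intro mult_right_mono) auto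
      moreover have "HH = 2 * V + 144 * (\<sigma> * A t) + 36 * (\<sigma>\<^sup>2 * M t)" by (simp add: HH_def)
      moreover have "2 * V + 144 * (\<sigma> * a t) \<le> 144 * v t" using V by (simp add: v_def)
      ultimately show ?thesis by linarith
    qed
    have Z1: "Z (Suc t) \<le> (1 - \<gamma> / 2) * (\<zeta> * v t)"
    proof -
      have "\<beta> * M t \<le> \<theta> * (\<mu> * v t)" using \<beta> Suc nonneg \<theta> by (intro mult_mono) auto
      also have "\<dots> \<le> \<gamma> / 4 * \<zeta> * v t"
        unfolding mult.assoc[symmetric] using \<theta>\<mu> v0 by (intro mult_right_mono) auto
      finally have "(1 - \<gamma>) * (Z t + \<beta> * M t) \<le> (1 - \<gamma>) * (\<zeta> * v t + \<gamma> / 4 * \<zeta> * v t)"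
        using Suc \<gamma> by (intro mult_left_mono add_mono) auto
      also have "\<dots> \<le> (1 - \<gamma>) * (\<zeta> * v t) + 1 * (\<gamma> / 4 * \<zeta> * v t)"
        unfolding distrib_left using \<gamma> \<zeta>0 v0 by (intro add_mono mult_right_mono) auto
      finally have Z_part: "(1 - \<gamma>) * (Z t + \<beta> * M t) \<le> (1 - \<gamma>) * (\<zeta> * v t) + \<gamma> / 4 * \<zeta> * v t" by simp
      have "8 * q * HH \<le> 8 * q * (180 * v t)" using HH q0 by (intro mult_left_mono) auto
      also have "8 * q * (180 * v t) = \<gamma> / 4 * \<zeta> * v t" unfolding q\<zeta>[symmetric] by simp
      finally have H_part: "8 * q * HH \<le> \<gamma> / 4 * \<zeta> * v t" .
      have "Z (Suc t) \<le> (1 - \<gamma>) * (\<zeta> * v t) + \<gamma> / 4 * \<zeta> * v t + \<gamma> / 4 * \<zeta> * v t"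
        by (rule order_trans[OF recZ[of t, folded q_def HH_def] add_mono[OF Z_part H_part]])
      also have "\<dots> = (1 - \<gamma> / 2) * (\<zeta> * v t)" by (simp add: field_simps)
      finally show ?thesis .
    qed
    \<comment> \<open>\<open>recM\<close> refers to the updated \<open>Z\<close>, so a bound in
      terms of the old \<open>v t\<close> is recorded besides the new invariant.\<close>
    have Z2: "Z (Suc t) \<le> \<zeta> * v t"
    proof -
      have "(1 - \<gamma> / 2) * (\<zeta> * v t) \<le> 1 * (\<zeta> * v t)" using \<gamma> \<zeta>0 v0 by (intro mult_right_mono) auto
      then show ?thesis using Z1 by simp
    qed
    have Z3: "Z (Suc t) \<le> \<zeta> * v (Suc t)"
    proof -
      have "(1 - \<gamma> / 2) * (\<zeta> * v t) \<le> (1 - \<theta> / 16) * (\<zeta> * v t)"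
        using \<gamma> \<theta> \<zeta>0 v0 by (intro mult_right_mono) auto
      also have "\<dots> = \<zeta> * ((1 - \<theta> / 16) * v t)" by simp
      also have "\<dots> \<le> \<zeta> * v (Suc t)" using v_le \<zeta>0 by (intro mult_left_mono) auto
      finally show ?thesis using Z1 by linarith
    qed
    have M3: "M (Suc t) \<le> \<mu> * v (Suc t)"
    proof -
      have "(1 - \<gamma> / 2) * M t \<le> (1 - \<gamma> / 2) * (\<mu> * v t)" using Suc \<gamma> by (intro mult_left_mono) auto
      moreover have "192 * \<theta>\<^sup>2 * q * HH \<le> \<gamma> / 8 * (\<mu> * v t)"
      proof -
        have "192 * \<theta>\<^sup>2 * q * HH \<le> 192 * \<theta>\<^sup>2 * q * (180 * v t)"
          using HH q0 by (intro mult_left_mono) auto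
        also have "\<dots> = 24 * \<theta>\<^sup>2 * (1440 * q) * v t" by simp
        also have "\<dots> = 6 * \<gamma> * (\<theta>\<^sup>2 * \<zeta>) * v t" unfolding q\<zeta> by simp
        also have "\<dots> = (6 / 40 * \<gamma>\<^sup>2) * (\<gamma> * (\<mu> * v t))"
          unfolding \<theta>\<zeta> by (simp add: power2_eq_square)
        also have "\<dots> \<le> 1 / 8 * (\<gamma> * (\<mu> * v t))"
        proof -
          have "\<gamma>\<^sup>2 \<le> (1 / 5)\<^sup>2" using \<gamma> by (intro power_mono) auto
          then show ?thesis using \<gamma> \<mu>0 v0[of t] by (intro mult_right_mono) (auto simp: power2_eq_square)
        qed
        finally show ?thesis by simp
      qed
      moreover have "3 * \<alpha>\<^sup>2 / \<gamma> * Z (Suc t) \<le> \<gamma> / 8 * (\<mu> * v t)"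
      proof -
        have "\<alpha>\<^sup>2 \<le> (\<theta> / 2)\<^sup>2" using \<alpha> by (intro power_mono) auto
        then have "3 * \<alpha>\<^sup>2 / \<gamma> * Z (Suc t) \<le> 3 * (\<theta> / 2)\<^sup>2 / \<gamma> * (\<zeta> * v t)"
          using Z2 nonneg \<gamma> by (intro mult_mono divide_right_mono) auto
        also have "\<dots> = 3 / 4 * (\<theta>\<^sup>2 * \<zeta>) / \<gamma> * v t" by (simp add: power_divide)
        also have "\<dots> = 3 / 160 * (\<gamma> * (\<mu> * v t))"
          unfolding \<theta>\<zeta> using \<gamma> by (simp add: power2_eq_square)
        also have "\<dots> \<le> 1 / 8 * (\<gamma> * (\<mu> * v t))"
          using \<gamma> \<mu>0 v0[of t] by (intro mult_right_mono) auto
        finally show ?thesis by simp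
      qed
      ultimately have "M (Suc t) \<le> (1 - \<gamma> / 2) * (\<mu> * v t) + \<gamma> / 8 * (\<mu> * v t) + \<gamma> / 8 * (\<mu> * v t)"
        by (intro order_trans[OF recM[of t, folded q_def HH_def]] add_mono)
      also have "\<dots> = (1 - \<gamma> / 4) * (\<mu> * v t)" by (simp add: field_simps)
      also have "\<dots> \<le> (1 - \<theta> / 16) * (\<mu> * v t)"
        using \<gamma> \<theta> \<mu>0 v0 by (intro mult_right_mono) auto
      also have "\<dots> = \<mu> * ((1 - \<theta> / 16) * v t)" by simp
      also have "\<dots> \<le> \<mu> * v (Suc t)" using v_le \<mu>0 by (intro mult_left_mono) auto
      finally show ?thesis .
    qed
    \<comment> \<open>Of the rate \<open>1 / 4\<close> the errors consume
      \<open>1 / 80 + 1 / 16 + 1 / 10\<close>; the remaining \<open>3 / 40\<close> still exceeds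
      \<open>1 / 16\<close>.\<close>
    have A3: "A (Suc t) \<le> a (Suc t)"
    proof -
      have "(1 - \<theta> / 4) * A t \<le> (1 - \<theta> / 4) * a t" using Suc \<theta>1 by (intro mult_left_mono) auto
      moreover have "36 * \<theta> * \<sigma> * M t \<le> \<theta> / 80 * a t + \<theta> / 16 * a t"
      proof -
        have "36 * \<theta> * \<sigma> * M t \<le> 36 * \<theta> * \<sigma> * (\<mu> * v t)" using Suc \<theta> \<sigma> by (intro mult_left_mono) auto
        also have "\<dots> = 36 * \<theta> * (\<sigma> * \<mu> * V) + 36 * \<theta> * ((\<sigma>\<^sup>2 * \<mu>) * a t)"
          by (simp add: v_def power2_eq_square algebra_simps)
        also have "\<dots> \<le> 36 * \<theta> * (\<epsilon> / \<sigma> / 10 ^ 10) + 36 * \<theta> * (1 / 600 * a t)"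
          using \<mu>V \<mu>_tiny aE[of t] \<theta> by (intro add_mono mult_left_mono mult_right_mono) auto
        also have "36 * \<theta> * (\<epsilon> / \<sigma> / 10 ^ 10) \<le> \<theta> / 80 * E0"
          using \<theta> \<epsilon>0 \<sigma> by (simp add: E0_def field_simps)
        also have "\<theta> / 80 * E0 \<le> \<theta> / 80 * a t" using aE \<theta> by (intro mult_left_mono) auto
        also have "36 * \<theta> * (1 / 600 * a t) \<le> \<theta> / 16 * a t" using \<theta> aE[of t] by simp
        finally show ?thesis by simp
      qed
      moreover have "2 * \<theta>\<^sup>2 / \<sigma> * (V / P) \<le> \<theta> / 10 * a t"
      proof -
        have "2 * \<theta>\<^sup>2 / \<sigma> * (V / P) = 2 * \<theta> * (\<theta> / \<sigma> * (V / P))" by (simp add: power2_eq_square)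
        also have "\<dots> \<le> 2 * \<theta> * (\<epsilon> / \<sigma> / 10 ^ 5)" using \<theta>V \<theta> by (intro mult_left_mono) auto
        also have "\<dots> = \<theta> / 10 * E0" by (simp add: E0_def)
        finally have "2 * \<theta>\<^sup>2 / \<sigma> * (V / P) \<le> \<theta> / 10 * E0" .
        moreover have "\<theta> / 10 * E0 \<le> \<theta> / 10 * a t" using aE \<theta> by (intro mult_left_mono) auto
        ultimately show ?thesis by (rule order_trans)
      qed
      ultimately have "A (Suc t) \<le> (1 - \<theta> / 4) * a t + (\<theta> / 80 * a t + \<theta> / 16 * a t) + \<theta> / 10 * a t"
        by (intro order_trans[OF recA[of t]] add_mono)
      also have "\<dots> = (1 - 3 / 40 * \<theta>) * a t" by (simp add: field_simps)
      also have "\<dots> \<le> (1 - \<theta> / 16) * a t" using aE \<theta> by (intro mult_right_mono) auto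
      finally have "A (Suc t) \<le> (1 - \<theta> / 16) * a t" .
      then show ?thesis using a_le[of t] by linarith
    qed
    show ?case using A3 M3 Z3 by blast
  qed
  have "3 * \<sigma> * M T \<le> 3 * \<sigma> * (\<mu> * v T)" using main \<sigma> by (intro mult_left_mono) auto
  also have "\<dots> = 3 * (\<sigma> * \<mu> * V) + 3 * ((\<sigma>\<^sup>2 * \<mu>) * a T)"
    by (simp add: v_def power2_eq_square algebra_simps)
  also have "\<dots> \<le> 3 * (\<epsilon> / \<sigma> / 10 ^ 10) + 3 * (1 / 600 * a T)"
    using \<mu>V \<mu>_tiny aE[of T] by (intro add_mono mult_left_mono mult_right_mono) auto
  finally have "3 * \<sigma> * M T \<le> 3 * (\<epsilon> / \<sigma> / 10 ^ 10) + a T"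
    using aE[of T] by linarith
  then have "12 * A T + 3 * \<sigma> * M T \<le> 13 * a T + 3 * (\<epsilon> / \<sigma> / 10 ^ 10)"
    using main[of T] by linarith
  also have "\<dots> \<le> 13 * ((1 - \<theta> / 16) ^ T * A0) + 3 * \<epsilon> / (1000 * \<sigma>)"
  proof -
    have "13 * E0 + 3 * (\<epsilon> / \<sigma> / 10 ^ 10) \<le> 3 * \<epsilon> / (1000 * \<sigma>)"
      using \<sigma> \<epsilon>0 by (simp add: E0_def field_simps)
    then show ?thesis by (simp add: a_def)
  qed
  finally show ?thesis .
qed

section \<open>One stage\<close>

lemma grad_objective:
  assumes "\<And>i p. i \<in> {1..N} \<Longrightarrow> p \<in> {1..P} \<Longrightarrow> has_gradient d (\<phi> i p) x (g i p)" "x \<in> Rsp d"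
  shows "has_gradient d (objective N P \<phi>) x (\<lambda>j. 1 / real P * (\<Sum>p=1..P. 1 / real N * (\<Sum>i=1..N. g i p j)))"
    "grad d (objective N P \<phi>) x = (\<lambda>j. 1 / real P * (\<Sum>p=1..P. 1 / real N * (\<Sum>i=1..N. g i p j)))"
proof -
  show 1: "has_gradient d (objective N P \<phi>) x (\<lambda>j. 1 / real P * (\<Sum>p=1..P. 1 / real N * (\<Sum>i=1..N. g i p j)))"
    unfolding objective_def by (intro has_gradient_cmult has_gradient_sum assms)
  show "grad d (objective N P \<phi>) x = (\<lambda>j. 1 / real P * (\<Sum>p=1..P. 1 / real N * (\<Sum>i=1..N. g i p j)))"
    by (rule grad_eqI[OF assms(2) 1])
qed

locale compressed_stage = quadratic_growth d "objective N P \<phi>" "grad d (objective N P \<phi>)" \<sigma>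
  for d N P :: nat and \<phi> :: "nat \<Rightarrow> nat \<Rightarrow> rvec \<Rightarrow> real" and \<sigma> :: real +
  fixes V :: real and u :: rvec
  assumes N: "1 \<le> N" and P: "1 \<le> P"
    and diff: "\<And>i p. i \<in> {1..N} \<Longrightarrow> p \<in> {1..P} \<Longrightarrow> differentiable_on_Rsp d (\<phi> i p)"
    and variance: "bounded_variance d N P V \<phi>"
    and u: "u \<in> Rsp d" "\<And>y. y \<in> Rsp d \<Longrightarrow> objective N P \<phi> u \<le> objective N P \<phi> y"
begin

abbreviation "G \<equiv> objective N P \<phi>"
abbreviation "g \<equiv> grad d G"

section \<open>Sampled gradients and their moments\<close>

definition samples :: "(nat \<Rightarrow> nat) pmf" where
  "samples = Pi_pmf {1..P} 0 (\<lambda>_. pmf_of_set {1..N})"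

definition hbar :: "rvec \<Rightarrow> (nat \<Rightarrow> nat) \<Rightarrow> rvec" where
  "hbar x i = (\<lambda>j. 1 / real P * (\<Sum>p=1..P. grad d (\<phi> (i p) p) x j))"

lemma finite_samples: "finite (set_pmf samples)"
  unfolding samples_def using N by (intro finite_set_Pi_pmf) auto

lemma samples_range: "i \<in> set_pmf samples \<Longrightarrow> p \<in> {1..P} \<Longrightarrow> i p \<in> {1..N}"
proof -
  assume i: "i \<in> set_pmf samples" and p: "p \<in> {1..P}"
  have "i \<in> PiE_dflt {1..P} 0 (set_pmf \<circ> (\<lambda>_. pmf_of_set {1..N}))"
    using i set_Pi_pmf[of "{1..P}" 0 "\<lambda>_. pmf_of_set {1..N}"] unfolding samples_def by simp
  then show ?thesis using p N by (auto simp: PiE_dflt_def)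
qed

lemma expect_sample: "p \<in> {1..P} \<Longrightarrow> expect samples (\<lambda>i. X (i p)) = 1 / real N * (\<Sum>i=1..N. X i)"
  unfolding samples_def using N expect_Pi_component[of "{1..P}" p 0 "\<lambda>_. pmf_of_set {1..N}" X]
  by (simp add: integral_pmf_of_set)

lemma g_eq: "x \<in> Rsp d \<Longrightarrow>
    g x = (\<lambda>j. 1 / real P * (\<Sum>p=1..P. 1 / real N * (\<Sum>i=1..N. grad d (\<phi> i p) x j)))"
  by (intro grad_objective(2) has_gradient_grad diff)

lemma sample_gradient_Rsp: "x \<in> Rsp d \<Longrightarrow> i \<in> set_pmf samples \<Longrightarrow> p \<in> {1..P} \<Longrightarrow> grad d (\<phi> (i p) p) x \<in> Rsp d"
  using samples_range diff by (intro grad_in_Rsp) auto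

lemma hbar_Rsp: "x \<in> Rsp d \<Longrightarrow> i \<in> set_pmf samples \<Longrightarrow> hbar x i \<in> Rsp d"
  unfolding hbar_def using sample_gradient_Rsp by (intro Rsp_intros) auto

lemma expect_hbar: "x \<in> Rsp d \<Longrightarrow> expect samples (\<lambda>i. hbar x i j) = g x j"
proof -
  assume x: "x \<in> Rsp d"
  have "expect samples (\<lambda>i. \<Sum>p=1..P. grad d (\<phi> (i p) p) x j) =
      (\<Sum>p=1..P. 1 / real N * (\<Sum>i=1..N. grad d (\<phi> i p) x j))"
    unfolding expect_sum[OF finite_samples]
    by (intro sum.cong refl) (rule expect_sample[where X = "\<lambda>i. grad d (\<phi> i _) x j"])
  then show ?thesis unfolding g_eq[OF x] hbar_def by simp
qed

lemma variance_sum: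
  assumes x: "x \<in> Rsp d"
  shows "(\<Sum>p=1..P. 1 / real N * (\<Sum>i=1..N. nsq d (\<lambda>j. grad d (\<phi> i p) x j - g x j))) \<le> real P * V"
proof -
  have "1 / (real N * real P) * (\<Sum>i=1..N. \<Sum>p=1..P. nsq d (\<lambda>j. grad d (\<phi> i p) x j - g x j)) \<le> V"
    using variance x unfolding bounded_variance_def edist_square by blast
  moreover have "(\<Sum>i=1..N. \<Sum>p=1..P. nsq d (\<lambda>j. grad d (\<phi> i p) x j - g x j)) =
      (\<Sum>p=1..P. \<Sum>i=1..N. nsq d (\<lambda>j. grad d (\<phi> i p) x j - g x j))"
    by (rule sum.swap)
  ultimately show ?thesis using N P by (simp add: field_simps flip: sum_divide_distrib)
qed

lemma expect_hbar_deviation: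
  assumes x: "x \<in> Rsp d"
  shows "expect samples (\<lambda>i. nsq d (\<lambda>j. hbar x i j - g x j)) \<le> V / real P"
proof -
  have "expect samples (\<lambda>i. (hbar x i j - g x j)\<^sup>2) \<le>
      (\<Sum>p=1..P. (1 / real P)\<^sup>2 * (1 / real N * (\<Sum>i=1..N. (grad d (\<phi> i p) x j - g x j)\<^sup>2)))" for j
  proof -
    define X where "X p i = 1 / real P * grad d (\<phi> i p) x j" for p i
    define \<mu> where "\<mu> p = expect (pmf_of_set {1..N}) (X p)" for p
    have fin: "finite (set_pmf (pmf_of_set {1..N}))" using N by simp
    have \<mu>_eq: "\<mu> p = 1 / real P * (1 / real N * (\<Sum>i=1..N. grad d (\<phi> i p) x j))" for p
      using N by (simp add: \<mu>_def X_def integral_pmf_of_set flip: sum_divide_distrib)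
    have sum: "(\<Sum>p=1..P. \<mu> p) = g x j"
      unfolding \<mu>_eq g_eq[OF x] sum_distrib_left ..
    have "expect samples (\<lambda>i. (hbar x i j - g x j)\<^sup>2) =
        expect samples (\<lambda>i. (- g x j + (\<Sum>p=1..P. X p (i p)))\<^sup>2)"
      by (simp add: hbar_def X_def sum_distrib_left)
    also have "\<dots> = (- g x j + (\<Sum>p=1..P. \<mu> p))\<^sup>2
        + (\<Sum>p=1..P. expect (pmf_of_set {1..N}) (\<lambda>i. (X p i - \<mu> p)\<^sup>2))"
      unfolding samples_def by (rule expect_Pi_square) (use fin in \<open>auto simp: \<mu>_def\<close>)
    also have "\<dots> = (\<Sum>p=1..P. expect (pmf_of_set {1..N}) (\<lambda>i. (X p i - \<mu> p)\<^sup>2))"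
      unfolding sum by simp
    \<comment> \<open>Independence centres each worker at its own mean, but the variance is bounded
      around the common gradient; the exchange only increases the sum.\<close>
    also have "\<dots> \<le> (\<Sum>p=1..P. expect (pmf_of_set {1..N}) (\<lambda>i. (X p i - 1 / real P * g x j)\<^sup>2))"
      unfolding \<mu>_def by (intro sum_mono expect_square_deviation_le fin)
    also have "\<dots> = (\<Sum>p=1..P. (1 / real P)\<^sup>2 * (1 / real N * (\<Sum>i=1..N. (grad d (\<phi> i p) x j - g x j)\<^sup>2)))"
    proof (intro sum.cong refl)
      fix p
      have "(X p i - 1 / real P * g x j)\<^sup>2 = (1 / real P)\<^sup>2 * (grad d (\<phi> i p) x j - g x j)\<^sup>2" for i
        unfolding X_def power_mult_distrib[symmetric] right_diff_distrib[symmetric] ..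
      then show "expect (pmf_of_set {1..N}) (\<lambda>i. (X p i - 1 / real P * g x j)\<^sup>2) =
          (1 / real P)\<^sup>2 * (1 / real N * (\<Sum>i=1..N. (grad d (\<phi> i p) x j - g x j)\<^sup>2))"
        using N by (simp add: integral_pmf_of_set)
    qed
    finally show ?thesis .
  qed
  then have "expect samples (\<lambda>i. nsq d (\<lambda>j. hbar x i j - g x j)) \<le>
      (\<Sum>j<d. \<Sum>p=1..P. (1 / real P)\<^sup>2 * (1 / real N * (\<Sum>i=1..N. (grad d (\<phi> i p) x j - g x j)\<^sup>2)))"
    unfolding nsq_def expect_sum[OF finite_samples] by (intro sum_mono)
  also have "\<dots> = (1 / real P)\<^sup>2 * (\<Sum>p=1..P. 1 / real N * (\<Sum>i=1..N. nsq d (\<lambda>j. grad d (\<phi> i p) x j - g x j)))"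
    unfolding nsq_def sum_distrib_left
    by (rule trans[OF sum.swap], rule sum.cong[OF refl], rule sum.swap)
  also have "\<dots> \<le> (1 / real P)\<^sup>2 * (real P * V)"
    by (intro mult_left_mono variance_sum x) auto
  also have "\<dots> = V / real P" using P by (simp add: power2_eq_square)
  finally show ?thesis .
qed

text \<open>Compression noise scales with full second moments and not with deviations. This brings
  the gradient of the objective into the memory recursions and couples them to the
  potential.\<close>

lemma expect_sample_gradients:
  assumes x: "x \<in> Rsp d"
  shows "expect samples (\<lambda>i. \<Sum>p=1..P. nsq d (grad d (\<phi> (i p) p) x)) \<le> real P * (2 * V + 2 * nsq d (g x))"
proof -
  have "expect samples (\<lambda>i. \<Sum>p=1..P. nsq d (grad d (\<phi> (i p) p) x)) =
      (\<Sum>p=1..P. 1 / real N * (\<Sum>i=1..N. nsq d (grad d (\<phi> i p) x)))"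
    unfolding expect_sum[OF finite_samples]
    by (intro sum.cong refl) (rule expect_sample[where X = "\<lambda>i. nsq d (grad d (\<phi> i _) x)"])
  also have "\<dots> \<le> (\<Sum>p=1..P. 1 / real N * (\<Sum>i=1..N. 2 * nsq d (\<lambda>j. grad d (\<phi> i p) x j - g x j) + 2 * nsq d (g x)))"
  proof (intro sum_mono mult_left_mono)
    fix i p
    have "(grad d (\<phi> i p) x j)\<^sup>2 \<le> 2 * (grad d (\<phi> i p) x j - g x j)\<^sup>2 + 2 * (g x j)\<^sup>2" for j
      using square_sum_le[of "grad d (\<phi> i p) x j - g x j" "g x j"] by simp
    then show "nsq d (grad d (\<phi> i p) x) \<le> 2 * nsq d (\<lambda>j. grad d (\<phi> i p) x j - g x j) + 2 * nsq d (g x)"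
      unfolding nsq_def sum_distrib_left sum.distrib[symmetric] by (intro sum_mono)
  qed auto
  also have "\<dots> = 2 * (\<Sum>p=1..P. 1 / real N * (\<Sum>i=1..N. nsq d (\<lambda>j. grad d (\<phi> i p) x j - g x j)))
      + real P * (2 * nsq d (g x))"
    using N by (simp add: sum.distrib distrib_left sum_distrib_left)
  also have "\<dots> \<le> 2 * (real P * V) + real P * (2 * nsq d (g x))"
    using variance_sum[OF x] by simp
  finally show ?thesis by (simp add: algebra_simps)
qed

end

lemma set_Pi_rand_comp:
  fixes c :: "nat \<Rightarrow> rvec"
  assumes "1 \<le> q" "q \<le> d" "c \<in> set_pmf (Pi_pmf {1..P} dflt (\<lambda>p. rand_comp d q (y p)))" "p \<in> {1..P}"
  shows "c p \<in> Rsp d"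
proof -
  have "c \<in> PiE_dflt {1..P} dflt (set_pmf \<circ> (\<lambda>p. rand_comp d q (y p)))"
    using assms(3) unfolding set_Pi_pmf[OF finite_atLeastAtMost] .
  then have "c p \<in> set_pmf (rand_comp d q (y p))" using assms(4) by (auto simp: PiE_dflt_def)
  then show ?thesis by (rule rand_comp_in_Rsp[OF assms(1,2)])
qed

locale compressed_run = compressed_stage +
  fixes k :: nat and c \<theta> :: real
  assumes k: "even k" "1 \<le> k div 2" "k div 2 \<le> d"
    and c: "0 < c" "c \<le> 1 / 10" and \<theta>0: "0 < \<theta>" and \<theta>_le: "\<theta> \<le> c * real k / real d / 10 ^ 5"
    and V: "0 \<le> V"
begin

section \<open>Parameters, potential and memories of a run\<close>

definition "\<gamma> = c * real k / real d"
definition "\<omega> = real d / real k"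
definition "lam = \<theta> / \<sigma>"
definition "\<eta> = 4 * \<theta>\<^sup>2 / \<sigma>"
definition "\<alpha> = \<theta> / (2 + \<theta>)"
definition "\<beta> = \<theta> / (1 + \<theta>)"

lemma k_real: "real (k div 2) = real k / 2" "0 < real k" "0 < real d" "real k \<le> 2 * real d"
proof -
  obtain l where l: "k = 2 * l" using k(1) by blast
  then show "real (k div 2) = real k / 2" "0 < real k" "0 < real d" "real k \<le> 2 * real d"
    using k by auto
qed

lemma params:
  "0 < \<gamma>" "\<gamma> \<le> 1 / 5" "0 < \<omega>" "\<omega> * \<gamma> = c" "real d / real (k div 2) = 2 * \<omega>"
  "\<theta> \<le> \<gamma> / 10 ^ 5" "\<theta> \<le> 1 / 10" "0 < lam" "0 < \<eta>"
  "0 \<le> \<alpha>" "\<alpha> \<le> \<theta> / 2" "\<alpha> \<le> 1" "0 \<le> \<beta>" "\<beta> \<le> \<theta>" "\<beta> \<le> 1"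
  "\<gamma> + 8 * (\<omega> * \<gamma>) \<le> 1"
proof -
  show 1: "0 < \<gamma>" using c k_real by (simp add: \<gamma>_def)
  have "\<gamma> = c * (real k / real d)" by (simp add: \<gamma>_def)
  also have "\<dots> \<le> 1 / 10 * 2" using c k_real by (intro mult_mono) (auto simp: field_simps)
  finally show 2: "\<gamma> \<le> 1 / 5" by simp
  show "0 < \<omega>" using k_real by (simp add: \<omega>_def)
  show 3: "\<omega> * \<gamma> = c" using k_real by (simp add: \<omega>_def \<gamma>_def)
  show "real d / real (k div 2) = 2 * \<omega>" unfolding k_real(1) \<omega>_def by simp
  show 4: "\<theta> \<le> \<gamma> / 10 ^ 5" using \<theta>_le by (simp add: \<gamma>_def)
  then show "\<theta> \<le> 1 / 10" using 2 by simp
  show "0 < lam" "0 < \<eta>" using \<theta>0 sigma_pos by (auto simp: lam_def \<eta>_def)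
  show "0 \<le> \<alpha>" "\<alpha> \<le> \<theta> / 2" "\<alpha> \<le> 1" "0 \<le> \<beta>" "\<beta> \<le> \<theta>" "\<beta> \<le> 1"
    using \<theta>0 by (auto simp: \<alpha>_def \<beta>_def field_simps)
  \<comment> \<open>The bound \<open>c \<le> 1 / 10\<close> is tailored to this:
    \<open>\<gamma>\<close> is at most \<open>2 * c\<close> because \<open>k \<le> 2 * d\<close>,
    and the second summand is \<open>8 * c\<close>.\<close>
  show "\<gamma> + 8 * (\<omega> * \<gamma>) \<le> 1" unfolding 3 using 2 c by simp
qed

definition mean :: "(nat \<Rightarrow> rvec) \<Rightarrow> rvec" where
  "mean m = (\<lambda>j. 1 / real P * (\<Sum>p=1..P. m p j))"

definition valid_state :: "snag_state \<Rightarrow> bool" where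
  "valid_state = (\<lambda>(x, z, m, mz). x \<in> Rsp d \<and> z \<in> Rsp d \<and> (\<forall>p\<in>{1..P}. m p \<in> Rsp d \<and> mz p \<in> Rsp d))"

definition energy :: "snag_state \<Rightarrow> real" where
  "energy = (\<lambda>(x, z, m, mz). potential \<theta> u (\<lambda>j. x j - mean m j) (\<lambda>j. z j - mean mz j))"

definition memory_x :: "snag_state \<Rightarrow> real" where
  "memory_x = (\<lambda>(x, z, m, mz). memory_norm d P m)"

definition memory_z :: "snag_state \<Rightarrow> real" where
  "memory_z = (\<lambda>(x, z, m, mz). memory_norm d P mz)"

lemma mean_Rsp: "(\<And>p. p \<in> {1..P} \<Longrightarrow> m p \<in> Rsp d) \<Longrightarrow> mean m \<in> Rsp d"
  unfolding mean_def by (intro Rsp_intros)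

lemma valid_stateD:
  assumes "valid_state (x, z, m, mz)"
  shows "x \<in> Rsp d" "z \<in> Rsp d" "p \<in> {1..P} \<Longrightarrow> m p \<in> Rsp d" "p \<in> {1..P} \<Longrightarrow> mz p \<in> Rsp d"
    "mean m \<in> Rsp d" "mean mz \<in> Rsp d"
  using assms by (auto simp: valid_state_def simp del: One_nat_def intro!: mean_Rsp)

lemma energy_nonneg: "valid_state s \<Longrightarrow> 0 \<le> energy s"
proof -
  assume s: "valid_state s"
  obtain x z m mz where s': "s = (x, z, m, mz)" by (cases s)
  show "0 \<le> energy s"
    unfolding s' energy_def prod.case
    using \<theta>0 by (intro potential_nonneg u Rsp_diff valid_stateD[OF s[unfolded s']]) auto
qed

lemma memory_nonneg: "0 \<le> memory_x s" "0 \<le> memory_z s"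
  by (auto simp: memory_x_def memory_z_def split: prod.splits)

text \<open>The virtual \<open>X\<close> is the convex combination of \<open>Y\<close> and
  \<open>Z\<close> with weight \<open>\<alpha>\<close>. The potential controls both of these,
  \<open>Y\<close> through its gap and \<open>Z\<close> directly, and the averaged memory leads from
  \<open>X\<close> back to the true iterate.\<close>

lemma distance_le_energy:
  assumes "valid_state (x, z, m, mz)"
  shows "nsq d (\<lambda>j. x j - u j) \<le> 8 / \<sigma> * energy (x, z, m, mz) + 2 * memory_x (x, z, m, mz)"
proof -
  define X where "X = (\<lambda>j. x j - mean m j)"
  define Z where "Z = (\<lambda>j. z j - mean mz j)"
  define Y where "Y = (\<lambda>j. X j - \<theta> / 2 * (Z j - X j))"
  have R: "X \<in> Rsp d" "Z \<in> Rsp d" unfolding X_def Z_def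
    by (intro Rsp_diff valid_stateD[OF assms])+
  then have YR: "Y \<in> Rsp d" unfolding Y_def by (intro Rsp_intros)
  have "\<alpha> * (2 + \<theta>) = \<theta>" using \<theta>0 by (simp add: \<alpha>_def)
  then have mix: "X j - u j = (1 - \<alpha>) * (Y j - u j) + \<alpha> * (Z j - u j)" for j
  proof -
    have "(1 - \<alpha>) * (Y j - u j) + \<alpha> * (Z j - u j) - (X j - u j) = (\<alpha> * (2 + \<theta>) - \<theta>) * (Z j - X j) / 2"
      unfolding Y_def by (simp add: field_simps)
    then show ?thesis using \<open>\<alpha> * (2 + \<theta>) = \<theta>\<close> by simp
  qed
  have "nsq d (\<lambda>j. X j - u j) \<le> (1 - \<alpha>) * nsq d (\<lambda>j. Y j - u j) + \<alpha> * nsq d (\<lambda>j. Z j - u j)"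
    unfolding mix by (intro nsq_combination_le convex_square_le params)
  also have "\<dots> \<le> 1 * nsq d (\<lambda>j. Y j - u j) + 1 * nsq d (\<lambda>j. Z j - u j)"
    using params by (intro add_mono mult_right_mono) auto
  finally have 1: "nsq d (\<lambda>j. X j - u j) \<le> nsq d (\<lambda>j. Y j - u j) + nsq d (\<lambda>j. Z j - u j)" by simp
  have "\<sigma> / 4 * nsq d (\<lambda>j. Y j - u j) + \<sigma> / 4 * nsq d (\<lambda>j. Z j - u j) \<le> energy (x, z, m, mz)"
  proof -
    have "\<sigma> / 4 * nsq d (\<lambda>j. Y j - u j) \<le> \<sigma> / 2 * nsq d (\<lambda>j. Y j - u j)"
      using sigma_pos by (intro mult_right_mono) auto
    also have "\<dots> \<le> G Y - G u" using distance_le_gap[OF u YR] .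
    finally have "\<sigma> / 4 * nsq d (\<lambda>j. Y j - u j) \<le> G Y - G u" .
    moreover have "1 * (\<sigma> / 4) * nsq d (\<lambda>j. Z j - u j) \<le> (1 + \<theta> / 4) * (\<sigma> / 4) * nsq d (\<lambda>j. Z j - u j)"
      using \<theta>0 sigma_pos by (intro mult_right_mono) auto
    moreover have "energy (x, z, m, mz) = G Y - G u + (1 + \<theta> / 4) * (\<sigma> / 4) * nsq d (\<lambda>j. Z j - u j)"
      by (simp add: energy_def potential_def Y_def X_def Z_def)
    ultimately show ?thesis by (simp only: mult_1_left add_mono)
  qed
  then have "\<sigma> / 4 * (nsq d (\<lambda>j. Y j - u j) + nsq d (\<lambda>j. Z j - u j)) \<le> energy (x, z, m, mz)"
    by (simp only: distrib_left)
  then have 2: "nsq d (\<lambda>j. Y j - u j) + nsq d (\<lambda>j. Z j - u j) \<le> 4 / \<sigma> * energy (x, z, m, mz)"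
    using sigma_pos by (simp add: field_simps)
  have "nsq d (\<lambda>j. 1 * (X j - u j) + 1 * mean m j) \<le> 2 * nsq d (\<lambda>j. X j - u j) + 2 * nsq d (mean m)"
    by (rule nsq_combination_le) (use square_sum_le in simp)
  moreover have "nsq d (mean m) \<le> memory_x (x, z, m, mz)"
    unfolding memory_x_def mean_def prod.case by (rule nsq_average_le_memory_norm)
  moreover have "(\<lambda>j. 1 * (X j - u j) + 1 * mean m j) = (\<lambda>j. x j - u j)" by (simp add: X_def)
  moreover have "8 / \<sigma> * energy (x, z, m, mz) = 2 * (4 / \<sigma> * energy (x, z, m, mz))" by simp
  ultimately show ?thesis using 1 2 by simp
qed

lemma gradient_le_energy:
  assumes s: "valid_state (x, z, m, mz)"
  shows "nsq d (g x) \<le> 72 * \<sigma> * energy (x, z, m, mz) + 18 * \<sigma>\<^sup>2 * memory_x (x, z, m, mz)"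
proof -
  have x: "x \<in> Rsp d" using s by (simp add: valid_state_def)
  have "nsq d (g x) \<le> 9 * \<sigma>\<^sup>2 * nsq d (\<lambda>j. x j - u j)"
    using lipschitz[OF x u(1)] gradient_minimizer[OF u] by simp
  also have "\<dots> \<le> 9 * \<sigma>\<^sup>2 * (8 / \<sigma> * energy (x, z, m, mz) + 2 * memory_x (x, z, m, mz))"
    using distance_le_energy[OF s] by (intro mult_left_mono) auto
  also have "\<dots> = 72 * \<sigma> * energy (x, z, m, mz) + 18 * \<sigma>\<^sup>2 * memory_x (x, z, m, mz)"
    using sigma_pos by (simp add: power2_eq_square algebra_simps)
  finally show ?thesis .
qed

lemma gap_le_energy:
  assumes s: "valid_state s"
  shows "G (fst s) - G u \<le> 12 * energy s + 3 * \<sigma> * memory_x s"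
proof -
  obtain x z m mz where s': "s = (x, z, m, mz)" by (cases s)
  have x: "x \<in> Rsp d" using s by (simp add: valid_state_def s')
  have "G x - G u \<le> 3 * \<sigma> / 2 * nsq d (\<lambda>j. x j - u j)" by (rule gap_le_distance[OF u x])
  also have "\<dots> \<le> 3 * \<sigma> / 2 * (8 / \<sigma> * energy s + 2 * memory_x s)"
    using distance_le_energy s sigma_pos unfolding s' by (intro mult_left_mono) auto
  also have "\<dots> = 12 * energy s + 3 * \<sigma> * memory_x s"
    using sigma_pos by (simp add: algebra_simps)
  finally show ?thesis by (simp add: s')
qed

section \<open>The transition and its three recursions\<close>

abbreviation "step \<equiv> snag_step d N P k \<gamma> \<phi> \<eta> lam \<alpha> \<beta>"

definition shifted :: "rvec \<Rightarrow> (nat \<Rightarrow> nat) \<Rightarrow> real \<Rightarrow> (nat \<Rightarrow> rvec) \<Rightarrow> (nat \<Rightarrow> rvec) pmf" where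
  "shifted x i s v = Pi_pmf {1..P} (\<lambda>_. 0)
     (\<lambda>p. rand_comp d (k div 2) (\<lambda>j. grad d (\<phi> (i p) p) x j + \<gamma> / s * v p j))"

definition residual :: "rvec \<Rightarrow> (nat \<Rightarrow> nat) \<Rightarrow> real \<Rightarrow> (nat \<Rightarrow> rvec) \<Rightarrow> (nat \<Rightarrow> rvec) \<Rightarrow> nat \<Rightarrow> rvec" where
  "residual x i s v y = (\<lambda>p j. v p j - s * (y p j - grad d (\<phi> (i p) p) x j))"

definition merged :: "(nat \<Rightarrow> rvec) \<Rightarrow> (nat \<Rightarrow> rvec) \<Rightarrow> nat \<Rightarrow> rvec" where
  "merged m mz = (\<lambda>p j. (1 - \<beta>) * mz p j + \<beta> * m p j)"

definition next_state :: "rvec \<Rightarrow> rvec \<Rightarrow> (nat \<Rightarrow> rvec) \<Rightarrow> (nat \<Rightarrow> rvec) \<Rightarrow> (nat \<Rightarrow> nat) \<Rightarrow>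
    (nat \<Rightarrow> rvec) \<Rightarrow> (nat \<Rightarrow> rvec) \<Rightarrow> snag_state" where
  "next_state x z m mz i cy cz = (let z' = (\<lambda>j. (1 - \<beta>) * z j + \<beta> * x j - lam * mean cz j);
      mz' = residual x i lam (merged m mz) cz
    in ((\<lambda>j. (1 - \<alpha>) * (x j - \<eta> * mean cy j) + \<alpha> * z' j), z',
        (\<lambda>p j. (1 - \<alpha>) * residual x i \<eta> m cy p j + \<alpha> * mz' p j), mz'))"

lemma step_eq: "step (x, z, m, mz) = bind_pmf samples (\<lambda>i. bind_pmf (shifted x i \<eta> m)
    (\<lambda>cy. bind_pmf (shifted x i lam (merged m mz)) (\<lambda>cz. return_pmf (next_state x z m mz i cy cz))))"
  unfolding snag_step_def samples_def shifted_def residual_def next_state_def mean_def merged_def Let_def prod.case ..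

lemma finite_shifted: "finite (set_pmf (shifted x i s v))"
  unfolding shifted_def by (intro finite_set_Pi_pmf finite_set_rand_comp k) simp

lemma finite_step: "finite (set_pmf (step s))"
  by (cases s) (auto simp: step_eq finite_samples finite_shifted)

lemma expect_step: "expect (step (x, z, m, mz)) F = expect samples (\<lambda>i. expect (shifted x i \<eta> m)
    (\<lambda>cy. expect (shifted x i lam (merged m mz)) (\<lambda>cz. F (next_state x z m mz i cy cz))))"
  unfolding step_eq
  by (simp add: expect_bind finite_samples finite_shifted)

lemma expect_residual:
  assumes x: "x \<in> Rsp d" and s: "0 < s"
  shows "expect samples (\<lambda>i. expect (shifted x i s v) (\<lambda>c. memory_norm d P (residual x i s v c)))
    \<le> (1 - \<gamma>) * memory_norm d P v + 8 * (\<omega> * s\<^sup>2 / real P) * (2 * V + 2 * nsq d (g x))"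
proof -
  have "expect samples (\<lambda>i. expect (shifted x i s v) (\<lambda>c. memory_norm d P (residual x i s v c))) \<le>
    expect samples (\<lambda>i. (1 - \<gamma>) * memory_norm d P v
      + 8 * \<omega> * s\<^sup>2 / (real P)\<^sup>2 * (\<Sum>p=1..P. nsq d (grad d (\<phi> (i p) p) x)))"
    unfolding shifted_def residual_def
    by (intro expect_mono finite_samples memory_norm_compress k s P params less_imp_le[OF params(1)])
  also have "\<dots> = (1 - \<gamma>) * memory_norm d P v + 8 * \<omega> * s\<^sup>2 / (real P)\<^sup>2
      * expect samples (\<lambda>i. \<Sum>p=1..P. nsq d (grad d (\<phi> (i p) p) x))"
    by (subst expect_add[OF finite_samples]) simp
  also have "\<dots> \<le> (1 - \<gamma>) * memory_norm d P v + 8 * \<omega> * s\<^sup>2 / (real P)\<^sup>2 * (real P * (2 * V + 2 * nsq d (g x)))"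
    using params by (intro add_left_mono mult_left_mono expect_sample_gradients x) auto
  also have "\<dots> = (1 - \<gamma>) * memory_norm d P v + 8 * (\<omega> * s\<^sup>2 / real P) * (2 * V + 2 * nsq d (g x))"
    using P by (simp add: power2_eq_square)
  finally show ?thesis .
qed

lemma valid_next_state:
  assumes s: "valid_state (x, z, m, mz)" and i: "i \<in> set_pmf samples"
    and cy: "cy \<in> set_pmf (shifted x i s1 v1)" and cz: "cz \<in> set_pmf (shifted x i s2 v2)"
  shows "valid_state (next_state x z m mz i cy cz)"
proof -
  note R = valid_stateD[OF s]
  have cR: "\<And>p. p \<in> {1..P} \<Longrightarrow> cy p \<in> Rsp d" "\<And>p. p \<in> {1..P} \<Longrightarrow> cz p \<in> Rsp d"
    by (rule set_Pi_rand_comp[OF k(2,3) cy[unfolded shifted_def]], assumption)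
      (rule set_Pi_rand_comp[OF k(2,3) cz[unfolded shifted_def]], assumption)
  note hR = sample_gradient_Rsp[OF R(1) i]
  show ?thesis
    unfolding valid_state_def next_state_def Let_def prod.case residual_def merged_def
    by (intro conjI ballI Rsp_intros mean_Rsp R cR hR)
qed

lemma valid_step:
  assumes "valid_state s" "s' \<in> set_pmf (step s)"
  shows "valid_state s'"
  using assms by (cases s) (auto simp: step_eq intro: valid_next_state)

lemma energy_step:
  assumes s: "valid_state s"
  shows "expect (step s) energy \<le> (1 - \<theta> / 4) * energy s + 36 * \<theta> * \<sigma> * memory_x s
    + 2 * \<theta>\<^sup>2 / \<sigma> * (V / real P)"
proof -
  obtain x z m mz where s': "s = (x, z, m, mz)" by (cases s)
  note R = valid_stateD[OF s[unfolded s']]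
  define X where "X = (\<lambda>j. x j - mean m j)"
  define Z where "Z = (\<lambda>j. z j - mean mz j)"
  define Z' where "Z' i = (\<lambda>j. (1 - \<beta>) * Z j + \<beta> * X j - lam * hbar x i j)" for i
  define X' where "X' i = (\<lambda>j. (1 - \<alpha>) * (X j - \<eta> * hbar x i j) + \<alpha> * Z' i j)" for i
  have mean_residual: "mean (residual x i s v y) j = mean v j - s * (mean y j - hbar x i j)" for i s v y j
    unfolding mean_def residual_def hbar_def
    by (simp add: sum_subtractf right_diff_distrib diff_divide_distrib flip: sum_distrib_left)
  have mean_comb: "mean (\<lambda>p j. a * v p j + b * w p j) j = a * mean v j + b * mean w j" for a b v w j
    unfolding mean_def by (simp add: sum.distrib add_divide_distrib distrib_left flip: sum_distrib_left)
  \<comment> \<open>The compressions \<open>cy\<close> and \<open>cz\<close> do not occur on the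
    right: they cancel between iterate and averaged memory, and the two mixing steps are the same
    linear combinations on both.\<close>
  have "energy (next_state x z m mz i cy cz) = potential \<theta> u (X' i) (Z' i)" for i cy cz
  proof -
    have zz: "(\<lambda>j. (1 - \<beta>) * z j + \<beta> * x j - lam * mean cz j - mean (residual x i lam (merged m mz) cz) j) = Z' i"
      unfolding mean_residual merged_def mean_comb Z'_def Z_def X_def by (intro ext) (simp add: algebra_simps)
    have xx: "(\<lambda>j. (1 - \<alpha>) * (x j - \<eta> * mean cy j) + \<alpha> * ((1 - \<beta>) * z j + \<beta> * x j - lam * mean cz j)
       - mean (\<lambda>p j. (1 - \<alpha>) * residual x i \<eta> m cy p j + \<alpha> * residual x i lam (merged m mz) cz p j) j) = X' i"
      unfolding mean_comb X'_def zz[symmetric] mean_residual X_def by (intro ext) (simp add: algebra_simps)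
    show ?thesis unfolding energy_def next_state_def Let_def prod.case zz xx ..
  qed
  then have "expect (step s) energy = expect samples (\<lambda>i. potential \<theta> u (X' i) (Z' i))"
    unfolding s' expect_step by simp
  also have "\<dots> \<le> (1 - \<theta> / 4) * potential \<theta> u X Z + 36 * \<theta> * \<sigma> * nsq d (\<lambda>j. x j - X j) + 2 * \<theta>\<^sup>2 / \<sigma> * (V / real P)"
  proof (rule potential_step[where H = "hbar x"])
    show "X \<in> Rsp d" "Z \<in> Rsp d" unfolding X_def Z_def by (intro Rsp_diff R)+
    show "Z' i = (\<lambda>j. (1 - \<beta>) * Z j + \<beta> * X j - lam * hbar x i j)" for i by (rule Z'_def)
    show "X' i = (\<lambda>j. (1 - \<alpha>) * (X j - \<eta> * hbar x i j) + \<alpha> * Z' i j)" for i by (rule X'_def)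
  qed (rule u R params \<theta>0 finite_samples expect_hbar expect_hbar_deviation hbar_Rsp
        \<eta>_def lam_def \<alpha>_def \<beta>_def | assumption)+
  also have "nsq d (\<lambda>j. x j - X j) = nsq d (mean m)" by (simp add: X_def)
  also have "potential \<theta> u X Z = energy s" by (simp add: energy_def s' X_def Z_def)
  also have "36 * \<theta> * \<sigma> * nsq d (mean m) \<le> 36 * \<theta> * \<sigma> * memory_x s"
    unfolding memory_x_def s' mean_def prod.case
    using \<theta>0 sigma_pos by (intro mult_left_mono nsq_average_le_memory_norm) auto
  finally show ?thesis by simp
qed

lemma memory_z_step:
  assumes s: "valid_state s"
  shows "expect (step s) memory_z \<le> (1 - \<gamma>) * (memory_z s + \<beta> * memory_x s)
    + 8 * (\<omega> * \<theta>\<^sup>2 / (\<sigma>\<^sup>2 * real P)) * (2 * V + 144 * \<sigma> * energy s + 36 * \<sigma>\<^sup>2 * memory_x s)"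
proof -
  obtain x z m mz where s': "s = (x, z, m, mz)" by (cases s)
  have x: "x \<in> Rsp d" using s by (simp add: valid_state_def s')
  have "expect (step s) memory_z = expect samples (\<lambda>i. expect (shifted x i lam (merged m mz))
      (\<lambda>c. memory_norm d P (residual x i lam (merged m mz) c)))"
    unfolding s' expect_step by (simp add: memory_z_def next_state_def Let_def)
  also have "\<dots> \<le> (1 - \<gamma>) * memory_norm d P (merged m mz) + 8 * (\<omega> * lam\<^sup>2 / real P) * (2 * V + 2 * nsq d (g x))"
    by (intro expect_residual x params)
  also have "\<dots> \<le> (1 - \<gamma>) * (memory_z s + \<beta> * memory_x s)
      + 8 * (\<omega> * lam\<^sup>2 / real P) * (2 * V + 144 * \<sigma> * energy s + 36 * \<sigma>\<^sup>2 * memory_x s)"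
  proof -
    have "memory_norm d P (merged m mz) \<le> (1 - \<beta>) * memory_z s + \<beta> * memory_x s"
      unfolding merged_def memory_z_def memory_x_def s' prod.case
      by (intro memory_norm_combination_le convex_square_le params)
    moreover have "(1 - \<beta>) * memory_z s \<le> 1 * memory_z s"
      using params memory_nonneg by (intro mult_right_mono) auto
    ultimately have merged_le: "memory_norm d P (merged m mz) \<le> memory_z s + \<beta> * memory_x s" by simp
    have grad_le: "2 * V + 2 * nsq d (g x) \<le> 2 * V + 144 * \<sigma> * energy s + 36 * \<sigma>\<^sup>2 * memory_x s"
      using gradient_le_energy[of x z m mz] s unfolding s' by simp
    show ?thesis
      using params by (intro add_mono mult_left_mono[OF merged_le] mult_left_mono[OF grad_le]) auto
  qed
  also have "\<omega> * lam\<^sup>2 / real P = \<omega> * \<theta>\<^sup>2 / (\<sigma>\<^sup>2 * real P)"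
    by (simp add: lam_def power_divide)
  finally show ?thesis .
qed

text \<open>Young's inequality with parameter \<open>\<gamma> / 2\<close> spends half of the
  contraction, as \<open>(1 + \<gamma> / 2) * (1 - \<gamma>) \<le> 1 - \<gamma> / 2\<close>. The
  factor \<open>192 = 12 * 16\<close> contains
  \<open>\<eta>^2 = 16 * \<theta>^4 / \<sigma>^2\<close>. The updated memory of \<open>z\<close>
  stays unexpanded, since its own recursion bounds it.\<close>

lemma memory_x_step:
  assumes s: "valid_state s"
  shows "expect (step s) memory_x \<le> (1 - \<gamma> / 2) * memory_x s
    + 192 * \<theta>\<^sup>2 * (\<omega> * \<theta>\<^sup>2 / (\<sigma>\<^sup>2 * real P)) * (2 * V + 144 * \<sigma> * energy s + 36 * \<sigma>\<^sup>2 * memory_x s)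
    + 3 * \<alpha>\<^sup>2 / \<gamma> * expect (step s) memory_z"
proof -
  obtain x z m mz where s': "s = (x, z, m, mz)" by (cases s)
  have x: "x \<in> Rsp d" using s by (simp add: valid_state_def s')
  define HH where "HH = 2 * V + 144 * \<sigma> * energy s + 36 * \<sigma>\<^sup>2 * memory_x s"
  have HH: "2 * V + 2 * nsq d (g x) \<le> HH"
    using gradient_le_energy[of x z m mz] s unfolding s' HH_def by simp
  have HH0: "0 \<le> HH" using V energy_nonneg[OF s] memory_nonneg sigma_pos by (simp add: HH_def)
  define A where "A = 1 + \<gamma> / 2"
  define B where "B = (1 + 1 / (\<gamma> / 2)) * \<alpha>\<^sup>2"
  define Ey where "Ey = expect samples (\<lambda>i. expect (shifted x i \<eta> m) (\<lambda>c. memory_norm d P (residual x i \<eta> m c)))"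
  have Ez: "expect (step s) memory_z = expect samples (\<lambda>i. expect (shifted x i lam (merged m mz))
      (\<lambda>c. memory_norm d P (residual x i lam (merged m mz) c)))"
    unfolding s' expect_step by (simp add: memory_z_def next_state_def Let_def)
  have Ez0: "0 \<le> expect (step s) memory_z" by (intro expect_nonneg memory_nonneg)
  have "expect (step s) memory_x \<le> expect samples (\<lambda>i. expect (shifted x i \<eta> m) (\<lambda>cy.
      expect (shifted x i lam (merged m mz)) (\<lambda>cz. A * memory_norm d P (residual x i \<eta> m cy)
        + B * memory_norm d P (residual x i lam (merged m mz) cz))))"
    unfolding s' expect_step memory_x_def next_state_def Let_def prod.case A_def B_def
    using params by (intro expect_mono finite_samples finite_shifted memory_norm_combination_le young_square_le) auto
  also have "\<dots> = A * Ey + B * expect (step s) memory_z"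
    unfolding Ez Ey_def by (simp add: expect_add finite_samples finite_shifted)
  also have "\<dots> \<le> ((1 - \<gamma> / 2) * memory_x s + 12 * (\<omega> * \<eta>\<^sup>2 / real P) * HH) + 3 * \<alpha>\<^sup>2 / \<gamma> * expect (step s) memory_z"
  proof (rule add_mono)
    have "Ey \<le> (1 - \<gamma>) * memory_x s + 8 * (\<omega> * \<eta>\<^sup>2 / real P) * (2 * V + 2 * nsq d (g x))"
      unfolding Ey_def memory_x_def s' prod.case by (intro expect_residual x params)
    also have "\<dots> \<le> (1 - \<gamma>) * memory_x s + 8 * (\<omega> * \<eta>\<^sup>2 / real P) * HH"
      using HH params by (intro add_left_mono mult_left_mono) auto
    finally have "A * Ey \<le> A * ((1 - \<gamma>) * memory_x s + 8 * (\<omega> * \<eta>\<^sup>2 / real P) * HH)"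
      using params unfolding A_def by (intro mult_left_mono) auto
    also have "\<dots> = (A * (1 - \<gamma>)) * memory_x s + (8 * A) * ((\<omega> * \<eta>\<^sup>2 / real P) * HH)"
      by (simp only: distrib_left mult_ac)
    also have "\<dots> \<le> (1 - \<gamma> / 2) * memory_x s + 12 * ((\<omega> * \<eta>\<^sup>2 / real P) * HH)"
    proof (intro add_mono mult_right_mono memory_nonneg)
      have "A * (1 - \<gamma>) = 1 - \<gamma> / 2 - \<gamma> * \<gamma> / 2" by (simp add: A_def field_simps)
      then show "A * (1 - \<gamma>) \<le> 1 - \<gamma> / 2" by simp
      show "8 * A \<le> 12" using params by (simp add: A_def)
    qed (use params HH0 in auto)
    finally show "A * Ey \<le> (1 - \<gamma> / 2) * memory_x s + 12 * (\<omega> * \<eta>\<^sup>2 / real P) * HH"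
      by (simp only: mult.assoc)
    have "B \<le> 3 * \<alpha>\<^sup>2 / \<gamma>"
    proof -
      have "1 + 1 / (\<gamma> / 2) \<le> 3 / \<gamma>" using params by (simp add: field_simps)
      then have "(1 + 1 / (\<gamma> / 2)) * \<alpha>\<^sup>2 \<le> 3 / \<gamma> * \<alpha>\<^sup>2" by (intro mult_right_mono) auto
      then show ?thesis by (simp add: B_def)
    qed
    then show "B * expect (step s) memory_z \<le> 3 * \<alpha>\<^sup>2 / \<gamma> * expect (step s) memory_z"
      using Ez0 by (intro mult_right_mono)
  qed
  also have "12 * (\<omega> * \<eta>\<^sup>2 / real P) = 192 * \<theta>\<^sup>2 * (\<omega> * \<theta>\<^sup>2 / (\<sigma>\<^sup>2 * real P))"
    by (simp add: \<eta>_def power_divide power_mult_distrib power2_eq_square)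
  finally show ?thesis unfolding HH_def .
qed

abbreviation "run x t \<equiv> snag_run d N P k \<gamma> \<phi> (\<lambda>_. \<eta>) (\<lambda>_. lam) (\<lambda>_. \<alpha>) (\<lambda>_. \<beta>) x t"

lemma run_support:
  assumes "x \<in> Rsp d"
  shows "finite (set_pmf (run x t)) \<and> (\<forall>s\<in>set_pmf (run x t). valid_state s)"
proof (induction t)
  case 0
  then show ?case using assms by (simp add: valid_state_def Rsp_zero)
next
  case (Suc t)
  then show ?case using finite_step valid_step by auto
qed

lemma expect_run_Suc:
  assumes "x \<in> Rsp d"
  shows "expect (run x (Suc t)) F = expect (run x t) (\<lambda>s. expect (step s) F)"
  using run_support[OF assms] finite_step by (simp add: expect_bind)

theorem stage_bound:
  assumes x: "x \<in> Rsp d"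
    and noise1: "\<theta> * V / real P \<le> \<epsilon> / 10 ^ 5" and noise2: "(\<theta> / \<gamma>) ^ 4 * V / real P \<le> \<epsilon> / 10 ^ 20"
    and T: "260 * (1 - \<theta> / 16) ^ T \<le> 1"
  shows "expect (map_pmf fst (run x T)) (\<lambda>y. G y - G u) \<le> 1 / 10 * (G x - G u) + 3 * \<epsilon> / (1000 * \<sigma>)"
proof -
  have fin: "finite (set_pmf (run x t))" and val: "\<And>s. s \<in> set_pmf (run x t) \<Longrightarrow> valid_state s" for t
    using run_support[OF x] by auto
  have gap0: "0 \<le> G x - G u" using u x by simp
  \<comment> \<open>All points start at \<open>x\<close> with empty memories, so strong convexity
    bounds the distance term of the potential by the gap.\<close>
  have init: "energy (x, x, \<lambda>_ _. 0, \<lambda>_ _. 0) \<le> 2 * (G x - G u)"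
  proof -
    have "(1 + \<theta> / 4) * (\<sigma> / 4) * nsq d (\<lambda>j. x j - u j) \<le> 2 * (\<sigma> / 4) * nsq d (\<lambda>j. x j - u j)"
      using params sigma_pos by (intro mult_right_mono) auto
    also have "\<dots> \<le> G x - G u" using distance_le_gap[OF u x] by simp
    finally have small: "(1 + \<theta> / 4) * (\<sigma> / 4) * nsq d (\<lambda>j. x j - u j) \<le> G x - G u" .
    have "energy (x, x, \<lambda>_ _. 0, \<lambda>_ _. 0) = (G x - G u) + (1 + \<theta> / 4) * (\<sigma> / 4) * nsq d (\<lambda>j. x j - u j)"
      by (simp add: energy_def mean_def potential_def)
    also have "\<dots> \<le> (G x - G u) + (G x - G u)" by (rule add_left_mono[OF small])
    finally show ?thesis by simp
  qed
  have "expect (map_pmf fst (run x T)) (\<lambda>y. G y - G u) \<le> expect (run x T) (\<lambda>s. 12 * energy s + 3 * \<sigma> * memory_x s)"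
    using gap_le_energy val by (auto intro!: expect_mono fin)
  also have "\<dots> = 12 * expect (run x T) energy + 3 * \<sigma> * expect (run x T) memory_x"
    by (simp add: expect_add[OF fin])
  also have "\<dots> \<le> 13 * ((1 - \<theta> / 16) ^ T * (2 * (G x - G u))) + 3 * \<epsilon> / (1000 * \<sigma>)"
  proof (rule coupled_recursion_bound[where V = V and \<alpha> = \<alpha> and \<beta> = \<beta> and \<gamma> = \<gamma> and \<omega> = \<omega> and P = "real P"
        and Z = "\<lambda>t. expect (run x t) memory_z"])
    fix t
    show "0 \<le> expect (run x t) energy"
      using expect_mono[OF fin, of t "\<lambda>_. 0" energy] energy_nonneg val by simp
    show "0 \<le> expect (run x t) memory_x" "0 \<le> expect (run x t) memory_z"
      by (auto intro!: expect_nonneg memory_nonneg)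
    have "expect (run x (Suc t)) energy \<le> expect (run x t) (\<lambda>s. (1 - \<theta> / 4) * energy s
        + 36 * \<theta> * \<sigma> * memory_x s + 2 * \<theta>\<^sup>2 / \<sigma> * (V / real P))"
      unfolding expect_run_Suc[OF x] by (intro expect_mono fin energy_step val)
    then show "expect (run x (Suc t)) energy \<le> (1 - \<theta> / 4) * expect (run x t) energy
        + 36 * \<theta> * \<sigma> * expect (run x t) memory_x + 2 * \<theta>\<^sup>2 / \<sigma> * (V / real P)"
      by (simp add: expect_add[OF fin])
    have "expect (run x (Suc t)) memory_z \<le> expect (run x t) (\<lambda>s. (1 - \<gamma>) * (memory_z s + \<beta> * memory_x s)
        + 8 * (\<omega> * \<theta>\<^sup>2 / (\<sigma>\<^sup>2 * real P)) * (2 * V + 144 * \<sigma> * energy s + 36 * \<sigma>\<^sup>2 * memory_x s))"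
      unfolding expect_run_Suc[OF x] by (intro expect_mono fin memory_z_step val)
    then show "expect (run x (Suc t)) memory_z \<le> (1 - \<gamma>) * (expect (run x t) memory_z + \<beta> * expect (run x t) memory_x)
        + 8 * (\<omega> * \<theta>\<^sup>2 / (\<sigma>\<^sup>2 * real P)) * (2 * V + 144 * \<sigma> * expect (run x t) energy
          + 36 * \<sigma>\<^sup>2 * expect (run x t) memory_x)"
      by (simp add: expect_add[OF fin])
    have "expect (run x (Suc t)) memory_x \<le> expect (run x t) (\<lambda>s. (1 - \<gamma> / 2) * memory_x s
        + 192 * \<theta>\<^sup>2 * (\<omega> * \<theta>\<^sup>2 / (\<sigma>\<^sup>2 * real P)) * (2 * V + 144 * \<sigma> * energy s + 36 * \<sigma>\<^sup>2 * memory_x s)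
        + 3 * \<alpha>\<^sup>2 / \<gamma> * expect (step s) memory_z)"
      unfolding expect_run_Suc[OF x] by (intro expect_mono fin memory_x_step val)
    then show "expect (run x (Suc t)) memory_x \<le> (1 - \<gamma> / 2) * expect (run x t) memory_x
        + 192 * \<theta>\<^sup>2 * (\<omega> * \<theta>\<^sup>2 / (\<sigma>\<^sup>2 * real P)) * (2 * V + 144 * \<sigma> * expect (run x t) energy
          + 36 * \<sigma>\<^sup>2 * expect (run x t) memory_x)
        + 3 * \<alpha>\<^sup>2 / \<gamma> * expect (run x (Suc t)) memory_z"
      unfolding expect_run_Suc[OF x, of t memory_z] by (simp add: expect_add[OF fin])
    show "expect (run x 0) energy \<le> 2 * (G x - G u)" using init by simp
    show "expect (run x 0) memory_x = 0" "expect (run x 0) memory_z = 0"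
      by (auto simp: memory_x_def memory_z_def memory_norm_def nsq_def)
    show "\<omega> * \<gamma> \<le> 1 / 10" using params c by simp
    show "1 \<le> real P" using P by simp
  qed (use params \<theta>0 V noise1 noise2 sigma_pos in auto)
  \<comment> \<open>\<open>13\<close> from the recursion, 2 from the initial potential and 10 for
    the desired reduction make up the \<open>260\<close> in the hypothesis.\<close>
  also have "13 * ((1 - \<theta> / 16) ^ T * (2 * (G x - G u))) = (26 * (1 - \<theta> / 16) ^ T) * (G x - G u)" by simp
  also have "\<dots> \<le> 1 / 10 * (G x - G u)" using T gap0 by (intro mult_right_mono) auto
  finally show ?thesis by simp
qed

end

section \<open>The proximal point iteration\<close>

lemma objective_regularized:
  assumes "1 \<le> N" "1 \<le> P"
  shows "objective N P (regularized d \<sigma> f z) x = objective N P f x + \<sigma> * (edist d x z)\<^sup>2"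
  using assms
  by (simp add: objective_def regularized_def sum.distrib add_divide_distrib distrib_left)

locale smooth_objective =
  fixes d N P :: nat and f :: "nat \<Rightarrow> nat \<Rightarrow> rvec \<Rightarrow> real" and L V :: real
  assumes N: "1 \<le> N" and P: "1 \<le> P" and L: "0 < L"
    and diff: "\<And>i p. i \<in> {1..N} \<Longrightarrow> p \<in> {1..P} \<Longrightarrow> differentiable_on_Rsp d (f i p)"
    and smooth: "smooth d L (objective N P f)"
    and variance: "bounded_variance d N P V f"
begin

abbreviation "F \<equiv> objective N P f"
abbreviation "reg z \<equiv> regularized d L f z"

lemma differentiable_F: "differentiable_on_Rsp d F"
  unfolding differentiable_on_Rsp_def
proof
  fix x assume x: "x \<in> Rsp d"
  show "\<exists>g. has_gradient d F x g"
    by (rule exI, rule grad_objective(1)[OF has_gradient_grad[OF diff x] x])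
qed

context
  fixes z :: rvec
  assumes z: "z \<in> Rsp d"
begin

lemma has_gradient_reg:
  assumes "x \<in> Rsp d" "i \<in> {1..N}" "p \<in> {1..P}"
  shows "has_gradient d (reg z i p) x (\<lambda>j. grad d (f i p) x j + L * (2 * (x j - z j)))"
  unfolding regularized_def
  by (intro has_gradient_add has_gradient_cmult has_gradient_edist_square has_gradient_grad diff assms z)

lemma grad_reg:
  assumes "x \<in> Rsp d" "i \<in> {1..N}" "p \<in> {1..P}"
  shows "grad d (reg z i p) x = (\<lambda>j. grad d (f i p) x j + L * (2 * (x j - z j)))"
  by (rule grad_eqI[OF assms(1) has_gradient_reg[OF assms]])

lemma differentiable_reg: "i \<in> {1..N} \<Longrightarrow> p \<in> {1..P} \<Longrightarrow> differentiable_on_Rsp d (reg z i p)"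
  unfolding differentiable_on_Rsp_def using has_gradient_reg by blast

lemma objective_reg: "objective N P (reg z) = (\<lambda>x. F x + L * (edist d x z)\<^sup>2)"
  using objective_regularized[OF N P] by blast

lemma grad_objective_reg:
  assumes x: "x \<in> Rsp d"
  shows "grad d (objective N P (reg z)) x = (\<lambda>j. grad d F x j + L * (2 * (x j - z j)))"
  unfolding objective_reg
  by (intro grad_eqI x has_gradient_add has_gradient_cmult has_gradient_edist_square z
      has_gradient_grad differentiable_F)

text \<open>The regularizer shifts all component gradients and their average by the same vector, so
  the deviations do not change.\<close>

lemma variance_reg: "bounded_variance d N P V (reg z)"
  unfolding bounded_variance_def
proof
  fix x assume x: "x \<in> Rsp d"
  have "edist d (grad d (reg z i p) x) (grad d (objective N P (reg z)) x) = edist d (grad d (f i p) x) (grad d F x)"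
    if "i \<in> {1..N}" "p \<in> {1..P}" for i p
    unfolding edist_def grad_objective_reg[OF x] grad_reg[OF x that] by simp
  then have "(\<Sum>i=1..N. \<Sum>p=1..P. (edist d (grad d (reg z i p) x) (grad d (objective N P (reg z)) x))\<^sup>2) =
     (\<Sum>i=1..N. \<Sum>p=1..P. (edist d (grad d (f i p) x) (grad d F x))\<^sup>2)"
    by (intro sum.cong refl) simp
  then show "1 / (real N * real P) * (\<Sum>i=1..N. \<Sum>p=1..P.
      (edist d (grad d (reg z i p) x) (grad d (objective N P (reg z)) x))\<^sup>2) \<le> V"
    using variance x unfolding bounded_variance_def by simp
qed

text \<open>The regularizer is exactly quadratic and adds
  \<open>L * nsq d (\<lambda>j. y j - x j)\<close> to both sides of the bound for \<open>F\<close>,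
  which moves the coefficients from \<open>- L / 2\<close> and \<open>L / 2\<close> to
  \<open>L / 2\<close> and \<open>3 * L / 2\<close>.\<close>

lemma quadratic_growth_reg: "quadratic_growth d (objective N P (reg z)) (grad d (objective N P (reg z))) L"
proof
  show "0 < L" by (rule L)
next
  fix x assume "x \<in> Rsp d"
  then show "grad d (objective N P (reg z)) x \<in> Rsp d"
    using z differentiable_F by (auto simp: grad_objective_reg intro!: Rsp_add Rsp_scale Rsp_diff grad_in_Rsp)
next
  fix x y assume x: "x \<in> Rsp d" and y: "y \<in> Rsp d"
  let ?G = "objective N P (reg z)"
  have F: "\<bar>F y - F x - ip d (grad d F x) (\<lambda>j. y j - x j)\<bar> \<le> L / 2 * nsq d (\<lambda>j. y j - x j)"
    by (rule smooth_quadratic_bound[OF differentiable_F smooth x y])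
  have "ip d (grad d ?G x) (\<lambda>j. y j - x j) = ip d (grad d F x) (\<lambda>j. y j - x j)
      + L * (\<Sum>j<d. 2 * (x j - z j) * (y j - x j))"
    unfolding grad_objective_reg[OF x] ip_def distrib_right sum.distrib sum_distrib_left
    by (simp add: mult.assoc)
  moreover have "(edist d y z)\<^sup>2 = (edist d x z)\<^sup>2 + (\<Sum>j<d. 2 * (x j - z j) * (y j - x j)) + nsq d (\<lambda>j. y j - x j)"
    unfolding edist_square nsq_def sum.distrib[symmetric]
    by (intro sum.cong refl) (simp add: power2_eq_square algebra_simps)
  ultimately have G: "?G y - ?G x - ip d (grad d ?G x) (\<lambda>j. y j - x j) =
      (F y - F x - ip d (grad d F x) (\<lambda>j. y j - x j)) + L * nsq d (\<lambda>j. y j - x j)"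
    unfolding objective_reg by (simp add: algebra_simps)
  show "?G y \<le> ?G x + ip d (grad d ?G x) (\<lambda>j. y j - x j) + 3 * L / 2 * nsq d (\<lambda>j. y j - x j)"
    "?G x + ip d (grad d ?G x) (\<lambda>j. y j - x j) + L / 2 * nsq d (\<lambda>j. y j - x j) \<le> ?G y"
  proof -
    define n where "n = L * nsq d (\<lambda>j. y j - x j)"
    have n: "L / 2 * nsq d (\<lambda>j. y j - x j) = n / 2" "3 * L / 2 * nsq d (\<lambda>j. y j - x j) = 3 * n / 2"
      "L * nsq d (\<lambda>j. y j - x j) = n"
      by (simp_all add: n_def)
    show "?G y \<le> ?G x + ip d (grad d ?G x) (\<lambda>j. y j - x j) + 3 * L / 2 * nsq d (\<lambda>j. y j - x j)"
      "?G x + ip d (grad d ?G x) (\<lambda>j. y j - x j) + L / 2 * nsq d (\<lambda>j. y j - x j) \<le> ?G y"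
      using F G unfolding n by linarith+
  qed
  \<comment> \<open>The weights 3 and 6 come from \<open>0 \<le> 2 * (a - L * b)^2\<close>; with the
    Lipschitz bound for \<open>F\<close> they add up to the sharp \<open>9 = 3^2\<close>, as the
    triangle inequality would give.\<close>
  have "nsq d (\<lambda>j. 1 * (grad d F x j - grad d F y j) + (2 * L) * (x j - y j)) \<le>
      3 * nsq d (\<lambda>j. grad d F x j - grad d F y j) + 6 * L\<^sup>2 * nsq d (\<lambda>j. x j - y j)"
  proof (rule nsq_combination_le)
    fix a b :: real
    have "0 \<le> 2 * (a - L * b)\<^sup>2" by simp
    then show "(1 * a + 2 * L * b)\<^sup>2 \<le> 3 * a\<^sup>2 + 6 * L\<^sup>2 * b\<^sup>2"
      by (simp add: power2_eq_square algebra_simps)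
  qed
  also have "\<dots> \<le> 3 * (L\<^sup>2 * nsq d (\<lambda>j. x j - y j)) + 6 * L\<^sup>2 * nsq d (\<lambda>j. x j - y j)"
  proof -
    have "edist d (grad d F x) (grad d F y) \<le> L * edist d x y"
      using smooth x y unfolding smooth_def by blast
    then have "(edist d (grad d F x) (grad d F y))\<^sup>2 \<le> (L * edist d x y)\<^sup>2"
      by (intro power_mono) auto
    then show ?thesis by (simp add: power_mult_distrib edist_square)
  qed
  finally show "nsq d (\<lambda>j. grad d ?G x j - grad d ?G y j) \<le> 9 * L\<^sup>2 * nsq d (\<lambda>j. x j - y j)"
    unfolding grad_objective_reg[OF x] grad_objective_reg[OF y] by (simp add: algebra_simps)
qed

end

end

locale smooth_run = smooth_objective +
  fixes k :: nat and c \<theta> \<epsilon> :: real and T :: nat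
  assumes k: "even k" "1 \<le> k div 2" "k div 2 \<le> d"
    and c: "0 < c" "c \<le> 1 / 10" and \<theta>0: "0 < \<theta>" and \<theta>_le: "\<theta> \<le> c * real k / real d / 10 ^ 5"
    and V: "0 \<le> V"
    and noise1: "\<theta> * V / real P \<le> \<epsilon> / 10 ^ 5"
    and noise2: "(\<theta> / (c * real k / real d)) ^ 4 * V / real P \<le> \<epsilon> / 10 ^ 20"
    and T: "260 * (1 - \<theta> / 16) ^ T \<le> 1"
begin

section \<open>A proximal stage and the sum over stages\<close>

definition stage :: "rvec \<Rightarrow> rvec pmf" where
  "stage z = s_snag_ef d N P k (c * real k / real d) (reg z) (\<lambda>_. 4 * \<theta>\<^sup>2 / L) (\<lambda>_. \<theta> / L)
     (\<lambda>_. \<theta> / (2 + \<theta>)) (\<lambda>_. \<theta> / (1 + \<theta>)) T z"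

lemma stage_step:
  assumes z: "z \<in> Rsp d"
  shows "finite (set_pmf (stage z))" "set_pmf (stage z) \<subseteq> Rsp d"
    "expect (stage z) (\<lambda>y. nsq d (grad d F y) + 8 * L * F y) \<le> 8 * L * F z + \<epsilon> / 2"
proof -
  interpret quadratic_growth d "objective N P (reg z)" "grad d (objective N P (reg z))" L
    by (rule quadratic_growth_reg[OF z])
  obtain u where u: "u \<in> Rsp d" "\<And>y. y \<in> Rsp d \<Longrightarrow> objective N P (reg z) u \<le> objective N P (reg z) y"
    using minimizer_exists by blast
  interpret R: compressed_run d N P "reg z" L V u k c \<theta>
    by unfold_locales (use N P differentiable_reg[OF z] variance_reg[OF z] u k c \<theta>0 \<theta>_le V in auto)
  have eq: "stage z = map_pmf fst (R.run z T)"
    unfolding stage_def s_snag_ef_def R.\<gamma>_def R.\<eta>_def R.lam_def R.\<alpha>_def R.\<beta>_def ..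
  have sup: "finite (set_pmf (R.run z T))" "\<And>s. s \<in> set_pmf (R.run z T) \<Longrightarrow> R.valid_state s"
    using R.run_support[OF z] by auto
  show fin: "finite (set_pmf (stage z))" using sup unfolding eq by simp
  show sub: "set_pmf (stage z) \<subseteq> Rsp d"
  proof
    fix y assume "y \<in> set_pmf (stage z)"
    then obtain s where s: "s \<in> set_pmf (R.run z T)" "y = fst s" unfolding eq by auto
    then show "y \<in> Rsp d" using sup(2)[OF s(1)] by (cases s) (simp add: R.valid_state_def)
  qed
  define D where "D y = objective N P (reg z) y - objective N P (reg z) u" for y
  define Gu where "Gu = objective N P (reg z) u"
  have bound: "expect (stage z) D \<le> 1 / 10 * D z + 3 * \<epsilon> / (1000 * L)"
    unfolding eq D_def by (rule R.stage_bound[OF z noise1 noise2[folded R.\<gamma>_def] T])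
  \<comment> \<open>The gradient of \<open>F\<close> differs from that of the regularized objective
    by \<open>2 * L * (y - z)\<close>, and \<open>L * nsq d (\<lambda>j. y j - z j)\<close> is
    exactly the regularized value minus \<open>F y\<close>. So \<open>8 * L^2\<close> times the
    squared distance becomes a difference of function values, which fixes the coefficient
    \<open>8 * L\<close> of \<open>F\<close>.\<close>
  have pt: "nsq d (grad d F y) + 8 * L * F y \<le> 20 * L * D y + 8 * L * Gu" if y: "y \<in> Rsp d" for y
  proof -
    have g: "grad d F y = (\<lambda>j. 1 * grad d (objective N P (reg z)) y j + (- 2 * L) * (y j - z j))"
      unfolding grad_objective_reg[OF z y] by auto
    have "nsq d (grad d F y) \<le> 2 * nsq d (grad d (objective N P (reg z)) y) + 8 * L\<^sup>2 * nsq d (\<lambda>j. y j - z j)"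
      unfolding g
    proof (rule nsq_combination_le)
      fix a b :: real
      show "(1 * a + - 2 * L * b)\<^sup>2 \<le> 2 * a\<^sup>2 + 8 * L\<^sup>2 * b\<^sup>2"
        using square_sum_le[of a "- 2 * L * b"] by (simp add: power_mult_distrib)
    qed
    also have "\<dots> \<le> 2 * (6 * L * D y) + 8 * L\<^sup>2 * nsq d (\<lambda>j. y j - z j)"
      using gradient_gap[OF y u(2)] unfolding D_def by simp
    finally have n: "nsq d (grad d F y) \<le> 12 * L * D y + 8 * L * (L * nsq d (\<lambda>j. y j - z j))"
      by (simp add: power2_eq_square)
    have Ln: "L * nsq d (\<lambda>j. y j - z j) = D y + Gu - F y"
      unfolding D_def Gu_def objective_reg[OF z] edist_square by simp
    show ?thesis using n unfolding Ln by (simp add: algebra_simps)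
  qed
  have "expect (stage z) (\<lambda>y. nsq d (grad d F y) + 8 * L * F y) \<le> expect (stage z) (\<lambda>y. 20 * L * D y + 8 * L * Gu)"
    using pt sub by (intro expect_mono fin) auto
  also have "\<dots> = 20 * L * expect (stage z) D + 8 * L * Gu"
    by (simp add: expect_add[OF fin])
  also have "\<dots> \<le> 20 * L * (1 / 10 * D z + 3 * \<epsilon> / (1000 * L)) + 8 * L * Gu"
    using bound L by (intro add_right_mono mult_left_mono) auto
  \<comment> \<open>The reduction by 10 leaves \<open>2 * L * D z\<close>, well below
    \<open>8 * L * D z\<close>; and \<open>D z + Gu\<close> is \<open>F z\<close> because the
    regularizer vanishes at its centre.\<close>
  also have "\<dots> = 8 * L * (D z + Gu) - 6 * (L * D z) + 3 / 50 * \<epsilon>"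
    using L by (simp add: field_simps)
  also have "D z + Gu = F z"
    unfolding D_def Gu_def objective_reg[OF z] edist_def enorm_def L2_set_def by simp
  also have "8 * L * F z - 6 * (L * D z) + 3 / 50 * \<epsilon> \<le> 8 * L * F z + \<epsilon> / 2"
  proof -
    have "0 \<le> L * D z" using u z L unfolding D_def by simp
    moreover have "0 \<le> \<epsilon>"
    proof -
      have "0 \<le> \<theta> * V / real P" using \<theta>0 V by simp
      then have "0 \<le> \<epsilon> / 10 ^ 5" using noise1 by (rule order_trans)
      then show ?thesis by simp
    qed
    ultimately show ?thesis by linarith
  qed
  finally show "expect (stage z) (\<lambda>y. nsq d (grad d F y) + 8 * L * F y) \<le> 8 * L * F z + \<epsilon> / 2" .
qed

abbreviation "stages x S \<equiv> reg_s_snag_ef d N P k (c * real k / real d) L f (\<lambda>_. 4 * \<theta>\<^sup>2 / L) (\<lambda>_. \<theta> / L)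
     (\<lambda>_. \<theta> / (2 + \<theta>)) (\<lambda>_. \<theta> / (1 + \<theta>)) T x S"

lemma stages_Suc: "stages x (Suc S) = bind_pmf (stages x S) (\<lambda>xs. bind_pmf (stage (last xs)) (\<lambda>y. return_pmf (xs @ [y])))"
  by (simp add: stage_def)

lemma stages_support:
  assumes x: "x \<in> Rsp d"
  shows "finite (set_pmf (stages x S)) \<and> (\<forall>xs\<in>set_pmf (stages x S). length xs = Suc S \<and> set xs \<subseteq> Rsp d)"
proof (induction S)
  case 0
  then show ?case using x by simp
next
  case (Suc S)
  have last: "last xs \<in> Rsp d" if "xs \<in> set_pmf (stages x S)" for xs
  proof -
    have "length xs = Suc S" "set xs \<subseteq> Rsp d" using Suc that by auto
    then show ?thesis by (metis last_in_set length_0_conv nat.distinct(1) subsetD)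
  qed
  show ?case unfolding stages_Suc
    using Suc last stage_step(1,2) by auto
qed

text \<open>Carrying \<open>8 * L * F (last xs)\<close> inside the expectation turns the telescoping
  sum into an induction: \<open>stage_step\<close> is applied conditionally on the past
  stages.\<close>

lemma stages_bound:
  assumes x: "x \<in> Rsp d"
  shows "expect (stages x S) (\<lambda>xs. (\<Sum>s=1..S. nsq d (grad d F (xs ! s))) + 8 * L * F (last xs)) \<le>
    8 * L * F x + real S * (\<epsilon> / 2)"
proof (induction S)
  case 0
  then show ?case by simp
next
  case (Suc S)
  have fin: "finite (set_pmf (stages x S))" and len: "\<And>xs. xs \<in> set_pmf (stages x S) \<Longrightarrow> length xs = Suc S"
    and sub: "\<And>xs. xs \<in> set_pmf (stages x S) \<Longrightarrow> set xs \<subseteq> Rsp d"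
    using stages_support[OF x, of S] by auto
  have last: "last xs \<in> Rsp d" if "xs \<in> set_pmf (stages x S)" for xs
    using len[OF that] sub[OF that] by (metis last_in_set length_0_conv nat.distinct(1) subsetD)
  define \<Sigma> where "\<Sigma> xs = (\<Sum>s=1..S. nsq d (grad d F (xs ! s)))" for xs
  have split: "(\<Sum>s=1..Suc S. nsq d (grad d F ((xs @ [y]) ! s))) + 8 * L * F (last (xs @ [y])) =
      \<Sigma> xs + (nsq d (grad d F y) + 8 * L * F y)" if "xs \<in> set_pmf (stages x S)" for xs y
  proof -
    have "(\<Sum>s=1..S. nsq d (grad d F ((xs @ [y]) ! s))) = \<Sigma> xs"
      unfolding \<Sigma>_def using len[OF that] by (intro sum.cong) (auto simp: nth_append)
    moreover have "(xs @ [y]) ! Suc S = y" using len[OF that] by (simp add: nth_append)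
    ultimately show ?thesis by simp
  qed
  have "expect (stages x (Suc S)) (\<lambda>xs. (\<Sum>s=1..Suc S. nsq d (grad d F (xs ! s))) + 8 * L * F (last xs)) =
      expect (stages x S) (\<lambda>xs. expect (stage (last xs)) (\<lambda>y.
        (\<Sum>s=1..Suc S. nsq d (grad d F ((xs @ [y]) ! s))) + 8 * L * F (last (xs @ [y]))))"
    unfolding stages_Suc using fin last stage_step(1)
    by (subst expect_bind, simp, simp, intro expect_cong, subst expect_bind) simp_all
  also have "\<dots> = expect (stages x S) (\<lambda>xs. \<Sigma> xs + expect (stage (last xs)) (\<lambda>y. nsq d (grad d F y) + 8 * L * F y))"
  proof (rule expect_cong)
    fix xs assume xs: "xs \<in> set_pmf (stages x S)"
    show "expect (stage (last xs)) (\<lambda>y. (\<Sum>s=1..Suc S. nsq d (grad d F ((xs @ [y]) ! s))) + 8 * L * F (last (xs @ [y]))) =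
        \<Sigma> xs + expect (stage (last xs)) (\<lambda>y. nsq d (grad d F y) + 8 * L * F y)"
      unfolding split[OF xs] using stage_step(1)[OF last[OF xs]]
      by (subst expect_add) simp_all
  qed
  also have "\<dots> \<le> expect (stages x S) (\<lambda>xs. \<Sigma> xs + (8 * L * F (last xs) + \<epsilon> / 2))"
    by (intro expect_mono fin add_left_mono stage_step(3) last)
  also have "\<dots> = expect (stages x S) (\<lambda>xs. \<Sigma> xs + 8 * L * F (last xs)) + \<epsilon> / 2"
    by (simp add: expect_add[OF fin])
  also have "\<dots> \<le> (8 * L * F x + real S * (\<epsilon> / 2)) + \<epsilon> / 2"
    using Suc unfolding \<Sigma>_def by simp
  also have "\<dots> = 8 * L * F x + real (Suc S) * (\<epsilon> / 2)" by (simp add: algebra_simps)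
  finally show ?case .
qed

theorem output_bound:
  assumes x: "x \<in> Rsp d" and m: "\<And>y. y \<in> Rsp d \<Longrightarrow> F_min \<le> F y" and S: "1 \<le> S" "16 * L * (F x - F_min) \<le> \<epsilon> * real S"
  shows "expect (reg_output d N P k (c * real k / real d) L f (\<lambda>_. 4 * \<theta>\<^sup>2 / L) (\<lambda>_. \<theta> / L)
     (\<lambda>_. \<theta> / (2 + \<theta>)) (\<lambda>_. \<theta> / (1 + \<theta>)) T S x) (\<lambda>y. (enorm d (grad d F y))\<^sup>2) \<le> \<epsilon>"
proof -
  have fin: "finite (set_pmf (stages x S))" and len: "\<And>xs. xs \<in> set_pmf (stages x S) \<Longrightarrow> length xs = Suc S"
    and sub: "\<And>xs. xs \<in> set_pmf (stages x S) \<Longrightarrow> set xs \<subseteq> Rsp d"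
    using stages_support[OF x, of S] by auto
  have last: "last xs \<in> Rsp d" if "xs \<in> set_pmf (stages x S)" for xs
    using len[OF that] sub[OF that] by (metis last_in_set length_0_conv nat.distinct(1) subsetD)
  define \<Sigma> where "\<Sigma> xs = (\<Sum>s=1..S. nsq d (grad d F (xs ! s)))" for xs
  have "expect (reg_output d N P k (c * real k / real d) L f (\<lambda>_. 4 * \<theta>\<^sup>2 / L) (\<lambda>_. \<theta> / L)
     (\<lambda>_. \<theta> / (2 + \<theta>)) (\<lambda>_. \<theta> / (1 + \<theta>)) T S x) (\<lambda>y. (enorm d (grad d F y))\<^sup>2) =
     expect (stages x S) (\<lambda>xs. expect (bind_pmf (pmf_of_set {1..S}) (\<lambda>s. return_pmf (xs ! s))) (\<lambda>y. nsq d (grad d F y)))"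
    unfolding reg_output_def enorm_square using fin S by (subst expect_bind) simp_all
  also have "\<dots> = expect (stages x S) (\<lambda>xs. 1 / real S * \<Sigma> xs)"
  proof (rule expect_cong)
    fix xs
    have "expect (bind_pmf (pmf_of_set {1..S}) (\<lambda>s. return_pmf (xs ! s))) (\<lambda>y. nsq d (grad d F y)) =
        expect (pmf_of_set {1..S}) (\<lambda>s. nsq d (grad d F (xs ! s)))"
      using S by (subst expect_bind) simp_all
    also have "\<dots> = 1 / real S * \<Sigma> xs" using S by (subst integral_pmf_of_set) (simp_all add: \<Sigma>_def)
    finally show "expect (bind_pmf (pmf_of_set {1..S}) (\<lambda>s. return_pmf (xs ! s))) (\<lambda>y. nsq d (grad d F y)) =
        1 / real S * \<Sigma> xs" .
  qed
  also have "\<dots> = 1 / real S * expect (stages x S) \<Sigma>" by simp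
  also have "\<dots> \<le> 1 / real S * (real S * \<epsilon>)"
  proof (rule mult_left_mono)
    have "expect (stages x S) (\<lambda>xs. \<Sigma> xs + 8 * L * F_min) \<le> expect (stages x S) (\<lambda>xs. \<Sigma> xs + 8 * L * F (last xs))"
      using L by (intro expect_mono fin add_left_mono mult_left_mono m last) auto
    also have "\<dots> \<le> 8 * L * F x + real S * (\<epsilon> / 2)"
      unfolding \<Sigma>_def by (rule stages_bound[OF x])
    finally have "expect (stages x S) \<Sigma> + 8 * L * F_min \<le> 8 * L * F x + real S * (\<epsilon> / 2)"
      by (simp add: expect_add[OF fin])
    \<comment> \<open>The 16 in \<open>S(2)\<close> bounds the total decrease
      \<open>8 * L * (F x - F_min)\<close> by \<open>real S * (\<epsilon> / 2)\<close>; the stage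
      errors take the other half.\<close>
    then show "expect (stages x S) \<Sigma> \<le> real S * \<epsilon>" using S(2) by (simp add: algebra_simps)
  qed simp
  also have "\<dots> = \<epsilon>" using S by simp
  finally show ?thesis .
qed

end

section \<open>Choice of the step size\<close>

lemma log_factor_ge_1:
  assumes "0 \<le> d" "0 \<le> P" "0 \<le> L" "0 \<le> V" "0 \<le> D" "0 < \<epsilon>"
  shows "1 \<le> log_factor d P L V D \<epsilon>"
proof -
  have "0 \<le> L * D / \<epsilon>" "0 \<le> V / \<epsilon>" using assms by auto
  then have "exp 1 \<le> exp 1 + d + P + L * D / \<epsilon> + V / \<epsilon>" using assms by linarith
  then have "ln (exp 1) \<le> ln (exp 1 + d + P + L * D / \<epsilon> + V / \<epsilon>)"
    by (intro ln_mono) (auto intro: less_le_trans[OF exp_gt_zero])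
  then show ?thesis by (simp add: log_factor_def)
qed

text \<open>
  With \<open>\<omega> = d / k\<close> and \<open>v = V / (P \<epsilon>)\<close>, the number of iterations of a stage is
  \<open>inverse_step \<omega> v\<close> up to constants and logarithms. The terms \<open>d\<^bsup>3/2\<^esup>\<close> and \<open>d\<^bsup>4/3\<^esup>\<close> of the rate
  are not needed, because the regularized objectives have condition number 3.
\<close>

definition inverse_step :: "real \<Rightarrow> real \<Rightarrow> real" where
  "inverse_step \<omega> v = 1 + v + \<omega> * (1 + v powr (1 / 4))"

lemma inverse_step_le_rate:
  assumes "0 < d" "0 < k" "0 < P" "0 \<le> L" "0 \<le> V" "0 \<le> D" "0 < \<epsilon>"
  shows "L * D / \<epsilon> * inverse_step (d / k) (V / (P * \<epsilon>)) \<le> rate d k P L V D \<epsilon>"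
proof -
  have "\<epsilon> powr (5 / 4) = \<epsilon> powr (1 + 1 / 4)" by simp
  also have "\<dots> = \<epsilon> * \<epsilon> powr (1 / 4)" using assms by (simp only: powr_add powr_one)
  finally have \<epsilon>: "\<epsilon> powr (5 / 4) = \<epsilon> * \<epsilon> powr (1 / 4)" .
  have v: "(V / (P * \<epsilon>)) powr (1 / 4) = V powr (1 / 4) / (P powr (1 / 4) * \<epsilon> powr (1 / 4))"
    using assms by (simp add: powr_divide powr_mult)
  have "L * D / \<epsilon> * inverse_step (d / k) (V / (P * \<epsilon>)) = L * D / \<epsilon> + V / P * (L * D / \<epsilon>\<^sup>2)
      + d / k * (L * D / \<epsilon>) + d / (k * P powr (1 / 4)) * (L * V powr (1 / 4) * D / \<epsilon> powr (5 / 4))"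
    unfolding inverse_step_def v \<epsilon> by (simp add: distrib_left power2_eq_square mult_ac)
  also have "\<dots> \<le> rate d k P L V D \<epsilon>"
    unfolding rate_def using assms
    by (intro add_mono order_refl mult_right_mono) auto
  finally show ?thesis .
qed

lemma powr_quarter_power4: "0 \<le> (v::real) \<Longrightarrow> (v powr (1 / 4)) ^ 4 = v"
  by (cases "v = 0") (auto simp: powr_power)

text \<open>A stage has to gain only a constant factor, so a fixed multiple of
  \<open>1 / \<theta>\<close> iterations is enough.\<close>

lemma contraction_power:
  fixes \<theta> :: real
  assumes "0 < \<theta>" "\<theta> \<le> 1" "6400 \<le> \<theta> * real T"
  shows "260 * (1 - \<theta> / 16) ^ T \<le> 1"
proof -
  have "(1 - \<theta> / 16) ^ T \<le> exp (- (\<theta> / 16)) ^ T"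
    using assms exp_ge_add_one_self[of "- (\<theta> / 16)"] by (intro power_mono) auto
  also have "\<dots> = exp (- (\<theta> * real T / 16))"
    by (simp add: exp_of_nat_mult[symmetric] mult.commute)
  also have "\<dots> \<le> exp (- 400)" using assms by simp
  finally have 1: "(1 - \<theta> / 16) ^ T \<le> exp (- 400)" .
  have "401 \<le> exp (400 :: real)" using exp_ge_add_one_self[of 400] by simp
  then have "401 * exp (- 400 :: real) \<le> exp 400 * exp (- 400)" by (intro mult_right_mono) auto
  then have "401 * exp (- 400 :: real) \<le> 1" by (simp add: mult_exp_exp)
  then show ?thesis using 1 exp_gt_zero[of "- 400 :: real"] by linarith
qed

lemma nat_ceiling_le_double: "1 \<le> (y::real) \<Longrightarrow> real (nat \<lceil>y\<rceil>) \<le> 2 * y"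
  by linarith

text \<open>Each condition is enforced by one summand of \<open>inverse_step\<close>: 1,
  \<open>\<omega>\<close>, \<open>v\<close> and \<open>\<omega> * v powr (1 / 4)\<close>, in this
  order. The last is the fourth root of the fourth-power noise condition.\<close>

lemma step_size_conditions:
  fixes c \<omega> v \<theta> :: real
  assumes c: "0 < c" "c \<le> 1" and \<omega>: "0 < \<omega>" and v: "0 \<le> v"
    and \<theta>: "\<theta> = c / 10 ^ 5 / inverse_step \<omega> v"
  shows "0 < \<theta>" "\<theta> \<le> 1" "\<theta> \<le> c / \<omega> / 10 ^ 5" "\<theta> * v \<le> 1 / 10 ^ 5" "(\<theta> / (c / \<omega>)) ^ 4 * v \<le> 1 / 10 ^ 20"
proof -
  define R where "R = inverse_step \<omega> v"
  have R: "1 \<le> R" "v \<le> R" "\<omega> \<le> R" "\<omega> * v powr (1 / 4) \<le> R"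
    using \<omega> v by (auto simp: R_def inverse_step_def distrib_left)
  show "0 < \<theta>" using c R by (simp add: \<theta> R_def[symmetric])
  have "c / R \<le> 1 / 1" using c R by (intro frac_le) auto
  then show "\<theta> \<le> 1" by (simp add: \<theta> R_def[symmetric])
  have "c / R \<le> c / \<omega>" using c R \<omega> by (intro divide_left_mono) auto
  then show "\<theta> \<le> c / \<omega> / 10 ^ 5" by (simp add: \<theta> R_def[symmetric])
  have "c * (v / R) \<le> 1 * 1" using c R v by (intro mult_mono) (auto simp: field_simps)
  then show "\<theta> * v \<le> 1 / 10 ^ 5" by (simp add: \<theta> R_def[symmetric])
  have "(\<theta> / (c / \<omega>)) ^ 4 * v = (1 / 10 ^ 5 * (\<omega> * v powr (1 / 4) / R)) ^ 4"
    using c powr_quarter_power4[OF v]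
    by (simp add: \<theta> R_def[symmetric] power_mult_distrib power_divide)
  also have "\<dots> \<le> (1 / 10 ^ 5 * 1) ^ 4"
    using R \<omega> by (intro power_mono mult_left_mono) auto
  also have "\<dots> = 1 / 10 ^ 20" by (simp add: power_divide)
  finally show "(\<theta> / (c / \<omega>)) ^ 4 * v \<le> 1 / 10 ^ 20" .
qed

text \<open>The claim with explicit constants. The step size depends on the parameters alone and is
  fixed before \<open>f\<close> and the points, hence uniform over all problem instances.\<close>

lemma complexity_bound:
  fixes d N P k a :: nat and c A B L V \<Delta> \<epsilon> :: real
  assumes "0 < c \<and> c \<le> 1 / 10" and A: "12800 \<le> A" and B: "16 \<le> B"
    and "1 \<le> d \<and> 1 \<le> N \<and> 1 \<le> P \<and> even k \<and> 1 \<le> k div 2 \<and> k div 2 \<le> d \<and>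
        0 < L \<and> 0 \<le> V \<and> 0 \<le> \<Delta> \<and> 0 < \<epsilon>"
  shows "\<exists>\<eta>>0.
          let \<sigma> = L;
              lam = 1 / 2 * sqrt (\<eta> / \<sigma>);
              \<alpha> = lam * \<sigma> / (2 + lam * \<sigma>);
              \<beta> = lam * \<sigma> / (1 + lam * \<sigma>);
              \<gamma> = c * real k / real d;
              \<Lambda> = log_factor (real d) (real P) L V \<Delta> \<epsilon>;
              T = nat \<lceil>A * \<Lambda> ^ a / sqrt (\<eta> * L)\<rceil>;
              S = nat \<lceil>B * (1 + L * \<Delta> / \<epsilon>)\<rceil>
          in
            real (S * T) \<le> 4 * 10 ^ 5 * A * B / c * \<Lambda> ^ a * rate (real d) (real k) (real P) L V (max \<Delta> (\<epsilon> / L)) \<epsilon> \<and>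
            (\<forall>(f :: nat \<Rightarrow> nat \<Rightarrow> rvec \<Rightarrow> real) x_in x_star.
              let F = objective N P f in
              (\<forall>i\<in>{1..N}. \<forall>p\<in>{1..P}. differentiable_on_Rsp d (f i p)) \<and>
              x_in \<in> Rsp d \<and>
              x_star \<in> Rsp d \<and> (\<forall>x\<in>Rsp d. F x_star \<le> F x) \<and>
              smooth d L F \<and> bounded_variance d N P V f \<and>
              \<Delta> = F x_in - F x_star \<longrightarrow>
              measure_pmf.expectation
                (reg_output d N P k \<gamma> \<sigma> f (\<lambda>_. \<eta>) (\<lambda>_. lam) (\<lambda>_. \<alpha>) (\<lambda>_. \<beta>) T S x_in)
                (\<lambda>x_out. (enorm d (grad d F x_out))\<^sup>2) \<le> \<epsilon>)"
proof -
  have c: "0 < c" "c \<le> 1 / 10"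
    and d: "1 \<le> d" and N: "1 \<le> N" and P: "1 \<le> P" and k: "even k" "1 \<le> k div 2" "k div 2 \<le> d"
    and L: "0 < L" and V: "0 \<le> V" and \<Delta>: "0 \<le> \<Delta>" and \<epsilon>: "0 < \<epsilon>"
    using assms by auto
  define \<omega> where "\<omega> = real d / real k"
  define v where "v = V / (real P * \<epsilon>)"
  define R where "R = inverse_step \<omega> v"
  define \<theta> where "\<theta> = c / 10 ^ 5 / inverse_step \<omega> v"
  \<comment> \<open>Solving \<open>1 / 2 * sqrt (\<eta> / L) = \<theta> / L\<close> gives this
    value. Then \<open>sqrt (\<eta> * L) = 2 * \<theta>\<close>, which turns \<open>12800\<close>
    into the \<open>6400\<close> of \<open>contraction_power\<close>.\<close>
  define \<eta> where "\<eta> = 4 * \<theta>\<^sup>2 / L"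
  define \<Lambda> where "\<Lambda> = log_factor (real d) (real P) L V \<Delta> \<epsilon>"
  define T where "T = nat \<lceil>A * \<Lambda> ^ a / (2 * \<theta>)\<rceil>"
  define S where "S = nat \<lceil>B * (1 + L * \<Delta> / \<epsilon>)\<rceil>"
  have k0: "0 < real k" "0 < real d" using k d by (auto intro!: Nat.gr0I)
  have \<omega>: "0 < \<omega>" using k0 by (simp add: \<omega>_def)
  have v: "0 \<le> v" using V P \<epsilon> by (simp add: v_def)
  have c\<omega>: "c / \<omega> = c * real k / real d" by (simp add: \<omega>_def)
  note cond = step_size_conditions[OF c(1) _ \<omega> v \<theta>_def]
  have \<theta>: "0 < \<theta>" "\<theta> \<le> 1" "\<theta> \<le> c * real k / real d / 10 ^ 5" "\<theta> * v \<le> 1 / 10 ^ 5"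
    "(\<theta> / (c * real k / real d)) ^ 4 * v \<le> 1 / 10 ^ 20"
    using cond c unfolding c\<omega> by auto
  have vP: "x * V / real P = \<epsilon> * (x * v)" for x using P \<epsilon> by (simp add: v_def)
  have noise1: "\<theta> * V / real P \<le> \<epsilon> / 10 ^ 5"
    using mult_left_mono[OF \<theta>(4), of \<epsilon>] \<epsilon> unfolding vP by simp
  have noise2: "(\<theta> / (c * real k / real d)) ^ 4 * V / real P \<le> \<epsilon> / 10 ^ 20"
    using mult_left_mono[OF \<theta>(5), of \<epsilon>] \<epsilon> unfolding vP by simp
  have \<eta>0: "0 < \<eta>" using \<theta> L by (simp add: \<eta>_def)
  have lam: "1 / 2 * sqrt (\<eta> / L) = \<theta> / L"
  proof -
    have "\<eta> / L = (2 * \<theta> / L)\<^sup>2" by (simp add: \<eta>_def power2_eq_square)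
    then have "sqrt (\<eta> / L) = 2 * \<theta> / L" using \<theta> L by (intro real_sqrt_unique) auto
    then show ?thesis by simp
  qed
  have sq: "sqrt (\<eta> * L) = 2 * \<theta>"
  proof -
    have "\<eta> * L = (2 * \<theta>)\<^sup>2" using L by (simp add: \<eta>_def power2_eq_square)
    then show ?thesis using \<theta> by (intro real_sqrt_unique) auto
  qed
  have lamL: "\<theta> / L * L = \<theta>" using L by simp
  have \<Lambda>: "1 \<le> \<Lambda>" unfolding \<Lambda>_def using L V \<Delta> \<epsilon> by (intro log_factor_ge_1) auto
  have \<Lambda>a: "1 \<le> \<Lambda> ^ a" using \<Lambda> by simp
  have LD: "0 \<le> L * \<Delta> / \<epsilon>" using L \<Delta> \<epsilon> by simp
  have S_ge: "B * (1 + L * \<Delta> / \<epsilon>) \<le> real S" unfolding S_def by (rule real_nat_ceiling_ge)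
  have AT: "12800 * 1 \<le> A * \<Lambda> ^ a" using A \<Lambda>a by (intro mult_mono) auto
  have T_ge: "A * \<Lambda> ^ a / (2 * \<theta>) \<le> real T" unfolding T_def by (rule real_nat_ceiling_ge)
  then have "A * \<Lambda> ^ a \<le> 2 * (\<theta> * real T)" using \<theta> by (simp add: field_simps)
  then have T: "260 * (1 - \<theta> / 16) ^ T \<le> 1" using AT \<theta> by (intro contraction_power) auto
  have B1: "16 * (1 + L * \<Delta> / \<epsilon>) \<le> B * (1 + L * \<Delta> / \<epsilon>)" using B LD by (intro mult_right_mono) auto
  have ge_1: "1 \<le> s" if "16 * (1 + r) \<le> s" "0 \<le> r" for r s :: real
    using that by simp
  have S1: "1 \<le> S"
  proof -
    have "1 \<le> real S" by (rule ge_1[OF order_trans[OF B1 S_ge] LD])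
    then show ?thesis by simp
  qed
  have S2: "16 * L * \<Delta> \<le> \<epsilon> * real S"
  proof -
    have "16 * (L * \<Delta> / \<epsilon>) \<le> real S" using order_trans[OF B1 S_ge] by simp
    then show ?thesis using \<epsilon> by (simp add: field_simps)
  qed
  have count: "real (S * T) \<le> 4 * 10 ^ 5 * A * B / c * \<Lambda> ^ a * rate (real d) (real k) (real P) L V (max \<Delta> (\<epsilon> / L)) \<epsilon>"
  proof -
    define D where "D = max \<Delta> (\<epsilon> / L)"
    have D: "\<Delta> \<le> D" "\<epsilon> / L \<le> D" "0 \<le> D" using \<Delta> by (auto simp: D_def)
    have "L * \<Delta> \<le> L * D" "\<epsilon> \<le> L * D" using D L by (auto simp: pos_divide_le_eq mult.commute)
    then have "L * \<Delta> / \<epsilon> \<le> L * D / \<epsilon>" "1 \<le> L * D / \<epsilon>" using \<epsilon> by (auto intro: divide_right_mono)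
    \<comment> \<open>The summand 1, present because at least one stage is run, is absorbed since
      \<open>D \<ge> \<epsilon> / L\<close>. This factor 2 and the one from rounding
      \<open>S\<close> give the 4 in the constant; the one from rounding \<open>T\<close> cancels
      against \<open>2 * \<theta>\<close>.\<close>
    then have LD2: "1 + L * \<Delta> / \<epsilon> \<le> 2 * (L * D / \<epsilon>)"
      unfolding mult_2 by (intro add_mono)
    have "1 \<le> A * \<Lambda> ^ a / (2 * \<theta>)" using AT \<theta> by (simp add: field_simps)
    then have T_le: "real T \<le> 2 * (A * \<Lambda> ^ a / (2 * \<theta>))" unfolding T_def by (rule nat_ceiling_le_double)
    have "1 \<le> B * (1 + L * \<Delta> / \<epsilon>)" by (rule ge_1[OF B1 LD])
    then have S_le: "real S \<le> 2 * (B * (1 + L * \<Delta> / \<epsilon>))" unfolding S_def by (rule nat_ceiling_le_double)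
    have "real S \<le> 4 * B * (L * D / \<epsilon>)"
    proof -
      have "B * (1 + L * \<Delta> / \<epsilon>) \<le> B * (2 * (L * D / \<epsilon>))" using LD2 B by (intro mult_left_mono) auto
      then show ?thesis using S_le by simp
    qed
    then have "real S * real T \<le> (4 * B * (L * D / \<epsilon>)) * (2 * (A * \<Lambda> ^ a / (2 * \<theta>)))"
      using T_le B L D \<epsilon> by (intro mult_mono) auto
    also have "\<dots> = (4 * B * (L * D / \<epsilon>)) * (A * \<Lambda> ^ a) * (1 / \<theta>)" by simp
    also have "1 / \<theta> = 10 ^ 5 / c * R" using c by (simp add: \<theta>_def R_def)
    also have "(4 * B * (L * D / \<epsilon>)) * (A * \<Lambda> ^ a) * (10 ^ 5 / c * R) = 4 * 10 ^ 5 * A * B / c * \<Lambda> ^ a * (L * D / \<epsilon> * R)"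
      by (simp add: mult_ac)
    also have "\<dots> \<le> 4 * 10 ^ 5 * A * B / c * \<Lambda> ^ a * rate (real d) (real k) (real P) L V D \<epsilon>"
      unfolding R_def \<omega>_def v_def using k0 P L V D \<epsilon> A B c \<Lambda>a
      by (intro mult_left_mono inverse_step_le_rate) auto
    finally show ?thesis by (simp add: D_def)
  qed
  have conv: "measure_pmf.expectation (reg_output d N P k (c * real k / real d) L f (\<lambda>_. \<eta>) (\<lambda>_. \<theta> / L)
      (\<lambda>_. \<theta> / (2 + \<theta>)) (\<lambda>_. \<theta> / (1 + \<theta>)) T S x_in) (\<lambda>x. (enorm d (grad d (objective N P f) x))\<^sup>2) \<le> \<epsilon>"
    if f: "\<forall>i\<in>{1..N}. \<forall>p\<in>{1..P}. differentiable_on_Rsp d (f i p)" "x_in \<in> Rsp d"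
      "\<forall>x\<in>Rsp d. objective N P f x_star \<le> objective N P f x" "smooth d L (objective N P f)"
      "bounded_variance d N P V f" "\<Delta> = objective N P f x_in - objective N P f x_star"
    for f x_in x_star
  proof -
    interpret smooth_run d N P f L V k c \<theta> \<epsilon> T
      by unfold_locales (use N P L f k c \<theta> V noise1 noise2 T in auto)
    show ?thesis
      unfolding \<eta>_def using f S1 S2 by (intro output_bound[where F_min = "objective N P f x_star"]) auto
  qed
  \<comment> \<open>The step sizes are first rewritten through \<open>\<theta>\<close>, because
    \<open>T\<close> is defined with \<open>2 * \<theta>\<close> and can be folded only
    afterwards.\<close>
  show ?thesis
    unfolding Let_def
    by (rule exI[of _ \<eta>], rule conjI[OF \<eta>0], unfold lam sq lamL \<Lambda>_def[symmetric],
        unfold T_def[symmetric] S_def[symmetric], rule conjI[OF count], intro allI impI, elim conjE)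
      (rule conv)
qed

theorem theorem5p1:
  shows "\<exists>c\<^sub>0>0. \<forall>c. 0 < c \<and> c \<le> c\<^sub>0 \<longrightarrow>
    (\<exists>A\<^sub>0>0. \<exists>a\<^sub>0::nat. \<exists>B\<^sub>0>0. \<forall>A\<ge>A\<^sub>0. \<forall>a\<ge>a\<^sub>0. \<forall>B\<ge>B\<^sub>0. \<exists>C>0. \<exists>b::nat.
      \<forall>(d::nat) (N::nat) (P::nat) (k::nat) (L::real) (V::real) (\<Delta>::real) (\<epsilon>::real).
        1 \<le> d \<and> 1 \<le> N \<and> 1 \<le> P \<and> even k \<and> 1 \<le> k div 2 \<and> k div 2 \<le> d \<and>
        0 < L \<and> 0 \<le> V \<and> 0 \<le> \<Delta> \<and> 0 < \<epsilon> \<longrightarrow>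
        (\<exists>\<eta>>0.
          let \<sigma> = L;
              lam = 1 / 2 * sqrt (\<eta> / \<sigma>);
              \<alpha> = lam * \<sigma> / (2 + lam * \<sigma>);
              \<beta> = lam * \<sigma> / (1 + lam * \<sigma>);
              \<gamma> = c * real k / real d;
              \<Lambda> = log_factor (real d) (real P) L V \<Delta> \<epsilon>;
              T = nat \<lceil>A * \<Lambda> ^ a / sqrt (\<eta> * L)\<rceil>;
              S = nat \<lceil>B * (1 + L * \<Delta> / \<epsilon>)\<rceil>
          in
            real (S * T) \<le> C * \<Lambda> ^ b * rate (real d) (real k) (real P) L V (max \<Delta> (\<epsilon> / L)) \<epsilon> \<and>
            (\<forall>(f :: nat \<Rightarrow> nat \<Rightarrow> rvec \<Rightarrow> real) x_in x_star.
              let F = objective N P f in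
              (\<forall>i\<in>{1..N}. \<forall>p\<in>{1..P}. differentiable_on_Rsp d (f i p)) \<and>
              x_in \<in> Rsp d \<and>
              x_star \<in> Rsp d \<and> (\<forall>x\<in>Rsp d. F x_star \<le> F x) \<and>
              smooth d L F \<and> bounded_variance d N P V f \<and>
              \<Delta> = F x_in - F x_star \<longrightarrow>
              measure_pmf.expectation
                (reg_output d N P k \<gamma> \<sigma> f (\<lambda>_. \<eta>) (\<lambda>_. lam) (\<lambda>_. \<alpha>) (\<lambda>_. \<beta>) T S x_in)
                (\<lambda>x_out. (enorm d (grad d F x_out))\<^sup>2) \<le> \<epsilon>)))"
  apply (rule exI[of _ "1 / 10"], rule conjI, simp, intro allI impI)
  \<comment> \<open>The thresholds: \<open>12800\<close> serves \<open>contraction_power\<close>,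
    and 16 serves \<open>output_bound\<close>. The threshold 0 for the exponent reflects the
    constant reduction per stage.\<close>
  apply (rule exI[of _ 12800], rule conjI, simp, rule exI[of _ 0], rule exI[of _ 16], rule conjI, simp, intro allI impI)
  \<comment> \<open>\<open>C\<close> and \<open>b\<close> stay schematic until
    \<open>complexity_bound\<close> instantiates them to \<open>4 * 10 ^ 5 * A * B / c\<close> and
    \<open>a\<close>; the rotation postpones positivity of \<open>C\<close> until it is
    known.\<close>
  apply (rule exI, rule conjI[rotated], rule exI, intro allI impI, rule complexity_bound, assumption+)
  apply simp
  done

end
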